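(* Let $(X,A)$ be a nondegenerate $C^*$-correspondence and $G$ a locally compact Hausdorff space. The map $$(\psi,\mathrm{id}):(C_b(G,M(X)_s),C_b(G,M(A)_s))\rightarrow(M(X\otimes C_0(G)),M(A\otimes C_0(G)))$$ given by $$\psi(m)\cdot f=m\cdot f$$ for $m\in C_b(G,M(X)_s)$ and $f\in A\otimes C_0(G)$ is an isomorphism of $C^*$-correspondences.
   Context: A $C^*$-correspondence $(X,A)$ is a right Hilbert $A$-module $X$ with a homomorphism $\varphi_A:A\to\mathcal{L}(X)$; nondegenerate means $\varphi_A(A)X$ has dense span in $X$. The multiplier correspondence is $M(X)=\mathcal{L}(A,X)$ over $M(A)$ with $m\cdot a=ma$, $\langle m,n\rangle_{M(A)}=m^*n$, $\varphi_{M(A)}(a)m=\overline{\varphi_A}(a)m$ ($\overline{\varphi_A}$ the strict extension); $X\subseteq M(X)$ via $\xi\mapsto(a\mapsto\xi\cdot a)$. $M(X)_s$ is $M(X)$ with the strict topology: $m_i\to0$ iff $\|Tm_i\|\to0$ and $\|m_i\cdot a\|\to0$ for all $T\in\mathcal{K}(X)$, $a\in A$. Tensor products are exterior (Hilbert modules) and minimal ($C^*$-algebras); $X\otimes C_0(G)$ is a correspondence over $A\otimes C_0(G)$. $C_b(G,M(X)_s)$ is the Banach space of bounded continuous functions $G\to M(X)_s$ with sup-norm; it is a $C^*$-correspondence over the $C^*$-algebra $C_b(G,M(A)_s)$ with pointwise operations $(m\cdot l)(r)=m(r)\cdot l(r)$, $\langle m,n\rangle(r)=\langle m(r),n(r)\rangle_{M(A)}$,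 $(\varphi(l)m)(r)=\varphi_{M(A)}(l(r))m(r)$. $C_0(G,X)$ is the subspace of norm-continuous $X$-valued functions vanishing at infinity. One identifies $C_0(G,X)=X\otimes C_0(G)$, $C_0(G,A)=A\otimes C_0(G)$ and $C_b(G,M(A)_s)=M(A\otimes C_0(G))$; for $m\in C_b(G,M(X)_s)$ and $f\in C_0(G,A)$ the pointwise product $m\cdot f$ lies in $C_0(G,X)=X\otimes C_0(G)$, so $\psi(m)$ is to be the element of $M(X\otimes C_0(G))=\mathcal{L}(A\otimes C_0(G),X\otimes C_0(G))$ given by $f\mapsto m\cdot f$. An isomorphism of correspondences is a pair of bijections (linear map, $*$-homomorphism) preserving the left action and the inner product. *)

theory Defs
  imports "HOL-Analysis.Analysis"
begin

section \<open>Complex Banach spaces and C*-algebras\<close>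

class scaleC =
  fixes scaleC :: "complex \<Rightarrow> 'a \<Rightarrow> 'a"  (infixr \<open>*\<^sub>C\<close> 75)

class complex_normed_vector = scaleC + real_normed_vector +
  assumes scaleC_add_right: "c *\<^sub>C (x + y) = c *\<^sub>C x + c *\<^sub>C y"
    and scaleC_add_left: "(c + d) *\<^sub>C x = c *\<^sub>C x + d *\<^sub>C x"
    and scaleC_scaleC: "c *\<^sub>C (d *\<^sub>C x) = (c * d) *\<^sub>C x"
    and scaleC_of_real: "complex_of_real r *\<^sub>C x = r *\<^sub>R x"
    and norm_scaleC: "norm (c *\<^sub>C x) = cmod c * norm x"

class cbanach = complex_normed_vector + banach

class cstar_algebra = cbanach + real_normed_algebra +
  fixes star :: "'a \<Rightarrow> 'a"
  assumes scaleC_mult_left: "(c *\<^sub>C a) * b = c *\<^sub>C (a * b)"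
    and scaleC_mult_right: "a * (c *\<^sub>C b) = c *\<^sub>C (a * b)"
    and star_add: "star (a + b) = star a + star b"
    and star_scaleC: "star (c *\<^sub>C a) = cnj c *\<^sub>C star a"
    and star_mult: "star (a * b) = star b * star a"
    and star_star: "star (star a) = a"
    and norm_star_mult_self: "norm (star a * a) = (norm a)\<^sup>2"

instantiation complex :: cstar_algebra
begin

definition scaleC_complex :: "complex \<Rightarrow> complex \<Rightarrow> complex" where
  "scaleC_complex c z = c * z"

definition star_complex :: "complex \<Rightarrow> complex" where
  "star_complex = cnj"

instance
  by standard
    (auto simp: scaleC_complex_def star_complex_def algebra_simps norm_mult scaleR_conv_of_real
      power2_eq_square)

end

lemma bounded_linear_scaleC: "bounded_linear (\<lambda>x::'a::complex_normed_vector. c *\<^sub>C x)"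
proof (rule bounded_linear_intro[where K = "cmod c"])
  fix x y :: 'a and r :: real
  show "c *\<^sub>C (x + y) = c *\<^sub>C x + c *\<^sub>C y" by (rule scaleC_add_right)
  show "c *\<^sub>C (r *\<^sub>R x) = r *\<^sub>R (c *\<^sub>C x)"
    by (simp add: scaleC_of_real[symmetric] scaleC_scaleC mult.commute)
  show "norm (c *\<^sub>C x) \<le> norm x * cmod c" by (simp add: norm_scaleC mult.commute)
qed

lemma continuous_on_scaleC [continuous_intros]:
  fixes f :: "'g::topological_space \<Rightarrow> complex" and x :: "'a::complex_normed_vector"
  assumes "continuous_on S f"
  shows "continuous_on S (\<lambda>r. f r *\<^sub>C x)"
proof -
  have "bounded_linear (\<lambda>c. c *\<^sub>C x)"
    by (rule bounded_linear_intro[where K = "norm x"])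
      (auto simp: scaleC_add_left norm_scaleC scaleC_scaleC[symmetric] scaleR_conv_of_real
        scaleC_of_real)
  from bounded_linear.continuous_on[OF this assms] show ?thesis .
qed

lemma scaleC_one [simp]: "1 *\<^sub>C x = (x::'a::complex_normed_vector)"
  using scaleC_of_real[of 1 x] by simp

instantiation blinfun :: (real_normed_vector, complex_normed_vector) complex_normed_vector
begin

lift_definition scaleC_blinfun :: "complex \<Rightarrow> ('a \<Rightarrow>\<^sub>L 'b) \<Rightarrow> 'a \<Rightarrow>\<^sub>L 'b" is "\<lambda>c T x. c *\<^sub>C T x"
  by (intro bounded_linear_compose[OF bounded_linear_scaleC])

instance
proof
  fix c d :: complex and r :: real and S T :: "'a \<Rightarrow>\<^sub>L 'b"
  show "c *\<^sub>C (S + T) = c *\<^sub>C S + c *\<^sub>C T"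
    by (rule blinfun_eqI) (simp add: scaleC_blinfun.rep_eq blinfun.add_left scaleC_add_right)
  show "(c + d) *\<^sub>C T = c *\<^sub>C T + d *\<^sub>C T"
    by (rule blinfun_eqI) (simp add: scaleC_blinfun.rep_eq blinfun.add_left scaleC_add_left)
  show "c *\<^sub>C (d *\<^sub>C T) = (c * d) *\<^sub>C T"
    by (rule blinfun_eqI) (simp add: scaleC_blinfun.rep_eq scaleC_scaleC)
  show "complex_of_real r *\<^sub>C T = r *\<^sub>R T"
    by (rule blinfun_eqI) (simp add: scaleC_blinfun.rep_eq blinfun.scaleR_left scaleC_of_real)
  have le: "norm (c *\<^sub>C T) \<le> cmod c * norm T" for c and T :: "'a \<Rightarrow>\<^sub>L 'b"
  proof (rule norm_blinfun_bound)
    fix x show "norm (blinfun_apply (c *\<^sub>C T) x) \<le> cmod c * norm T * norm x"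
      using mult_left_mono[OF norm_blinfun[of T x], of "cmod c"]
      by (simp add: scaleC_blinfun.rep_eq norm_scaleC mult.assoc)
  qed simp
  show "norm (c *\<^sub>C T) = cmod c * norm T"
  proof (cases "c = 0")
    case True
    then show ?thesis using le[of 0 T] by simp
  next
    case False
    have "T = inverse c *\<^sub>C (c *\<^sub>C T)"
      using False by (intro blinfun_eqI) (simp add: scaleC_blinfun.rep_eq scaleC_scaleC)
    then have "norm T \<le> cmod (inverse c) * norm (c *\<^sub>C T)" using le by metis
    then have "cmod c * norm T \<le> norm (c *\<^sub>C T)"
      using False by (simp add: norm_inverse norm_divide field_simps)
    with le show ?thesis by (simp add: order_antisym)
  qed
qed

end


section \<open>Functions vanishing at infinity\<close>

definition c0_set :: "('g::topological_space \<Rightarrow> 'x::real_normed_vector) set" where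
  "c0_set = {f. continuous_on UNIV f \<and>
     (\<forall>e>0. \<exists>K. compact K \<and> (\<forall>r. r \<notin> K \<longrightarrow> norm (f r) < e))}"

typedef (overloaded) ('g, 'x) c0 = "c0_set :: ('g::topological_space \<Rightarrow> 'x::real_normed_vector) set"
  morphisms c0_apply Abs_c0
  by (rule exI[of _ "\<lambda>_. 0"]) (auto simp: c0_set_def intro!: exI[of _ "{}"])

setup_lifting type_definition_c0

lemma c0_eqI: "(\<And>r. c0_apply f r = c0_apply g r) \<Longrightarrow> f = g"
  by (metis c0_apply_inject ext)

lemma c0_setI:
  assumes "continuous_on UNIV f"
    and "\<And>e. e > 0 \<Longrightarrow> \<exists>K. compact K \<and> (\<forall>r. r \<notin> K \<longrightarrow> norm (f r) < e)"
  shows "f \<in> c0_set"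
  using assms by (auto simp: c0_set_def)

lemma c0_continuous: "f \<in> c0_set \<Longrightarrow> continuous_on UNIV f"
  by (simp add: c0_set_def)

lemma c0_vanishes:
  "f \<in> c0_set \<Longrightarrow> e > 0 \<Longrightarrow> \<exists>K. compact K \<and> (\<forall>r. r \<notin> K \<longrightarrow> norm (f r) < e)"
  by (simp add: c0_set_def)

lemma c0_bdd: "f \<in> c0_set \<Longrightarrow> \<exists>B. \<forall>r. norm (f r) \<le> B"
proof -
  assume f: "f \<in> c0_set"
  obtain K where K: "compact K" "\<And>r. r \<notin> K \<Longrightarrow> norm (f r) < 1"
    using c0_vanishes[OF f, of 1] by auto
  have "compact (f ` K)"
    using K(1) c0_continuous[OF f] continuous_on_subset compact_continuous_image by blast
  then obtain B where "\<And>r. r \<in> K \<Longrightarrow> norm (f r) \<le> B"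
    by (meson bounded_iff compact_imp_bounded image_eqI)
  then have "norm (f r) \<le> max B 1" for r
    using K(2)[of r] by (cases "r \<in> K") fastforce+
  then show ?thesis by blast
qed

lemma c0_dominated:
  assumes f: "f \<in> c0_set" and h: "continuous_on UNIV h" and le: "\<And>r. norm (h r) \<le> C * norm (f r)"
  shows "h \<in> c0_set"
proof (rule c0_setI[OF h])
  fix e :: real assume e: "e > 0"
  have pos: "e / (\<bar>C\<bar> + 1) > 0" using e by simp
  obtain K where K: "compact K" "\<And>r. r \<notin> K \<Longrightarrow> norm (f r) < e / (\<bar>C\<bar> + 1)"
    using c0_vanishes[OF f pos] by auto
  have "norm (h r) < e" if "r \<notin> K" for r
  proof -
    have "norm (h r) \<le> C * norm (f r)" by (rule le)
    also have "\<dots> \<le> (\<bar>C\<bar> + 1) * norm (f r)" by (intro mult_right_mono) auto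
    also have "\<dots> < e" using K(2)[OF that] by (simp add: field_simps)
    finally show ?thesis .
  qed
  with K(1) show "\<exists>K. compact K \<and> (\<forall>r. r \<notin> K \<longrightarrow> norm (h r) < e)" by blast
qed

lemma c0_set_add:
  assumes f: "f \<in> c0_set" and g: "g \<in> c0_set"
  shows "(\<lambda>r. f r + g r) \<in> c0_set"
proof (rule c0_setI)
  show "continuous_on UNIV (\<lambda>r. f r + g r)"
    using f g by (intro continuous_intros c0_continuous)
  fix e :: real assume "e > 0"
  then have e: "e / 2 > 0" by simp
  obtain K L where K: "compact K" "\<And>r. r \<notin> K \<Longrightarrow> norm (f r) < e / 2"
    and L: "compact L" "\<And>r. r \<notin> L \<Longrightarrow> norm (g r) < e / 2"
    using c0_vanishes[OF f e] c0_vanishes[OF g e] by auto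
  have "norm (f r + g r) < e" if "r \<notin> K \<union> L" for r
    using K(2)[of r] L(2)[of r] that norm_triangle_ineq[of "f r" "g r"] by simp
  with compact_Un[OF K(1) L(1)]
  show "\<exists>K. compact K \<and> (\<forall>r. r \<notin> K \<longrightarrow> norm (f r + g r) < e)" by blast
qed

lemma c0_set_scaleR: "f \<in> c0_set \<Longrightarrow> (\<lambda>r. c *\<^sub>R f r) \<in> c0_set"
  by (rule c0_dominated[where f = f and C = "\<bar>c\<bar>"])
    (auto intro: continuous_on_scaleR[OF continuous_on_const] c0_continuous)

lemma c0_set_minus: "f \<in> c0_set \<Longrightarrow> (\<lambda>r. - f r) \<in> c0_set"
  using c0_set_scaleR[of f "- 1"] by simp

lemma c0_set_diff: "f \<in> c0_set \<Longrightarrow> g \<in> c0_set \<Longrightarrow> (\<lambda>r. f r - g r) \<in> c0_set"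
  using c0_set_add[OF _ c0_set_minus, of f g] by simp

lemma c0_set_scaleC:
  fixes f :: "'g::topological_space \<Rightarrow> 'x::complex_normed_vector"
  shows "f \<in> c0_set \<Longrightarrow> (\<lambda>r. c *\<^sub>C f r) \<in> c0_set"
  by (rule c0_dominated[where f = f and C = "cmod c"])
    (auto simp: norm_scaleC intro: bounded_linear.continuous_on[OF bounded_linear_scaleC]
      c0_continuous)

instantiation c0 :: (topological_space, real_normed_vector) real_normed_vector
begin

lift_definition zero_c0 :: "('a, 'b) c0" is "\<lambda>_. 0"
  by (rule c0_setI) (auto intro!: exI[of _ "{}"])

lift_definition plus_c0 :: "('a, 'b) c0 \<Rightarrow> ('a, 'b) c0 \<Rightarrow> ('a, 'b) c0" is "\<lambda>f g r. f r + g r"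
  by (rule c0_set_add)

lift_definition minus_c0 :: "('a, 'b) c0 \<Rightarrow> ('a, 'b) c0 \<Rightarrow> ('a, 'b) c0" is "\<lambda>f g r. f r - g r"
  by (rule c0_set_diff)

lift_definition uminus_c0 :: "('a, 'b) c0 \<Rightarrow> ('a, 'b) c0" is "\<lambda>f r. - f r"
  by (rule c0_set_minus)

lift_definition scaleR_c0 :: "real \<Rightarrow> ('a, 'b) c0 \<Rightarrow> ('a, 'b) c0" is "\<lambda>c f r. c *\<^sub>R f r"
  by (rule c0_set_scaleR)

definition norm_c0 :: "('a, 'b) c0 \<Rightarrow> real" where
  "norm_c0 f = (SUP r. norm (c0_apply f r))"

definition dist_c0 :: "('a, 'b) c0 \<Rightarrow> ('a, 'b) c0 \<Rightarrow> real" where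
  "dist_c0 f g = norm (f - g)"

definition sgn_c0 :: "('a, 'b) c0 \<Rightarrow> ('a, 'b) c0" where
  "sgn_c0 f = scaleR (inverse (norm f)) f"

definition uniformity_c0 :: "(('a, 'b) c0 \<times> ('a, 'b) c0) filter" where
  "uniformity_c0 = (INF e\<in>{0<..}. principal {(x, y). dist x y < e})"

definition open_c0 :: "('a, 'b) c0 set \<Rightarrow> bool" where
  "open_c0 S = (\<forall>x\<in>S. \<forall>\<^sub>F (x', y) in uniformity. x' = x \<longrightarrow> y \<in> S)"

lemma norm_c0_upper: "norm (c0_apply f r) \<le> norm f"
proof -
  have "bdd_above (range (\<lambda>r. norm (c0_apply f r)))"
    using c0_bdd[OF c0_apply[of f]] by (auto simp: bdd_above_def)
  then show ?thesis unfolding norm_c0_def by (rule cSUP_upper[OF UNIV_I])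
qed

lemma norm_c0_least: "(\<And>r. norm (c0_apply f r) \<le> B) \<Longrightarrow> norm f \<le> B"
  unfolding norm_c0_def by (rule cSUP_least) auto

instance
proof
  fix a b :: real and f g h :: "('a, 'b) c0"
  show "f + g + h = f + (g + h)" "f + g = g + f" "0 + f = f" "- f + f = 0" "f - g = f + - g"
    "a *\<^sub>R (f + g) = a *\<^sub>R f + a *\<^sub>R g" "(a + b) *\<^sub>R f = a *\<^sub>R f + b *\<^sub>R f"
    "a *\<^sub>R b *\<^sub>R f = (a * b) *\<^sub>R f" "1 *\<^sub>R f = f"
    by (transfer; simp add: algebra_simps)+
  show "dist f g = norm (f - g)" "sgn f = scaleR (inverse (norm f)) f"
    by (simp_all add: dist_c0_def sgn_c0_def)
  show "uniformity = (INF e\<in>{0<..}. principal {(x, y :: ('a, 'b) c0). dist x y < e})"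
    by (rule uniformity_c0_def)
  show "open S = (\<forall>x\<in>S. \<forall>\<^sub>F (x', y) in uniformity. x' = x \<longrightarrow> y \<in> S)" for S :: "('a, 'b) c0 set"
    by (rule open_c0_def)
  show "(norm f = 0) = (f = 0)"
  proof
    assume "norm f = 0"
    then have "c0_apply f r = 0" for r using norm_c0_upper[of f r] by simp
    then show "f = 0" by (intro c0_eqI) (simp add: zero_c0.rep_eq)
  qed (simp add: norm_c0_def zero_c0.rep_eq)
  show "norm (f + g) \<le> norm f + norm g"
    by (rule norm_c0_least) (auto simp: plus_c0.rep_eq intro: norm_triangle_mono norm_c0_upper)
  have le: "norm (a *\<^sub>R f) \<le> \<bar>a\<bar> * norm f" for a and f :: "('a, 'b) c0"
    by (rule norm_c0_least) (auto simp: scaleR_c0.rep_eq intro!: mult_left_mono norm_c0_upper)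
  show "norm (a *\<^sub>R f) = \<bar>a\<bar> * norm f"
  proof (cases "a = 0")
    case True
    then show ?thesis using le[of a f] norm_c0_upper[of "a *\<^sub>R f" undefined]
      by (metis abs_zero le_zero_eq mult_zero_left norm_ge_zero order_antisym order_trans)
  next
    case False
    have "f = inverse a *\<^sub>R (a *\<^sub>R f)"
      using False by (intro c0_eqI) (simp add: scaleR_c0.rep_eq)
    then have "norm f \<le> \<bar>inverse a\<bar> * norm (a *\<^sub>R f)" using le by metis
    then have "\<bar>a\<bar> * norm f \<le> norm (a *\<^sub>R f)" using False by (simp add: field_simps)
    with le show ?thesis by (simp add: order_antisym)
  qed
qed

end

instantiation c0 :: (topological_space, complex_normed_vector) complex_normed_vector
begin

lift_definition scaleC_c0 :: "complex \<Rightarrow> ('a, 'b) c0 \<Rightarrow> ('a, 'b) c0" is "\<lambda>c f r. c *\<^sub>C f r"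
  by (rule c0_set_scaleC)

instance
proof
  fix c d :: complex and r :: real and f g :: "('a, 'b) c0"
  show "c *\<^sub>C (f + g) = c *\<^sub>C f + c *\<^sub>C g" by transfer (simp add: scaleC_add_right)
  show "(c + d) *\<^sub>C f = c *\<^sub>C f + d *\<^sub>C f" by transfer (simp add: scaleC_add_left)
  show "c *\<^sub>C d *\<^sub>C f = (c * d) *\<^sub>C f" by transfer (simp add: scaleC_scaleC)
  show "complex_of_real r *\<^sub>C f = r *\<^sub>R f" by transfer (simp add: scaleC_of_real)
  have le: "norm (c *\<^sub>C f) \<le> cmod c * norm f" for c and f :: "('a, 'b) c0"
    by (rule norm_c0_least)
      (auto simp: scaleC_c0.rep_eq norm_scaleC intro!: mult_left_mono norm_c0_upper)
  show "norm (c *\<^sub>C f) = cmod c * norm f"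
  proof (cases "c = 0")
    case True
    then show ?thesis using le[of 0 f] by simp
  next
    case False
    have "f = inverse c *\<^sub>C (c *\<^sub>C f)"
      using False by (intro c0_eqI) (simp add: scaleC_c0.rep_eq scaleC_scaleC)
    then have "norm f \<le> cmod (inverse c) * norm (c *\<^sub>C f)" using le by metis
    then have "cmod c * norm f \<le> norm (c *\<^sub>C f)"
      using False by (simp add: norm_inverse norm_divide field_simps)
    with le show ?thesis by (simp add: order_antisym)
  qed
qed

end

instance c0 :: (topological_space, cbanach) cbanach
proof
  fix f :: "nat \<Rightarrow> ('a, 'b) c0"
  assume C: "Cauchy f"
  have nd: "dist (c0_apply (f m) r) (c0_apply (f n) r) \<le> dist (f m) (f n)" for m n r
    using norm_c0_upper[of "f m - f n" r] by (simp add: minus_c0.rep_eq dist_norm)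
  have "\<exists>N. \<forall>m\<ge>N. \<forall>n\<ge>N. \<forall>r. dist (c0_apply (f m) r) (c0_apply (f n) r) < e" if "e > 0" for e
    using C that nd unfolding Cauchy_def by (meson le_less_trans)
  then have "\<exists>l. uniform_limit UNIV (\<lambda>n. c0_apply (f n)) l sequentially"
    using uniformly_convergent_eq_cauchy[of "\<lambda>_. True" "\<lambda>n. c0_apply (f n)"]
    unfolding uniform_limit_sequentially_iff by simp meson
  then obtain l where l: "uniform_limit UNIV (\<lambda>n. c0_apply (f n)) l sequentially" by blast
  have "l \<in> c0_set"
  proof (rule c0_setI)
    show "continuous_on UNIV l"
      by (rule uniform_limit_theorem[OF _ l]) (simp_all add: c0_continuous[OF c0_apply])
    fix e :: real assume "e > 0"
    then have e: "e / 2 > 0" by simp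
    obtain N where N: "\<And>r. dist (c0_apply (f N) r) (l r) < e / 2"
      using l e unfolding uniform_limit_sequentially_iff by blast
    obtain K where K: "compact K" "\<And>r. r \<notin> K \<Longrightarrow> norm (c0_apply (f N) r) < e / 2"
      using c0_vanishes[OF c0_apply e] by blast
    have "norm (l r) < e" if "r \<notin> K" for r
      using K(2)[OF that] N[of r] norm_triangle_sub[of "l r" "c0_apply (f N) r"]
      by (simp add: dist_norm norm_minus_commute)
    with K(1) show "\<exists>K. compact K \<and> (\<forall>r. r \<notin> K \<longrightarrow> norm (l r) < e)" by blast
  qed
  then obtain L where L: "c0_apply L = l" by (metis Abs_c0_inverse)
  have "f \<longlonglongrightarrow> L"
  proof (rule LIMSEQ_I)
    fix e :: real assume "e > 0"
    then have e: "e / 2 > 0" by simp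
    obtain N where N: "\<And>n r. n \<ge> N \<Longrightarrow> dist (c0_apply (f n) r) (l r) < e / 2"
      using l e unfolding uniform_limit_sequentially_iff by blast
    have "norm (f n - L) < e" if "n \<ge> N" for n
    proof -
      have "norm (f n - L) \<le> e / 2"
        by (rule norm_c0_least)
          (use N[OF that] in \<open>auto simp: minus_c0.rep_eq L dist_norm intro: less_imp_le\<close>)
      also have "\<dots> < e" using \<open>e > 0\<close> by simp
      finally show ?thesis .
    qed
    then show "\<exists>no. \<forall>n\<ge>no. norm (f n - L) < e" by blast
  qed
  then show "convergent f" by (rule convergentI)
qed

lemma norm_star [simp]: "norm (star a) = norm (a::'a::cstar_algebra)"
proof -
  have le: "norm a \<le> norm (star a)" for a :: 'a
  proof (cases "a = 0")
    case False
    have "norm a * norm a \<le> norm (star a) * norm a"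
      using norm_mult_ineq[of "star a" a] by (simp add: norm_star_mult_self power2_eq_square)
    then show ?thesis using False by simp
  qed simp
  from le[of a] le[of "star a"] show ?thesis by (simp add: star_star)
qed

lemma bounded_linear_star: "bounded_linear (star :: 'a \<Rightarrow> 'a::cstar_algebra)"
proof (rule bounded_linear_intro[where K = 1])
  fix x y :: 'a and r :: real
  show "star (x + y) = star x + star y" by (rule star_add)
  show "star (r *\<^sub>R x) = r *\<^sub>R star x"
    using star_scaleC[of "complex_of_real r" x] by (simp add: scaleC_of_real)
qed simp

instantiation c0 :: (topological_space, cstar_algebra) cstar_algebra
begin

lift_definition times_c0 :: "('a, 'b) c0 \<Rightarrow> ('a, 'b) c0 \<Rightarrow> ('a, 'b) c0" is "\<lambda>f g r. f r * g r"
proof -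
  fix f g :: "'a \<Rightarrow> 'b" assume f: "f \<in> c0_set" and g: "g \<in> c0_set"
  obtain B where B: "\<And>r. norm (f r) \<le> B" using c0_bdd[OF f] by blast
  show "(\<lambda>r. f r * g r) \<in> c0_set"
  proof (rule c0_dominated[OF g, where C = B])
    show "continuous_on UNIV (\<lambda>r. f r * g r)"
      using f g by (intro continuous_intros c0_continuous)
    fix r
    show "norm (f r * g r) \<le> B * norm (g r)"
      by (rule order_trans[OF norm_mult_ineq mult_right_mono[OF B]]) simp
  qed
qed

lift_definition star_c0 :: "('a, 'b) c0 \<Rightarrow> ('a, 'b) c0" is "\<lambda>f r. star (f r)"
  by (rule c0_dominated[where C = 1])
    (auto intro: bounded_linear.continuous_on[OF bounded_linear_star] c0_continuous)

instance
proof
  fix c :: complex and r :: real and a b d :: "('a, 'b) c0"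
  show "a * b * d = a * (b * d)" "(a + b) * d = a * d + b * d" "a * (b + d) = a * b + a * d"
    "r *\<^sub>R a * b = r *\<^sub>R (a * b)" "a * r *\<^sub>R b = r *\<^sub>R (a * b)"
    by (transfer; simp add: algebra_simps)+
  show "(c *\<^sub>C a) * b = c *\<^sub>C (a * b)" by transfer (simp add: scaleC_mult_left)
  show "a * (c *\<^sub>C b) = c *\<^sub>C (a * b)" by transfer (simp add: scaleC_mult_right)
  show "star (a + b) = star a + star b" by transfer (simp add: star_add)
  show "star (c *\<^sub>C a) = cnj c *\<^sub>C star a" by transfer (simp add: star_scaleC)
  show "star (a * b) = star b * star a" by transfer (simp add: star_mult)
  show "star (star a) = a" by transfer (simp add: star_star)
  show mult_le: "norm (a * b) \<le> norm a * norm b" for a b :: "('a, 'b) c0"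
    by (rule norm_c0_least)
      (auto simp: times_c0.rep_eq
        intro!: order_trans[OF norm_mult_ineq mult_mono] norm_c0_upper)
  have star_le: "norm (star a) \<le> norm a"
    by (rule norm_c0_least) (simp add: star_c0.rep_eq norm_c0_upper)
  show "norm (star a * a) = (norm a)\<^sup>2"
  proof (rule order_antisym)
    show "norm (star a * a) \<le> (norm a)\<^sup>2"
      using mult_le[of "star a" a] mult_right_mono[OF star_le, of "norm a"]
      by (simp add: power2_eq_square)
    have "norm a \<le> sqrt (norm (star a * a))"
    proof (rule norm_c0_least)
      fix r
      have "(norm (c0_apply a r))\<^sup>2 \<le> norm (star a * a)"
        using norm_c0_upper[of "star a * a" r]
        by (simp add: times_c0.rep_eq star_c0.rep_eq norm_star_mult_self)
      then show "norm (c0_apply a r) \<le> sqrt (norm (star a * a))" by (rule real_le_rsqrt)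
    qed
    then show "(norm a)\<^sup>2 \<le> norm (star a * a)"
      by (metis norm_ge_zero power_mono real_sqrt_pow2)
  qed
qed

end


section \<open>Hilbert modules and C*-correspondences\<close>

text \<open>The carriers of the module and of the coefficient algebra are types. Inner products are
  linear in the second variable.\<close>

record (overloaded) ('x, 'a) corr =
  ract :: "'x \<Rightarrow> 'a \<Rightarrow> 'x"
  ip :: "'x \<Rightarrow> 'x \<Rightarrow> 'a"
  phi :: "'a \<Rightarrow> 'x \<Rightarrow>\<^sub>L 'x"

definition cbilinear ::
  "('x::complex_normed_vector \<Rightarrow> 'y::complex_normed_vector \<Rightarrow> 'z::complex_normed_vector) \<Rightarrow> bool"
where
  "cbilinear u \<longleftrightarrow>
     (\<forall>x x' y. u (x + x') y = u x y + u x' y) \<and> (\<forall>x y y'. u x (y + y') = u x y + u x y') \<and>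
     (\<forall>c x y. u (c *\<^sub>C x) y = c *\<^sub>C u x y) \<and> (\<forall>c x y. u x (c *\<^sub>C y) = c *\<^sub>C u x y)"

text \<open>Since the norm of the type satisfies \<open>\<parallel>x\<parallel>\<^sup>2 = \<parallel>\<langle>x, x\<rangle>\<parallel>\<close>, definiteness of the inner product
  is automatic and completeness is part of the class \<^class>\<open>cbanach\<close>.\<close>

definition hilbert_module :: "('x::cbanach, 'a::cstar_algebra) corr \<Rightarrow> bool" where
  "hilbert_module X \<longleftrightarrow>
     cbilinear (ract X) \<and>
     (\<forall>x a b. ract X (ract X x a) b = ract X x (a * b)) \<and>
     (\<forall>x y z. ip X x (y + z) = ip X x y + ip X x z) \<and>
     (\<forall>x y c. ip X x (c *\<^sub>C y) = c *\<^sub>C ip X x y) \<and>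
     (\<forall>x y a. ip X x (ract X y a) = ip X x y * a) \<and>
     (\<forall>x y. star (ip X x y) = ip X y x) \<and>
     (\<forall>x. \<exists>b. ip X x x = star b * b) \<and>
     (\<forall>x. (norm x)\<^sup>2 = norm (ip X x x))"

definition adjointable ::
  "('x::cbanach, 'a::cstar_algebra) corr \<Rightarrow> ('y::cbanach, 'a) corr \<Rightarrow> ('x \<Rightarrow>\<^sub>L 'y) set"
where
  "adjointable X Y = {T. \<exists>S. \<forall>x y. ip Y (blinfun_apply T x) y = ip X x (blinfun_apply S y)}"

definition adjoint ::
  "('x::cbanach, 'a::cstar_algebra) corr \<Rightarrow> ('y::cbanach, 'a) corr \<Rightarrow> ('x \<Rightarrow>\<^sub>L 'y) \<Rightarrow> 'y \<Rightarrow>\<^sub>L 'x"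
where
  "adjoint X Y T = (THE S. \<forall>x y. ip Y (blinfun_apply T x) y = ip X x (blinfun_apply S y))"

text \<open>The real span suffices: the set of operators \<open>\<theta>\<^bsub>x,y\<^esub> = x \<cdot> \<langle>y, _\<rangle>\<close> is closed under
  multiplication by complex scalars.\<close>

definition compacts :: "('x::cbanach, 'a::cstar_algebra) corr \<Rightarrow> ('x \<Rightarrow>\<^sub>L 'x) set" where
  "compacts X = closure (span {T. \<exists>x y. \<forall>z. blinfun_apply T z = ract X x (ip X y z)})"

definition correspondence :: "('x::cbanach, 'a::cstar_algebra) corr \<Rightarrow> bool" where
  "correspondence X \<longleftrightarrow>
     hilbert_module X \<and>
     (\<forall>a. phi X a \<in> adjointable X X) \<and>
     (\<forall>a b. phi X (a + b) = phi X a + phi X b) \<and>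
     (\<forall>c a. phi X (c *\<^sub>C a) = c *\<^sub>C phi X a) \<and>
     (\<forall>a b. phi X (a * b) = phi X a o\<^sub>L phi X b) \<and>
     (\<forall>a. phi X (star a) = adjoint X X (phi X a))"

definition nondegenerate :: "('x::cbanach, 'a::cstar_algebra) corr \<Rightarrow> bool" where
  "nondegenerate X \<longleftrightarrow> closure (span {phi X a x |a x. True}) = UNIV"

definition self_corr :: "('a::cstar_algebra, 'a) corr" where
  "self_corr = \<lparr>ract = (*), ip = (\<lambda>a b. star a * b), phi = blinfun_mult_right\<rparr>"


section \<open>Multipliers and strict topologies\<close>

definition multipliers :: "('x::cbanach, 'a::cstar_algebra) corr \<Rightarrow> ('a \<Rightarrow>\<^sub>L 'x) set" where
  "multipliers X = adjointable self_corr X"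

text \<open>Initial topology for the maps \<open>m \<mapsto> T m\<close> (\<open>T\<close> compact, operator norm) and
  \<open>m \<mapsto> m \<cdot> a\<close>; under the inclusion of \<open>X\<close> in \<open>M(X)\<close> the multiplier \<open>m \<cdot> a\<close> is the element
  \<open>m a\<close> of \<open>X\<close>. For \<^const>\<open>self_corr\<close> this is the strict topology of the multiplier algebra.\<close>

definition strict :: "('x::cbanach, 'a::cstar_algebra) corr \<Rightarrow> ('a \<Rightarrow>\<^sub>L 'x) topology" where
  "strict X = pullback_topology (multipliers X)
     (\<lambda>m. (\<lambda>T\<in>compacts X. T o\<^sub>L m, \<lambda>a\<in>UNIV. blinfun_apply m a))
     (prod_topology (product_topology (\<lambda>_. euclidean) (compacts X))
                    (product_topology (\<lambda>_. euclidean) UNIV))"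

text \<open>Strict topology of \<open>L(X) = M(K(X))\<close>.\<close>

definition strict_L :: "('x::cbanach, 'a::cstar_algebra) corr \<Rightarrow> ('x \<Rightarrow>\<^sub>L 'x) topology" where
  "strict_L X = pullback_topology (adjointable X X)
     (\<lambda>S. (\<lambda>T\<in>compacts X. T o\<^sub>L S, \<lambda>T\<in>compacts X. S o\<^sub>L T))
     (prod_topology (product_topology (\<lambda>_. euclidean) (compacts X))
                    (product_topology (\<lambda>_. euclidean) (compacts X)))"

text \<open>The strictly continuous extension of \<open>\<phi>\<close> to the multiplier algebra, in which \<open>a\<close> sits as
  left multiplication by \<open>a\<close>. It exists when \<open>X\<close> is nondegenerate; extensionality fixes the
  irrelevant values outside the multiplier algebra.\<close>

definition strict_ext ::
  "('x::cbanach, 'a::cstar_algebra) corr \<Rightarrow> ('a \<Rightarrow>\<^sub>L 'a) \<Rightarrow> 'x \<Rightarrow>\<^sub>L 'x"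
where
  "strict_ext X = (THE h. h \<in> extensional (multipliers self_corr) \<and>
     continuous_map (strict self_corr) (strict_L X) h \<and>
     (\<forall>a. h (blinfun_mult_right a) = phi X a))"


section \<open>Correspondences with explicit carriers, and their isomorphisms\<close>

record 'l star_alg =
  acarrier :: "'l set"
  aadd :: "'l \<Rightarrow> 'l \<Rightarrow> 'l"
  ascale :: "complex \<Rightarrow> 'l \<Rightarrow> 'l"
  amult :: "'l \<Rightarrow> 'l \<Rightarrow> 'l"
  astar :: "'l \<Rightarrow> 'l"

record ('m, 'l) corr_on =
  coeffs :: "'l star_alg"
  mcarrier :: "'m set"
  madd :: "'m \<Rightarrow> 'm \<Rightarrow> 'm"
  mscale :: "complex \<Rightarrow> 'm \<Rightarrow> 'm"
  mract :: "'m \<Rightarrow> 'l \<Rightarrow> 'm"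
  mip :: "'m \<Rightarrow> 'm \<Rightarrow> 'l"
  mlact :: "'l \<Rightarrow> 'm \<Rightarrow> 'm"

definition star_iso :: "'k star_alg \<Rightarrow> 'l star_alg \<Rightarrow> ('k \<Rightarrow> 'l) \<Rightarrow> bool" where
  "star_iso B C \<rho> \<longleftrightarrow>
     bij_betw \<rho> (acarrier B) (acarrier C) \<and>
     (\<forall>a\<in>acarrier B. \<forall>b\<in>acarrier B. \<rho> (aadd B a b) = aadd C (\<rho> a) (\<rho> b)) \<and>
     (\<forall>c. \<forall>a\<in>acarrier B. \<rho> (ascale B c a) = ascale C c (\<rho> a)) \<and>
     (\<forall>a\<in>acarrier B. \<forall>b\<in>acarrier B. \<rho> (amult B a b) = amult C (\<rho> a) (\<rho> b)) \<and>
     (\<forall>a\<in>acarrier B. \<rho> (astar B a) = astar C (\<rho> a))"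

text \<open>Preservation of the right action is not listed: it follows from the preservation of the
  inner products.\<close>

definition corr_iso ::
  "('m, 'k) corr_on \<Rightarrow> ('n, 'l) corr_on \<Rightarrow> ('m \<Rightarrow> 'n) \<Rightarrow> ('k \<Rightarrow> 'l) \<Rightarrow> bool"
where
  "corr_iso X Y \<psi> \<rho> \<longleftrightarrow>
     star_iso (coeffs X) (coeffs Y) \<rho> \<and>
     bij_betw \<psi> (mcarrier X) (mcarrier Y) \<and>
     (\<forall>m\<in>mcarrier X. \<forall>n\<in>mcarrier X. \<psi> (madd X m n) = madd Y (\<psi> m) (\<psi> n)) \<and>
     (\<forall>c. \<forall>m\<in>mcarrier X. \<psi> (mscale X c m) = mscale Y c (\<psi> m)) \<and>
     (\<forall>m\<in>mcarrier X. \<forall>n\<in>mcarrier X. \<rho> (mip X m n) = mip Y (\<psi> m) (\<psi> n)) \<and>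
     (\<forall>l\<in>acarrier (coeffs X). \<forall>m\<in>mcarrier X. \<psi> (mlact X l m) = mlact Y (\<rho> l) (\<psi> m))"

definition mult_alg :: "('a::cstar_algebra \<Rightarrow>\<^sub>L 'a) star_alg" where
  "mult_alg = \<lparr>acarrier = multipliers self_corr, aadd = (+), ascale = scaleC, amult = (o\<^sub>L),
     astar = adjoint self_corr self_corr\<rparr>"

definition mult_corr ::
  "('x::cbanach, 'a::cstar_algebra) corr \<Rightarrow> ('a \<Rightarrow>\<^sub>L 'x, 'a \<Rightarrow>\<^sub>L 'a) corr_on"
where
  "mult_corr X = \<lparr>coeffs = mult_alg, mcarrier = multipliers X, madd = (+), mscale = scaleC,
     mract = (o\<^sub>L), mip = (\<lambda>m n. adjoint self_corr X m o\<^sub>L n),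
     mlact = (\<lambda>l m. strict_ext X l o\<^sub>L m)\<rparr>"

definition Cb_strict ::
  "('x::cbanach, 'a::cstar_algebra) corr \<Rightarrow> ('g::topological_space \<Rightarrow> 'a \<Rightarrow>\<^sub>L 'x) set"
where
  "Cb_strict X = {m. continuous_map euclidean (strict X) m \<and> bounded (range m)}"

definition Cb_alg :: "('g::topological_space \<Rightarrow> 'a::cstar_algebra \<Rightarrow>\<^sub>L 'a) star_alg" where
  "Cb_alg = \<lparr>acarrier = Cb_strict self_corr, aadd = (\<lambda>l k r. aadd mult_alg (l r) (k r)),
     ascale = (\<lambda>c l r. ascale mult_alg c (l r)), amult = (\<lambda>l k r. amult mult_alg (l r) (k r)),
     astar = (\<lambda>l r. astar mult_alg (l r))\<rparr>"

definition Cb_corr ::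
  "('x::cbanach, 'a::cstar_algebra) corr \<Rightarrow>
     ('g::topological_space \<Rightarrow> 'a \<Rightarrow>\<^sub>L 'x, 'g \<Rightarrow> 'a \<Rightarrow>\<^sub>L 'a) corr_on"
where
  "Cb_corr X = \<lparr>coeffs = Cb_alg, mcarrier = Cb_strict X,
     madd = (\<lambda>m n r. madd (mult_corr X) (m r) (n r)),
     mscale = (\<lambda>c m r. mscale (mult_corr X) c (m r)),
     mract = (\<lambda>m l r. mract (mult_corr X) (m r) (l r)),
     mip = (\<lambda>m n r. mip (mult_corr X) (m r) (n r)),
     mlact = (\<lambda>l m r. mlact (mult_corr X) (l r) (m r))\<rparr>"


section \<open>Tensor products\<close>

definition cstar_norm_on :: "'c::cstar_algebra set \<Rightarrow> ('c \<Rightarrow> real) \<Rightarrow> bool" where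
  "cstar_norm_on S \<gamma> \<longleftrightarrow>
     (\<forall>x\<in>S. 0 \<le> \<gamma> x \<and> (\<gamma> x = 0 \<longleftrightarrow> x = 0)) \<and>
     (\<forall>x\<in>S. \<forall>y\<in>S. \<gamma> (x + y) \<le> \<gamma> x + \<gamma> y) \<and>
     (\<forall>c. \<forall>x\<in>S. \<gamma> (c *\<^sub>C x) = cmod c * \<gamma> x) \<and>
     (\<forall>x\<in>S. \<forall>y\<in>S. \<gamma> (x * y) \<le> \<gamma> x * \<gamma> y) \<and>
     (\<forall>x\<in>S. \<gamma> (star x * x) = (\<gamma> x)\<^sup>2)"

text \<open>The target of \<open>t\<close> is the minimal tensor product, with \<open>t a b\<close> the elementary tensor: the
  span of the elementary tensors is a copy of the algebraic tensor product (fourth clause), it is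
  dense, and its norm is the least C*-norm. The cross-norm identity holds for every C*-norm on an
  algebraic tensor product; it is included as part of the notion of a C*-tensor norm.\<close>

definition min_tensor ::
  "('a::cstar_algebra \<Rightarrow> 'b::cstar_algebra \<Rightarrow> 'c::cstar_algebra) \<Rightarrow> bool"
where
  "min_tensor t \<longleftrightarrow>
     cbilinear t \<and>
     (\<forall>a a' b b'. t a b * t a' b' = t (a * a') (b * b')) \<and>
     (\<forall>a b. star (t a b) = t (star a) (star b)) \<and>
     (\<forall>(n::nat) a b. (\<forall>c. (\<Sum>i<n. c i *\<^sub>C b i) = 0 \<longrightarrow> (\<forall>i<n. c i = 0)) \<longrightarrow>
        (\<Sum>i<n. t (a i) (b i)) = 0 \<longrightarrow> (\<forall>i<n. a i = 0)) \<and>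
     closure (span {t a b |a b. True}) = UNIV \<and>
     (\<forall>a b. norm (t a b) = norm a * norm b) \<and>
     (\<forall>\<gamma>. cstar_norm_on (span {t a b |a b. True}) \<gamma> \<longrightarrow>
        (\<forall>x\<in>span {t a b |a b. True}. norm x \<le> \<gamma> x))"

text \<open>\<open>Z\<close> is the exterior tensor product of the correspondences \<open>X\<close> and \<open>Y\<close>, over the tensor
  product of the coefficient algebras given by \<open>t\<close>, with elementary tensors \<open>u x y\<close>. These
  conditions determine \<open>Z\<close> up to a unitary that is compatible with the elementary tensors.\<close>

definition exterior_tensor ::
  "('x::cbanach, 'a::cstar_algebra) corr \<Rightarrow> ('y::cbanach, 'b::cstar_algebra) corr \<Rightarrow>
     ('z::cbanach, 'c::cstar_algebra) corr \<Rightarrow> ('a \<Rightarrow> 'b \<Rightarrow> 'c) \<Rightarrow> ('x \<Rightarrow> 'y \<Rightarrow> 'z) \<Rightarrow> bool"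
where
  "exterior_tensor X Y Z t u \<longleftrightarrow>
     correspondence Z \<and> cbilinear u \<and>
     (\<forall>x x' y y'. ip Z (u x y) (u x' y') = t (ip X x x') (ip Y y y')) \<and>
     (\<forall>x y a b. ract Z (u x y) (t a b) = u (ract X x a) (ract Y y b)) \<and>
     (\<forall>x y a b. phi Z (t a b) (u x y) = u (phi X a x) (phi Y b y)) \<and>
     closure (span {u x y |x y. True}) = UNIV"

text \<open>The identification of \<open>C\<^sub>0(G, X)\<close> with \<open>X \<otimes> C\<^sub>0(G)\<close>, under which the function
  \<open>r \<mapsto> g(r) x\<close> becomes the elementary tensor \<open>u x g\<close>.\<close>

definition c0_tensor ::
  "('x::cbanach \<Rightarrow> ('g::topological_space, complex) c0 \<Rightarrow> 'z::cbanach) \<Rightarrow> ('g, 'x) c0 \<Rightarrow> 'z"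
where
  "c0_tensor u = (THE J. bounded_linear J \<and>
     (\<forall>x g. J (Abs_c0 (\<lambda>r. c0_apply g r *\<^sub>C x)) = u x g))"

definition pw :: "('g::topological_space \<Rightarrow> 'a::cbanach \<Rightarrow>\<^sub>L 'x::cbanach) \<Rightarrow> ('g, 'a) c0 \<Rightarrow> ('g, 'x) c0"
where
  "pw m f = Abs_c0 (\<lambda>r. m r (c0_apply f r))"

text \<open>The map \<open>\<psi>\<close>, as an operator from \<open>A \<otimes> C\<^sub>0(G)\<close> to \<open>X \<otimes> C\<^sub>0(G)\<close>. For \<open>X = A\<close> and
  \<open>u = t\<close> it is the identification of \<open>C\<^sub>b(G, M(A)\<^sub>s)\<close> with \<open>M(A \<otimes> C\<^sub>0(G))\<close>.\<close>

definition psi ::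
  "('a::cstar_algebra \<Rightarrow> ('g::topological_space, complex) c0 \<Rightarrow> 'c::cstar_algebra) \<Rightarrow>
     ('x::cbanach \<Rightarrow> ('g, complex) c0 \<Rightarrow> 'z::cbanach) \<Rightarrow> ('g \<Rightarrow> 'a \<Rightarrow>\<^sub>L 'x) \<Rightarrow> 'c \<Rightarrow>\<^sub>L 'z"
where
  "psi t u m = Blinfun (\<lambda>f. c0_tensor u (pw m (inv (c0_tensor t) f)))"

end

theory Submission
  imports Defs
begin

text \<open>Write \<open>J\<^sub>t : C\<^sub>0(G, A) \<rightarrow> A \<otimes> C\<^sub>0(G)\<close> and
  \<open>J\<^sub>u : C\<^sub>0(G, X) \<rightarrow> X \<otimes> C\<^sub>0(G)\<close> for the identifications. The sup norm is a C*-norm on the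
  algebraic tensor product, so \<open>J\<^sub>t\<close> is contractive by minimality; multiplying by bump functions and
  using the cross-norm identity it is isometric, and then so is \<open>J\<^sub>u\<close>, since it carries inner products
  to inner products. Conjugating by these isometries turns an adjointable operator
  \<open>N : A \<otimes> C\<^sub>0(G) \<rightarrow> X \<otimes> C\<^sub>0(G)\<close> into one between function spaces. Adjointability makes it local:
  the value of \<open>N f\<close> at \<open>r\<close> depends only on \<open>f r\<close>, so it is multiplication by a function
  \<open>m\<close>, and both \<open>m\<close> and \<open>m\<^sup>*\<close> are strongly continuous, which for bounded \<open>m\<close> is strict continuity.

  The left actions are compared through the extension \<open>l \<mapsto> (\<phi>(a) x \<mapsto> \<phi>(l a) x)\<close>, whose strict
  continuity on unbounded sets comes from Cohen factorization \<open>T = \<phi>(a) S\<close> of compact operators.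
  Functional calculus is replaced throughout by one fact: for self-adjoint \<open>h\<close> with
  \<open>\<parallel>h\<parallel>\<^sup>2 \<le> 3/4\<close> a square root of \<open>1 - h\<^sup>2\<close> is the fixed point of a contraction, so \<open>1 - 2 h\<^sup>2\<close>
  is the real part of a unitary and its Cesaro means produce approximate units.\<close>

section \<open>Norms and approximate units without spectral theory\<close>

text \<open>Elements of the unitization are written as 1 + w or 1 - f with w and f in the algebra
  itself, and contractivity of 1 - f stands in for the order relation 0 \<le> f \<le> 1. Locality
  has a simple source: transported to functions, <N f, xi> = star f * N' xi with N' the adjoint of N
  holds at every point, and at r its right side sees f only through its value f r. The same identity
  read the other way makes N' local. Cohen factorization is needed because a strictly convergent
  family of multipliers may be unbounded, so that density of the finite-rank operators in K(X) gives
  nothing. After writing T = S phi (star a) or T = phi b R, one seminorm of the strict topology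
  controls the whole expression. Maps out of spans of elementary tensors are handled as relations
  until a norm estimate shows that they are single-valued. Multipliers of A are the case X = A, u =
  t of multipliers of X, so what is shown for \<open>psi t u\<close> also serves the coefficient map
  \<open>psi t t\<close>. Constants such as 4 and 8 are not sharp; they only enter where uniform
  boundedness matters.\<close>

lemma scaleC_zero [simp]: "c *\<^sub>C (0::'a::complex_normed_vector) = 0"
  using bounded_linear.linear[OF bounded_linear_scaleC] by (rule linear_0)

lemma scaleC_minus [simp]: "c *\<^sub>C (- x::'a::complex_normed_vector) = - (c *\<^sub>C x)"
  using bounded_linear.linear[OF bounded_linear_scaleC] by (rule linear_neg)

lemma scaleC_diff: "c *\<^sub>C (x - y::'a::complex_normed_vector) = c *\<^sub>C x - c *\<^sub>C y"
  using bounded_linear.linear[OF bounded_linear_scaleC] by (rule linear_diff)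

lemma scaleC_uminus [simp]: "(- c) *\<^sub>C (x::'a::complex_normed_vector) = - (c *\<^sub>C x)"
  using scaleC_scaleC[of "- 1" c x] scaleC_of_real[of "- 1" "c *\<^sub>C x"] by simp

lemma scaleC_scaleR: "c *\<^sub>C (r *\<^sub>R x::'a::complex_normed_vector) = r *\<^sub>R (c *\<^sub>C x)"
  using bounded_linear.linear[OF bounded_linear_scaleC] by (rule linear_scale)

lemma scaleC_sum: "c *\<^sub>C (\<Sum>i\<in>I. f i::'a::complex_normed_vector) = (\<Sum>i\<in>I. c *\<^sub>C f i)"
  using bounded_linear.linear[OF bounded_linear_scaleC] by (rule linear_sum)

lemma star_simps [simp]:
  fixes a b :: "'a::cstar_algebra"
  shows "star 0 = (0::'a)" "star (- a) = - star a" "star (a - b) = star a - star b"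
    "star (r *\<^sub>R a) = r *\<^sub>R star a" "star (star a) = a" "star (a + b) = star a + star b"
    "star (a * b) = star b * star a" "star (sum f I) = (\<Sum>i\<in>I. star (f i) :: 'a)"
proof -
  interpret bounded_linear "star :: 'a \<Rightarrow> 'a" by (rule bounded_linear_star)
  show "star 0 = (0::'a)" "star (- a) = - star a" "star (a - b) = star a - star b"
    "star (r *\<^sub>R a) = r *\<^sub>R star a" "star (star a) = a" "star (a + b) = star a + star b"
    "star (a * b) = star b * star a" "star (sum f I) = (\<Sum>i\<in>I. star (f i) :: 'a)"
    by (simp_all add: zero neg diff scaleR sum star_star star_add star_mult)
qed

lemma norm_mult_star_self: "norm (a * star a) = (norm (a::'a::cstar_algebra))\<^sup>2"
  using norm_star_mult_self[of "star a"] by (simp add: star_star)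

text \<open>The element q is 1 - sqrt (1 - h^2): the last equation says (1 - q)^2 = 1 - h^2. It is
  the fixed point of q = (h^2 + q^2) / 2. The bound 3/4 on h^2 keeps the ball of radius 1/2
  invariant, since (3/4 + 1/4) / 2 = 1/2, and there the map is 1/2-Lipschitz. Self-adjointness and
  commutation with h are closed conditions, so the fixed point inherits them.\<close>

lemma selfadjoint_sqrt:
  fixes h :: "'a::cstar_algebra"
  assumes sa: "star h = h" and le: "(norm h)\<^sup>2 \<le> 3 / 4"
  obtains q where "star q = q" "q * h = h * q" "q + q = h * h + q * q"
proof -
  define S where "S = {q::'a. norm q \<le> 1 / 2 \<and> star q = q \<and> q * h = h * q}"
  define F where "F q = (1 / 2) *\<^sub>R (h * h + q * q)" for q :: 'a
  have nh: "norm (h * h) \<le> 3 / 4"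
    using le norm_star_mult_self[of h] sa by simp
  have "closed S"
    unfolding S_def
    by (intro closed_Collect_conj closed_Collect_le closed_Collect_eq continuous_intros
        bounded_linear.continuous_on[OF bounded_linear_star])
  then have "complete S" by (simp add: complete_eq_closed)
  moreover have "F ` S \<subseteq> S"
  proof clarify
    fix q assume q: "q \<in> S"
    have "norm (q * q) \<le> (1 / 2) * (1 / 2)"
      using q by (intro order_trans[OF norm_mult_ineq] mult_mono) (auto simp: S_def)
    then have "norm (h * h + q * q) \<le> 1"
      using norm_triangle_ineq[of "h * h" "q * q"] nh by linarith
    moreover have "q * q * h = h * (q * q)"
    proof -
      have "q * h = h * q" using q by (simp add: S_def)
      then show ?thesis by (metis mult.assoc)
    qed
    ultimately show "F q \<in> S"
      using q sa by (simp add: F_def S_def distrib_left distrib_right mult.assoc)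
  qed
  moreover have "dist (F p) (F q) \<le> (1 / 2) * dist p q" if "p \<in> S" "q \<in> S" for p q
  proof -
    have "F p - F q = (1 / 2) *\<^sub>R (p * (p - q) + (p - q) * q)"
      by (simp add: F_def algebra_simps)
    also have "norm \<dots> \<le> (1 / 2) * (norm p * norm (p - q) + norm (p - q) * norm q)"
      using norm_triangle_mono[OF norm_mult_ineq norm_mult_ineq] by auto
    also have "\<dots> = (1 / 2) * ((norm p + norm q) * norm (p - q))" by (simp add: algebra_simps)
    also have "\<dots> \<le> (1 / 2) * (1 * norm (p - q))"
      using that by (intro mult_left_mono mult_right_mono) (auto simp: S_def)
    finally show ?thesis by (simp add: dist_norm)
  qed
  moreover have "S \<noteq> {}" by (auto simp: S_def intro!: exI[of _ 0])
  ultimately obtain q where q: "q \<in> S" "F q = q"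
    using Banach_fix[of S "1 / 2" F] by auto
  have "q + q = h * h + q * q"
    using arg_cong[OF q(2), of "\<lambda>x. 2 *\<^sub>R x"] by (simp add: F_def scaleR_2)
  then show thesis using q(1) that by (auto simp: S_def)
qed

text \<open>\<open>1 + w\<close> is the unitary \<open>\<surd>(1 - h\<^sup>2) + i h\<close> of the unitization; both
  identities on \<open>w\<close> say so without a unit.\<close>

lemma selfadjoint_unitary:
  fixes h :: "'a::cstar_algebra"
  assumes sa: "star h = h" and le: "(norm h)\<^sup>2 \<le> 3 / 4"
  obtains w where "w + star w + star w * w = 0" "w + star w + w * star w = 0"
    "w - star w = 2 *\<^sub>R (\<i> *\<^sub>C h)" "(w + w + w * w) + (star w + star w + star w * star w) = - 4 *\<^sub>R (h * h)"
proof -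
  obtain q where q: "star q = q" "q * h = h * q" "q + q = h * h + q * q"
    using selfadjoint_sqrt[OF assms] by metis
  define k where "k = \<i> *\<^sub>C h"
  define w where "w = k - q"
  have k: "star k = - k" "k * k = - (h * h)" "q * k = k * q"
    using sa q(2) by (simp_all add: k_def star_scaleC scaleC_mult_left scaleC_mult_right scaleC_scaleC)
  have w': "star w = - k - q" by (simp add: w_def k q)
  have "w + star w = - (q + q)" by (simp add: w' w_def k(1) q(1))
  moreover have "star w * w = h * h + q * q" "w * star w = h * h + q * q"
    unfolding w' by (simp_all add: w_def algebra_simps k)
  \<comment> \<open>The fourth identity says that the squares of the unitary and of its adjoint add
    up to 2 - 4 h^2. Passing to squares removes the square root and leaves a polynomial in
    h.\<close>
  moreover have "w * w + star w * star w = 2 *\<^sub>R (q * q) - 2 *\<^sub>R (h * h)"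
    unfolding w' by (simp add: w_def algebra_simps k scaleR_2)
  moreover have "w - star w = 2 *\<^sub>R k" unfolding w' by (simp add: w_def scaleR_2)
  moreover have "(w + w + w * w) + (star w + star w + star w * star w) =
    2 *\<^sub>R (w + star w) + (w * w + star w * star w)" by (simp add: algebra_simps scaleR_2)
  ultimately have "(w + w + w * w) + (star w + star w + star w * star w) =
    - 2 *\<^sub>R (h * h + q * q) + (2 *\<^sub>R (q * q) - 2 *\<^sub>R (h * h))"
    by (simp only: q(3)) (simp add: algebra_simps)
  also have "\<dots> = - 4 *\<^sub>R (h * h)"
    by (simp add: scaleR_left_diff_distrib[symmetric] algebra_simps)
  finally show thesis using that[of w] \<open>w + star w = - (q + q)\<close> \<open>star w * w = h * h + q * q\<close>
     \<open>w * star w = h * h + q * q\<close> \<open>w - star w = 2 *\<^sub>R k\<close> q(3) by (simp add: k_def)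
qed

text \<open>In the unitization this bounds the norm of 1 - f by 1. Self-adjointness is not imposed,
  so the property survives products of the elements 1 - f.\<close>

definition unit_contraction :: "'a::cstar_algebra \<Rightarrow> bool" where
  "unit_contraction f \<longleftrightarrow> (\<forall>v. norm (v - v * f) \<le> norm v) \<and> (\<forall>v. norm (v - f * v) \<le> norm v)"

lemma unit_contractionD:
  assumes "unit_contraction f"
  shows "norm (v - v * f) \<le> norm v" "norm (v - f * v) \<le> norm v"
  using assms by (auto simp: unit_contraction_def)

text \<open>Testing on \<open>star f\<close>, the C*-identity and the triangle inequality bound the
  square of the norm by twice the norm.\<close>

lemma norm_unit_contraction:
  assumes "unit_contraction f"
  shows "norm f \<le> 2"
proof -
  have "norm f * norm f = norm (star f * f)"
    by (simp add: norm_star_mult_self power2_eq_square)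
  also have "\<dots> \<le> norm (star f - star f * f) + norm (star f)"
    by (metis add.commute norm_minus_commute norm_triangle_sub)
  also have "\<dots> \<le> 2 * norm f" using unit_contractionD(1)[OF assms, of "star f"] by simp
  finally show ?thesis by (metis mult_right_le_imp_le norm_ge_zero order_le_less zero_le_numeral)
qed

lemma unit_contraction_selfadjointI:
  fixes f :: "'a::cstar_algebra"
  assumes "star f = f" "\<And>v. norm (v - v * f) \<le> norm v"
  shows "unit_contraction f"
proof -
  have "norm (v - f * v) = norm (star v - star v * f)" for v
    using norm_star[of "v - f * v"] assms(1) by (simp del: norm_star)
  then show ?thesis using assms(2)[of "star _"] assms(2) by (auto simp: unit_contraction_def)
qed

lemma unit_contraction_zero: "unit_contraction 0"
  by (simp add: unit_contraction_def)

lemma unit_contraction_star: "unit_contraction f \<Longrightarrow> unit_contraction (star f)"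
proof -
  assume f: "unit_contraction f"
  have "norm (v - v * star f) = norm (star v - f * star v)"
    "norm (v - star f * v) = norm (star v - star v * f)" for v
    using norm_star[of "v - v * star f"] norm_star[of "v - star f * v"]
    by (simp_all del: norm_star)
  then show ?thesis using unit_contractionD[OF f, of "star _"] by (simp add: unit_contraction_def)
qed

text \<open>The reason is 1 - (f + g - f g) = (1 - f) (1 - g).\<close>

lemma unit_contraction_circle:
  assumes f: "unit_contraction f" and g: "unit_contraction g"
  shows "unit_contraction (f + g - f * g)"
proof -
  have "v - v * (f + g - f * g) = (v - v * f) - (v - v * f) * g"
    "v - (f + g - f * g) * v = (v - g * v) - f * (v - g * v)" for v
    by (simp_all add: algebra_simps)
  then show ?thesis
    unfolding unit_contraction_def by (metis unit_contractionD[OF f] unit_contractionD[OF g] order_trans)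
qed

text \<open>The element 1 - 2 h^2 is the mean of the squares of a unitary 1 + w and of its adjoint,
  and right multiplication by a unitary preserves the norm by the C*-identity.\<close>

lemma unit_contraction_square:
  fixes h :: "'a::cstar_algebra"
  assumes sa: "star h = h" and le: "(norm h)\<^sup>2 \<le> 3 / 4"
  shows "unit_contraction (2 *\<^sub>R (h * h))"
proof (rule unit_contraction_selfadjointI)
  fix v
  obtain w where w: "w + star w + w * star w = 0" "w + star w + star w * w = 0"
    "(w + w + w * w) + (star w + star w + star w * star w) = - 4 *\<^sub>R (h * h)"
    using selfadjoint_unitary[OF assms] by metis
  have iso: "norm (v + v * w) = norm v" if "w + star w + w * star w = 0" for v w :: 'a
  proof -
    have "(v + v * w) * star (v + v * w) = v * star v + v * (w + star w + w * star w) * star v"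
      by (simp add: algebra_simps)
    then have "(norm (v + v * w))\<^sup>2 = (norm v)\<^sup>2"
      by (simp add: norm_mult_star_self[symmetric] that del: star_simps)
    then show ?thesis by simp
  qed
  have w': "star w + star (star w) + star w * star (star w) = 0"
    using w(2) by (simp add: add.commute)
  define U V where "U v = v + v * w" and "V v = v + v * star w" for v
  have "norm (U (U v)) = norm v" "norm (V (V v)) = norm v" unfolding U_def V_def
    using iso[OF w(1)] iso[OF w'] by metis+
  moreover have "U (U v) + V (V v) = 2 *\<^sub>R v + v * ((w + w + w * w) + (star w + star w + star w * star w))"
    by (simp add: U_def V_def algebra_simps scaleR_2)
  then have "U (U v) + V (V v) = 2 *\<^sub>R (v - v * (2 *\<^sub>R (h * h)))"
    unfolding w(3) by (simp add: algebra_simps)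
  ultimately have "norm (2 *\<^sub>R (v - v * (2 *\<^sub>R (h * h)))) \<le> norm v + norm v"
    by (metis norm_triangle_ineq)
  then have "2 * norm (v - v * (2 *\<^sub>R (h * h))) \<le> norm v + norm v" unfolding norm_scaleR by simp
  then show "norm (v - v * 2 *\<^sub>R (h * h)) \<le> norm v" by linarith
qed (simp add: sa)

text \<open>\<open>1 - f k\<close> is the \<open>k\<close>-th power of the contraction \<open>T = 1 - 2 h\<^sup>2\<close> and \<open>1 - e\<close> its Cesaro
  mean of length \<open>n\<close>, so that \<open>(1 - T) (1 - e) = (1 - T\<^sup>n) / n\<close>.\<close>

lemma cesaro_unit:
  fixes h :: "'a::cstar_algebra"
  assumes sa: "star h = h" and le: "(norm h)\<^sup>2 \<le> 3 / 4" and n: "n > 0"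
  obtains e z where "unit_contraction e" "star e = e" "e * h = h * e" "e = h * z"
    "(norm (h - h * e))\<^sup>2 \<le> 1 / real n"
proof -
  define d where "d = 2 *\<^sub>R (h * h)"
  \<comment> \<open>The iteration encodes 1 - f (Suc k) = (1 - f k) (1 - d).\<close>
  define f where "f k = ((\<lambda>f. f + d - f * d) ^^ k) 0" for k :: nat
  have f_Suc: "f (Suc k) = f k + d - f k * d" and f_0: "f 0 = 0" for k by (simp_all add: f_def)
  have d: "unit_contraction d" unfolding d_def by (rule unit_contraction_square[OF sa le])
  have f: "unit_contraction (f k)" for k
    by (induction k) (simp_all add: f_0 f_Suc unit_contraction_zero unit_contraction_circle d)
  have fh: "f k * h = h * f k" for k
  proof (induction k)
    case (Suc k)
    have "d * h = h * d" by (simp add: d_def mult.assoc)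
    then show ?case using Suc by (simp add: f_Suc algebra_simps) (metis mult.assoc)
  qed (simp add: f_0)
  have fd: "f k * d = d * f k" for k
    by (simp add: d_def) (metis fh mult.assoc)
  have fs: "star (f k) = f k" for k
  proof (induction k)
    case (Suc k)
    have "star d = d" by (simp add: d_def sa)
    then show ?case using Suc fd[of k] by (simp add: f_Suc)
  qed (simp add: f_0)
  have "\<exists>z. f k = h * z" for k
  proof (induction k)
    case (Suc k)
    then obtain z where "f k = h * z" by blast
    then have "f (Suc k) = h * (z + 2 *\<^sub>R h - z * d)"
      by (simp add: f_Suc d_def algebra_simps)
    then show ?case by blast
  qed (auto simp: f_0 intro: exI[of _ 0])
  then obtain z where z: "\<And>k. f k = h * z k" by metis
  define e where "e = (1 / real n) *\<^sub>R (\<Sum>k<n. f k)"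
  have es: "star e = e" by (simp add: e_def fs)
  have eh: "e * h = h * e" by (simp add: e_def sum_distrib_left sum_distrib_right fh)
  have ez: "e = h * ((1 / real n) *\<^sub>R (\<Sum>k<n. z k))"
    by (simp add: e_def sum_distrib_left z)
  have e: "unit_contraction e"
  proof (rule unit_contraction_selfadjointI[OF es])
    fix v
    have "v - v * e = (1 / real n) *\<^sub>R (\<Sum>k<n. v - v * f k)"
      using n by (simp add: e_def sum_subtractf sum_distrib_left scaleR_diff_right sum_constant_scaleR)
    also have "norm \<dots> \<le> (1 / real n) * (\<Sum>k<n. norm v)"
      unfolding norm_scaleR using unit_contractionD(1)[OF f, of v]
      by (intro mult_mono sum_norm_le) auto
    finally show "norm (v - v * e) \<le> norm v" using n by simp
  qed
  \<comment> \<open>Telescoping: f (Suc k) - f k = d - f k * d. Summing up to n expresses n (d - d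
    e) by f n alone, whose norm is at most 2; this is where the factor 1/n comes from.\<close>
  have "f m = (\<Sum>k<m. d - f k * d)" for m
    by (induction m) (simp_all add: f_0 f_Suc)
  then have "f n = (\<Sum>k<n. d - f k * d)" .
  also have "\<dots> = real n *\<^sub>R d - (\<Sum>k<n. d * f k)"
    by (simp add: sum_subtractf fd sum_constant_scaleR)
  also have "(\<Sum>k<n. d * f k) = real n *\<^sub>R (d * e)"
    using n by (simp add: e_def sum_distrib_left)
  finally have "f n = real n *\<^sub>R (d - d * e)" by (simp add: scaleR_diff_right)
  then have "2 *\<^sub>R (h * h - h * h * e) = (1 / real n) *\<^sub>R f n"
    using n by (simp add: d_def scaleR_diff_right[symmetric])
  then have "2 * norm (h * h - h * h * e) = (1 / real n) * norm (f n)"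
    by (metis abs_numeral abs_of_nonneg norm_scaleR of_nat_0_le_iff zero_le_divide_1_iff)
  then have hh: "norm (h * h - h * h * e) \<le> 1 / real n"
    using mult_left_mono[OF norm_unit_contraction[OF f[of n]], of "1 / real n"] by simp
  \<comment> \<open>The estimate so far concerns h^2 (1 - e). Since e commutes with h, the square of
    h (1 - e) is h^2 (1 - e) times the contraction 1 - e, and the C*-identity yields a bound for h
    (1 - e) itself.\<close>
  have "(norm (h - h * e))\<^sup>2 = norm ((h - h * e) * (h - h * e))"
    using norm_star_mult_self[of "h - h * e"] by (simp add: sa es eh)
  also have "(h - h * e) * (h - h * e) = (h * h - h * h * e) - (h * h - h * h * e) * e"
    by (simp add: algebra_simps) (metis eh mult.assoc)
  also have "norm \<dots> \<le> 1 / real n" using unit_contractionD(1)[OF e] hh order_trans by blast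
  finally show thesis using that[OF e es eh ez] by blast
qed

text \<open>This is the preceding lemma after rescaling. The factorization \<open>e = b * z\<close>
  is kept for Hilbert modules: with b = <x, x> it turns x e into x <x, x z>, a vector in K(X)
  X.\<close>

lemma selfadjoint_local_unit:
  fixes b :: "'a::cstar_algebra"
  assumes sa: "star b = b" and \<epsilon>: "\<epsilon> > 0"
  obtains e z where "unit_contraction e" "star e = e" "e = b * z" "norm (b - b * e) < \<epsilon>"
proof -
  \<comment> \<open>With this factor the norm of h is at most 1/2; the summand 1 covers b =
    0.\<close>
  define c where "c = 1 / (2 * (norm b + 1))"
  define h where "h = c *\<^sub>R b"
  have c: "c > 0" by (simp add: c_def add_nonneg_pos)
  have "norm h \<le> 1 / 2"
    by (simp add: h_def c_def divide_simps) (smt (verit) norm_ge_zero)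
  then have "(norm h)\<^sup>2 \<le> (1 / 2)\<^sup>2" by (intro power_mono) auto
  then have le: "(norm h)\<^sup>2 \<le> 3 / 4" by (simp add: power2_eq_square)
  obtain n :: nat where n: "n > 0" "1 / real n < (c * \<epsilon>)\<^sup>2"
    using reals_Archimedean[of "(c * \<epsilon>)\<^sup>2"] c \<epsilon> by (metis inverse_eq_divide mult_pos_pos zero_less_Suc zero_less_power)
  obtain e z where e: "unit_contraction e" "star e = e" "e = h * z"
    "(norm (h - h * e))\<^sup>2 \<le> 1 / real n"
    using cesaro_unit[OF _ le n(1)] sa by (metis h_def star_simps(4))
  have "norm (h - h * e) < c * \<epsilon>"
    using e(4) n(2) c \<epsilon> by (metis less_eq_real_def mult_pos_pos order_le_less_trans power_less_imp_less_base)
  moreover have "h - h * e = c *\<^sub>R (b - b * e)" by (simp add: h_def scaleR_diff_right)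
  ultimately have "norm (b - b * e) < \<epsilon>" using c by simp
  moreover have "e = b * (c *\<^sub>R z)" by (simp add: e(3) h_def)
  ultimately show thesis using that e by blast
qed

text \<open>To include a new element a, a local unit f is chosen for the defect a - g a left by the
  old unit g. The new unit satisfies 1 - e = (1 - f) (1 - g), and the contraction 1 - f does not
  spoil the estimates already achieved by g.\<close>

lemma finite_left_unit:
  fixes B :: "'a::cstar_algebra set"
  assumes "finite B" "\<epsilon> > 0"
  shows "\<exists>e. unit_contraction e \<and> (\<forall>a\<in>B. norm (a - e * a) < \<epsilon>)"
  using assms(1)
proof (induction B)
  case empty
  then show ?case using unit_contraction_zero by auto
next
  case (insert a B)
  then obtain g where g: "unit_contraction g" "\<forall>a\<in>B. norm (a - g * a) < \<epsilon>" by blast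
  define b where "b = a - g * a"
  \<comment> \<open>Local units exist for self-adjoint elements only, hence b * star b; by the
    C*-identity the square of the norm of (1 - f) b is that of (1 - f) b (star b) (1 - f).\<close>
  obtain f where f: "unit_contraction f" "star f = f" "norm (b * star b - b * star b * f) < \<epsilon>\<^sup>2"
    by (rule selfadjoint_local_unit[of "b * star b" "\<epsilon>\<^sup>2"]) (use assms(2) in auto)
  have "(norm (b - f * b))\<^sup>2 = norm ((b - f * b) * star (b - f * b))"
    by (simp only: norm_mult_star_self)
  also have "(b - f * b) * star (b - f * b) = (b * star b - b * star b * f) - f * (b * star b - b * star b * f)"
    by (simp add: algebra_simps f(2))
  also have "norm \<dots> < \<epsilon>\<^sup>2" using unit_contractionD(2)[OF f(1)] f(3) by (rule order_le_less_trans)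
  finally have fb: "norm (b - f * b) < \<epsilon>"
    using assms(2) by (simp add: power_less_imp_less_base less_imp_le)
  have e: "x - (f + g - f * g) * x = (x - g * x) - f * (x - g * x)" for x
    by (simp add: algebra_simps)
  have "norm (x - (f + g - f * g) * x) < \<epsilon>" if "x \<in> insert a B" for x
    using that fb g(2) order_le_less_trans[OF unit_contractionD(2)[OF f(1)]]
    unfolding e by (auto simp: b_def)
  then show ?case using unit_contraction_circle[OF f(1) g(1)] by blast
qed

lemma finite_two_sided_unit:
  fixes B :: "'a::cstar_algebra set"
  assumes "finite B" "\<epsilon> > 0"
  shows "\<exists>e. unit_contraction e \<and> (\<forall>a\<in>B. norm (a - e * a) < \<epsilon> \<and> norm (a - a * e) < \<epsilon>)"
proof -
  obtain g where g: "unit_contraction g" "\<forall>a\<in>B. norm (a - g * a) < \<epsilon>"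
    using finite_left_unit[OF assms] by blast
  obtain f' where f': "unit_contraction f'" "\<forall>a\<in>star ` B. norm (a - f' * a) < \<epsilon>"
    using finite_left_unit[of "star ` B"] assms by blast
  define f where "f = star f'"
  have f: "unit_contraction f" unfolding f_def by (rule unit_contraction_star[OF f'(1)])
  have fB: "norm (a - a * f) < \<epsilon>" if "a \<in> B" for a
    using norm_star[of "a - a * f"] f'(2) that by (auto simp: f_def simp del: norm_star)
  have e: "x - (f + g - f * g) * x = (x - g * x) - f * (x - g * x)"
     "x - x * (f + g - f * g) = (x - x * f) - (x - x * f) * g" for x
    by (simp_all add: algebra_simps)
  have "norm (x - (f + g - f * g) * x) < \<epsilon> \<and> norm (x - x * (f + g - f * g)) < \<epsilon>" if "x \<in> B" for x
    using that fB[OF that] g(2) order_le_less_trans[OF unit_contractionD(2)[OF f]]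
      order_le_less_trans[OF unit_contractionD(1)[OF g(1)]]
    unfolding e by auto
  then show ?thesis using unit_contraction_circle[OF f g(1)] by blast
qed

text \<open>A filter replaces the usual net: its generating sets prescribe precision at one element,
  and \<open>finite_two_sided_unit\<close> shows that finite intersections are nonempty.\<close>

definition approx_unit :: "'a::cstar_algebra filter" where
  "approx_unit = (INF (a, \<epsilon>)\<in>UNIV \<times> {0<..}.
     principal {e. unit_contraction e \<and> norm (a - e * a) < \<epsilon> \<and> norm (a - a * e) < \<epsilon>})"

lemma approx_unit_not_bot: "approx_unit \<noteq> (bot :: 'a::cstar_algebra filter)"
  unfolding approx_unit_def
proof (rule INF_filter_not_bot)
  fix P :: "('a \<times> real) set"
  assume P: "P \<subseteq> UNIV \<times> {0<..}" "finite P"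
  define \<epsilon> where "\<epsilon> = Min (insert 1 (snd ` P))"
  have "\<epsilon> > 0" using P by (auto simp: \<epsilon>_def)
  moreover have "\<epsilon> \<le> snd p" if "p \<in> P" for p using P that by (auto simp: \<epsilon>_def intro: Min_le)
  moreover obtain e where "unit_contraction e"
    "\<forall>a\<in>fst ` P. norm (a - e * a) < \<epsilon> \<and> norm (a - a * e) < \<epsilon>"
    using finite_two_sided_unit[of "fst ` P" \<epsilon>] P \<open>\<epsilon> > 0\<close> by blast
  ultimately have "e \<in> (\<Inter>p\<in>P. {e. unit_contraction e \<and> norm (fst p - e * fst p) < snd p \<and>
      norm (fst p - fst p * e) < snd p})"
    by (auto intro: less_le_trans)
  then show "(INF (a, \<epsilon>)\<in>P. principal {e. unit_contraction e \<and> norm (a - e * a) < \<epsilon> \<and>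
      norm (a - a * e) < \<epsilon>}) \<noteq> bot"
    by (auto simp: case_prod_unfold INF_principal_finite[OF P(2)] principal_eq_bot_iff)
qed

lemma eventually_approx_unit:
  assumes "\<epsilon> > 0"
  shows "\<forall>\<^sub>F e in approx_unit. unit_contraction e \<and> norm (a - e * a) < \<epsilon> \<and> norm (a - a * e) < \<epsilon>"
  unfolding approx_unit_def
  by (rule eventually_INF1[of "(a, \<epsilon>)"]) (auto simp: assms eventually_principal)

lemma approx_unit_contraction: "\<forall>\<^sub>F e in approx_unit. unit_contraction e"
  by (rule eventually_mono[OF eventually_approx_unit[of 1]]) auto

lemma approx_unit_left: "((\<lambda>e. e * a) \<longlongrightarrow> a) approx_unit"
  and approx_unit_right: "((\<lambda>e. a * e) \<longlongrightarrow> a) approx_unit"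
  unfolding tendsto_iff dist_norm
  by (auto intro!: eventually_mono[OF eventually_approx_unit] simp: norm_minus_commute)

section \<open>Density and extension\<close>

lemma bounded_linear_eq_on_dense:
  assumes f: "bounded_linear f" and g: "bounded_linear g" and eq: "\<And>s. s \<in> S \<Longrightarrow> f s = g s"
    and dense: "closure (span S) = UNIV"
  shows "f x = g x"
proof -
  have "f y = g y" if "y \<in> span S" for y
    using linear_eq_on_span[OF bounded_linear.linear[OF f] bounded_linear.linear[OF g] eq that] .
  moreover have "closed {x. f x = g x}"
    by (intro closed_Collect_eq linear_continuous_on f g)
  ultimately have "closure (span S) \<subseteq> {x. f x = g x}" by (intro closure_minimal) auto
  then show ?thesis using dense by auto
qed

text \<open>The point x ranges over the closure of a span, not over the whole space, so that the
  lemma also applies to \<open>compacts X\<close> inside all bounded operators.\<close>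

lemma tendsto_on_closure_span:
  fixes V :: "'e \<Rightarrow> 'a::real_normed_vector \<Rightarrow> 'b::real_normed_vector"
  assumes lin: "\<And>e. linear (V e)" and bd: "\<forall>\<^sub>F e in F. \<forall>v. norm (V e v) \<le> B * norm v"
    and W: "bounded_linear W" and S: "\<And>s. s \<in> S \<Longrightarrow> ((\<lambda>e. V e s) \<longlongrightarrow> W s) F"
    and x: "x \<in> closure (span S)"
  shows "((\<lambda>e. V e x) \<longlongrightarrow> W x) F"
proof -
  interpret W: bounded_linear W by (rule W)
  have span: "((\<lambda>e. V e y) \<longlongrightarrow> W y) F" if "y \<in> span S" for y
    using that
  proof (induction rule: span_induct_alt)
    case base
    then show ?case using lin by (simp add: linear_0 W.zero)
  next
    case (step c z y)
    have "V e (c *\<^sub>R z + y) = c *\<^sub>R V e z + V e y" for e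
      using lin[of e] by (simp add: linear_add linear_scale)
    then show ?case using step S by (auto simp: W.add W.scaleR intro!: tendsto_intros)
  qed
  obtain K where K: "K > 0" "\<And>v. norm (W v) \<le> norm v * K"
    using W.pos_bounded by blast
  show ?thesis
  proof (rule tendstoI)
    fix \<epsilon> :: real assume \<epsilon>: "\<epsilon> > 0"
    define M where "M = \<bar>B\<bar> + K"
    have M: "M > 0" using K by (simp add: M_def)
    then obtain y where y: "y \<in> span S" "dist y x < \<epsilon> / (2 * M)"
      using x \<epsilon> unfolding closure_approachable by (metis divide_pos_pos mult_pos_pos zero_less_numeral)
    have "\<forall>\<^sub>F e in F. dist (V e y) (W y) < \<epsilon> / 2"
      using tendstoD[OF span[OF y(1)], of "\<epsilon> / 2"] \<epsilon> by simp
    with bd show "\<forall>\<^sub>F e in F. dist (V e x) (W x) < \<epsilon>"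
    proof eventually_elim
      case (elim e)
      have "V e x - W x = V e (x - y) + (V e y - W y) - W (x - y)"
        using lin[of e] by (simp add: linear_diff W.diff)
      also have "norm \<dots> \<le> norm (V e (x - y)) + norm (V e y - W y) + norm (W (x - y))"
        by (smt (verit) norm_triangle_ineq norm_triangle_ineq4)
      also have "\<dots> \<le> \<bar>B\<bar> * norm (x - y) + norm (V e y - W y) + norm (x - y) * K"
        using elim(1) K(2)[of "x - y"] by (smt (verit) abs_ge_self mult_right_mono norm_ge_zero)
      also have "\<dots> = M * norm (x - y) + norm (V e y - W y)" by (simp add: M_def algebra_simps)
      also have "M * norm (x - y) < \<epsilon> / 2"
        using y(2) M by (simp add: dist_norm norm_minus_commute field_simps)
      finally show ?case using elim(2) by (simp add: dist_norm)
    qed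
  qed
qed

lemma subspace_closure:
  fixes S :: "'a::real_normed_vector set"
  assumes S: "subspace S"
  shows "subspace (closure S)"
proof (rule subspaceI)
  show "0 \<in> closure S" using subspace_0[OF S] closure_subset by blast
next
  fix x y assume "x \<in> closure S" "y \<in> closure S"
  then obtain s t where "\<And>n. s n \<in> S" "s \<longlonglongrightarrow> x" "\<And>n. t n \<in> S" "t \<longlonglongrightarrow> y"
    unfolding closure_sequential by blast
  then show "x + y \<in> closure S"
    unfolding closure_sequential
    by (intro exI[of _ "\<lambda>n. s n + t n"]) (auto intro: subspace_add[OF S] tendsto_add)
next
  fix c x assume "x \<in> closure S"
  then obtain s where "\<And>n. s n \<in> S" "s \<longlonglongrightarrow> x" unfolding closure_sequential by blast
  then show "c *\<^sub>R x \<in> closure S"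
    unfolding closure_sequential
    by (intro exI[of _ "\<lambda>n. c *\<^sub>R s n"]) (auto intro: subspace_scale[OF S] tendsto_scaleR)
qed

text \<open>A map prescribed on linearly dependent generators is entered as the span of its pairs of
  values; the norm estimate makes the relation single-valued. The last conclusion passes closed
  conditions on the pairs of R to the graph of T.\<close>

lemma bounded_linear_extension_of_relation:
  fixes R :: "('a::real_normed_vector \<times> 'b::banach) set"
  assumes R: "subspace R" and le: "\<And>x y. (x, y) \<in> R \<Longrightarrow> norm y \<le> K * norm x"
    and dense: "closure (fst ` R) = UNIV"
  obtains T where "bounded_linear T" "\<And>x y. (x, y) \<in> R \<Longrightarrow> T x = y"
    "\<And>x. norm (T x) \<le> K * norm x" "\<And>x. (x, T x) \<in> closure R"
proof -
  have "closed {p :: 'a \<times> 'b. norm (snd p) \<le> K * norm (fst p)}"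
    by (intro closed_Collect_le continuous_intros)
  then have "closure R \<subseteq> {p. norm (snd p) \<le> K * norm (fst p)}"
    using le by (intro closure_minimal) auto
  then have le': "norm y \<le> K * norm x" if "(x, y) \<in> closure R" for x y using that by auto
  have sub: "subspace (closure R)" using R by (rule subspace_closure)
  have uniq: "y = y'" if "(x, y) \<in> closure R" "(x, y') \<in> closure R" for x y y'
    using le'[of 0 "y - y'"] subspace_diff[OF sub that] by simp
  have ex: "\<exists>y. (x, y) \<in> closure R" for x
  proof -
    have "x \<in> closure (fst ` R)" using dense by simp
    then obtain s where s: "\<And>n. s n \<in> fst ` R" "s \<longlonglongrightarrow> x" unfolding closure_sequential by blast
    then have "\<forall>n. \<exists>y. (s n, y) \<in> R" by force
    then obtain y where y: "\<And>n. (s n, y n) \<in> R" by metis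
    have "norm (y m - y n) \<le> \<bar>K\<bar> * norm (s m - s n)" for m n
      using le[of "s m - s n" "y m - y n"] subspace_diff[OF R y[of m] y[of n]]
      by (simp add: order_trans mult_right_mono abs_ge_self)
    then have d: "dist (y m) (y n) \<le> \<bar>K\<bar> * dist (s m) (s n)" for m n by (simp add: dist_norm)
    have "Cauchy y"
    proof (rule metric_CauchyI)
      fix \<epsilon> :: real assume "\<epsilon> > 0"
      then have "\<epsilon> / (\<bar>K\<bar> + 1) > 0" by simp
      then obtain N where N: "\<And>m n. m \<ge> N \<Longrightarrow> n \<ge> N \<Longrightarrow> dist (s m) (s n) < \<epsilon> / (\<bar>K\<bar> + 1)"
        using LIMSEQ_imp_Cauchy[OF s(2)] unfolding Cauchy_def by metis
      have "dist (y m) (y n) < \<epsilon>" if "m \<ge> N" "n \<ge> N" for m n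
      proof -
        have "dist (y m) (y n) \<le> (\<bar>K\<bar> + 1) * dist (s m) (s n)"
          using d[of m n] by (simp add: distrib_right add_increasing2)
        also have "\<dots> < \<epsilon>" using N[OF that] by (simp add: field_simps)
        finally show ?thesis .
      qed
      then show "\<exists>N. \<forall>m\<ge>N. \<forall>n\<ge>N. dist (y m) (y n) < \<epsilon>" by blast
    qed
    then obtain l where "y \<longlonglongrightarrow> l" using Cauchy_convergent convergent_def by blast
    then have "(\<lambda>n. (s n, y n)) \<longlonglongrightarrow> (x, l)" using s(2) by (intro tendsto_Pair)
    then have "(x, l) \<in> closure R" unfolding closure_sequential using y
      by (intro exI[of _ "\<lambda>n. (s n, y n)"]) auto
    then show ?thesis by blast
  qed
  then obtain T where T: "\<And>x. (x, T x) \<in> closure R" by metis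
  have "T (x + y) = T x + T y" "T (c *\<^sub>R x) = c *\<^sub>R T x" for x y c
    using uniq[OF T] subspace_add[OF sub T[of x] T[of y]] subspace_scale[OF sub T[of x], of c] by auto
  then have "bounded_linear T"
    using le'[OF T] by (intro bounded_linear_intro[where K = K]) (auto simp: mult.commute)
  moreover have "T x = y" if "(x, y) \<in> R" for x y
    using uniq[OF T[of x]] that closure_subset by blast
  ultimately show thesis using that le'[OF T] T by blast
qed

section \<open>Cohen factorization\<close>

lemma convergent_of_summable_steps:
  fixes f :: "nat \<Rightarrow> 'a::banach"
  assumes "\<And>n. norm (f (Suc n) - f n) \<le> b n" "summable b"
  shows "convergent f"
proof -
  have "summable (\<lambda>n. f (Suc n) - f n)"
    by (rule summable_comparison_test'[OF assms(2), of 0]) (rule assms(1))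
  then have "convergent (\<lambda>n. f n - f 0)"
    by (simp add: summable_iff_convergent sum_lessThan_telescope)
  then have "convergent (\<lambda>n. (f n - f 0) + f 0)" by (intro convergent_add convergent_const)
  then show ?thesis by simp
qed

text \<open>Cohen factorization, with the invertible elements
  \<open>(1 - c)\<^sup>n + p n = \<Prod>k<n. ((1 - c) + c e k)\<close> of the unitization: the element \<open>e n\<close> is almost a
  unit from the right for \<open>p n\<close> and from the left for \<open>v n\<close>, the inverse of this product applied to
  \<open>v\<close>.\<close>

lemma cohen_factorization:
  fixes act :: "'a::cstar_algebra \<Rightarrow> 'v::banach \<Rightarrow> 'v"
  assumes bb: "bounded_bilinear act" and mult: "\<And>a b v. act (a * b) v = act a (act b v)"
    and ess: "((\<lambda>e. act e v) \<longlongrightarrow> v) approx_unit"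
  obtains a w where "v = act a w"
proof -
  interpret bounded_bilinear act by (rule bb)
  obtain K where K: "K > 0" "\<And>a v. norm (act a v) \<le> norm a * norm v * K" using pos_bounded by blast
  \<comment> \<open>L bounds the operator v - e v, because the norm of e is at most 2; c then makes
    c (1 - e) an operator of norm at most 1/2, and (1 - c) + c e = 1 - c (1 - e) is
    invertible.\<close>
  define L where "L = 1 + 2 * K"
  define c where "c = 1 / (2 * L)"
  have L: "L > 1" using K by (simp add: L_def)
  have c: "0 < c" "c < 1" "c * L = 1 / 2" using L by (simp_all add: c_def divide_simps)
  have N: "norm (c *\<^sub>R (v - act e v)) \<le> (1 / 2) * norm v" if "unit_contraction e" for e v
  proof -
    have "norm (act e v) \<le> norm e * norm v * K" by (rule K(2))
    also have "\<dots> \<le> 2 * norm v * K"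
      using norm_unit_contraction[OF that] K(1) by (intro mult_right_mono) auto
    finally have "norm (v - act e v) \<le> L * norm v"
      using norm_triangle_ineq4[of v "act e v"] by (simp add: L_def algebra_simps)
    then have "c * norm (v - act e v) \<le> c * (L * norm v)" using c by (intro mult_left_mono) auto
    then show ?thesis using c by (simp add: mult.assoc[symmetric])
  qed
  have solve: "\<exists>x. x - c *\<^sub>R (x - act e x) = y \<and> norm (x - y) \<le> norm (y - act e y)"
    if e: "unit_contraction e" for e y
  proof -
    have "\<exists>!x. y + c *\<^sub>R (x - act e x) = x"
    proof (rule banach_fix_type[where c = "1 / 2"])
      show "\<forall>x z. dist (y + c *\<^sub>R (x - act e x)) (y + c *\<^sub>R (z - act e z)) \<le> 1 / 2 * dist x z"
      proof clarify
        fix x z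
        have "(y + c *\<^sub>R (x - act e x)) - (y + c *\<^sub>R (z - act e z)) = c *\<^sub>R ((x - z) - act e (x - z))"
          by (simp add: diff_right algebra_simps)
        then show "dist (y + c *\<^sub>R (x - act e x)) (y + c *\<^sub>R (z - act e z)) \<le> 1 / 2 * dist x z"
          using N[OF e, of "x - z"] by (simp add: dist_norm)
      qed
    qed auto
    then obtain x where x: "y + c *\<^sub>R (x - act e x) = x" by blast
    \<comment> \<open>The solution moves y by an amount governed by the defect y - e y: the first
      summand is absorbed into the left side at the price of a factor 2, and 2 c is at most
      1.\<close>
    have "x - y = c *\<^sub>R ((x - y) - act e (x - y)) + c *\<^sub>R (y - act e y)"
      using x by (simp add: diff_right scaleR_diff_right) (metis add_diff_cancel_left' scaleR_diff_right)
    then have "norm (x - y) \<le> norm (c *\<^sub>R ((x - y) - act e (x - y))) + norm (c *\<^sub>R (y - act e y))"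
      by (metis norm_triangle_ineq)
    then have "norm (x - y) \<le> 2 * (c * norm (y - act e y))"
      using N[OF e, of "x - y"] c by simp
    also have "2 * c \<le> 1" using L by (simp add: c_def)
    then have "2 * (c * norm (y - act e y)) \<le> norm (y - act e y)"
      using mult_right_mono[of "2 * c" 1 "norm (y - act e y)"] by simp
    finally have "norm (x - y) \<le> norm (y - act e y)" .
    moreover have "x - c *\<^sub>R (x - act e x) = y" using x by (metis add_diff_cancel_right')
    ultimately show ?thesis by blast
  qed
  \<comment> \<open>A state is the pair of p n and v n. P records the factorization of v together
    with the convergence needed to choose the next e; Q makes both sequences move by summable
    steps.\<close>
  define P where "P n s \<longleftrightarrow> v = (1 - c) ^ n *\<^sub>R snd s + act (fst s) (snd s) \<and>
    ((\<lambda>e. act e (snd s)) \<longlongrightarrow> snd s) approx_unit" for n and s :: "'a \<times> 'v"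
  define Q where "Q n s s' \<longleftrightarrow> norm (fst s' - fst s) \<le> 2 * (1 - c) ^ n + (1 / 2) ^ n \<and>
    norm (snd s' - snd s) \<le> (1 / 2) ^ n" for n and s s' :: "'a \<times> 'v"
  have "P 0 (0, v)" using ess by (simp add: P_def zero_left)
  moreover have "\<exists>s'. P (Suc n) s' \<and> Q n s s'" if "P n s" for n s
  proof -
    obtain p x where s: "s = (p, x)" by (cases s)
    have x: "v = (1 - c) ^ n *\<^sub>R x + act p x" "((\<lambda>e. act e x) \<longlongrightarrow> x) approx_unit"
      using that by (simp_all add: P_def s)
    have "\<forall>\<^sub>F e in approx_unit. dist (act e x) x < (1 / 2) ^ n"
      by (rule tendstoD[OF x(2)]) simp
    with eventually_approx_unit[of "(1 / 2) ^ n" p]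
    have "\<forall>\<^sub>F e in approx_unit. unit_contraction e \<and> norm (p - p * e) < (1 / 2) ^ n \<and>
      norm (x - act e x) < (1 / 2) ^ n"
      by (auto simp: dist_norm norm_minus_commute elim: eventually_elim2)
    then obtain e where e: "unit_contraction e" "norm (p - p * e) < (1 / 2) ^ n"
      "norm (x - act e x) < (1 / 2) ^ n"
      using eventually_happens approx_unit_not_bot by blast
    obtain y where y: "y - c *\<^sub>R (y - act e y) = x" "norm (y - x) \<le> norm (x - act e x)"
      using solve[OF e(1)] by blast
    \<comment> \<open>Expanding ((1 - c)^n + p) ((1 - c) + c e) and subtracting the scalar part (1 -
      c)^(n + 1) gives q.\<close>
    define q where "q = p + (c * (1 - c) ^ n) *\<^sub>R e - c *\<^sub>R (p - p * e)"
    have x_y: "x = (1 - c) *\<^sub>R y + c *\<^sub>R act e y" using y(1) by (simp add: algebra_simps)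
    have "v = (1 - c) ^ Suc n *\<^sub>R y + act q y"
      unfolding x(1) x_y q_def
      by (simp add: add_left add_right diff_left diff_right scaleR_left scaleR_right mult algebra_simps)
    moreover have "((\<lambda>f. act f y) \<longlongrightarrow> y) approx_unit"
    proof -
      \<comment> \<open>The approximate unit converges at y because y is a combination of x, where
        it does by induction, and of e y, where it does for every y.\<close>
      have y': "y = (1 / (1 - c)) *\<^sub>R (x - c *\<^sub>R act e y)"
        using c unfolding x_y by simp
      have "((\<lambda>f. act (f * e) y) \<longlongrightarrow> act e y) approx_unit"
        by (intro tendsto tendsto_const approx_unit_left)
      then have lim: "((\<lambda>f. (1 / (1 - c)) *\<^sub>R (act f x - c *\<^sub>R act f (act e y))) \<longlongrightarrow>
        (1 / (1 - c)) *\<^sub>R (x - c *\<^sub>R act e y)) approx_unit"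
        by (intro tendsto_intros x(2)) (simp add: mult)
      have "(\<lambda>f. act f y) = (\<lambda>f. (1 / (1 - c)) *\<^sub>R (act f x - c *\<^sub>R act f (act e y)))"
        by (rule ext, subst y') (simp add: scaleR_right diff_right)
      then show ?thesis using lim by (simp only: y'[symmetric])
    qed
    moreover have "norm (q - p) \<le> 2 * (1 - c) ^ n + (1 / 2) ^ n"
    proof -
      have "norm (q - p) \<le> norm ((c * (1 - c) ^ n) *\<^sub>R e) + norm (c *\<^sub>R (p - p * e))"
        using norm_triangle_ineq4[of "(c * (1 - c) ^ n) *\<^sub>R e" "c *\<^sub>R (p - p * e)"] by (simp add: q_def)
      also have "norm ((c * (1 - c) ^ n) *\<^sub>R e) \<le> (1 * (1 - c) ^ n) * 2"
        unfolding norm_scaleR using c norm_unit_contraction[OF e(1)]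
        by (intro mult_mono) (auto simp: abs_mult intro!: mult_mono)
      also have "norm (c *\<^sub>R (p - p * e)) \<le> 1 * (1 / 2) ^ n"
        unfolding norm_scaleR using c e(2) by (intro mult_mono) auto
      finally show ?thesis by simp
    qed
    moreover have "norm (y - x) \<le> (1 / 2) ^ n" using y(2) e(3) by simp
    ultimately have "P (Suc n) (q, y) \<and> Q n s (q, y)" by (simp add: P_def Q_def s)
    then show ?thesis by blast
  qed
  ultimately obtain s where P: "\<And>n. P n (s n)" and Q: "\<And>n. Q n (s n) (s (Suc n))"
    using dependent_nat_choice[of P Q] by metis
  have geo: "summable (\<lambda>n. (1 / 2 :: real) ^ n)" "summable (\<lambda>n. (1 - c) ^ n)"
    using c by (auto intro!: summable_geometric)
  have "convergent (\<lambda>n. fst (s n))"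
    by (rule convergent_of_summable_steps[where b = "\<lambda>n. 2 * (1 - c) ^ n + (1 / 2) ^ n"])
      (use Q geo in \<open>auto simp: Q_def intro!: summable_add summable_mult\<close>)
  then obtain a where a: "(\<lambda>n. fst (s n)) \<longlonglongrightarrow> a" by (auto simp: convergent_def)
  have "convergent (\<lambda>n. snd (s n))"
    by (rule convergent_of_summable_steps[where b = "\<lambda>n. (1 / 2) ^ n"]) (use Q geo in \<open>auto simp: Q_def\<close>)
  then obtain w where w: "(\<lambda>n. snd (s n)) \<longlonglongrightarrow> w" by (auto simp: convergent_def)
  \<comment> \<open>The scalar part of the product dies out, so only the part lying in the algebra
    remains in the limit.\<close>
  have "(\<lambda>n. (1 - c) ^ n *\<^sub>R snd (s n) + act (fst (s n)) (snd (s n))) \<longlonglongrightarrow> 0 *\<^sub>R w + act a w"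
    using c by (intro tendsto_intros tendsto a w LIMSEQ_power_zero) auto
  moreover have "(1 - c) ^ n *\<^sub>R snd (s n) + act (fst (s n)) (snd (s n)) = v" for n
    using P[of n] by (simp add: P_def)
  ultimately have "v = act a w" using LIMSEQ_unique[OF tendsto_const] by fastforce
  then show thesis by (rule that)
qed

section \<open>Hilbert modules\<close>

locale complex_bilinear =
  fixes u :: "'x::complex_normed_vector \<Rightarrow> 'y::complex_normed_vector \<Rightarrow> 'z::complex_normed_vector"
  assumes cbilinear: "cbilinear u"
begin

lemma add_left: "u (x + x') y = u x y + u x' y" and add_right: "u x (y + y') = u x y + u x y'"
  and scaleC_left: "u (c *\<^sub>C x) y = c *\<^sub>C u x y" and scaleC_right: "u x (c *\<^sub>C y) = c *\<^sub>C u x y"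
  using cbilinear by (simp_all add: cbilinear_def)

lemma scaleR_left: "u (r *\<^sub>R x) y = r *\<^sub>R u x y" and scaleR_right: "u x (r *\<^sub>R y) = r *\<^sub>R u x y"
  using scaleC_left[of "complex_of_real r"] scaleC_right[of _ "complex_of_real r"]
  by (simp_all add: scaleC_of_real)

lemma linear_left: "linear (\<lambda>x. u x y)" and linear_right: "linear (u x)"
  by (auto intro!: linearI simp: add_left add_right scaleR_left scaleR_right)

lemma sum_right: "u x (\<Sum>i\<in>I. f i) = (\<Sum>i\<in>I. u x (f i))"
  using linear_sum[OF linear_right] .

lemma zero_left [simp]: "u 0 y = 0" and zero_right [simp]: "u x 0 = 0"
  using linear_0[OF linear_left] linear_0[OF linear_right] by auto

lemma bounded_bilinearI: "(\<And>x y. norm (u x y) \<le> norm x * norm y * K) \<Longrightarrow> bounded_bilinear u"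
  by (rule bounded_bilinear.intro)
    (auto simp: add_left add_right scaleR_left scaleR_right)

end

locale hilbert_mod =
  fixes X :: "('x::cbanach, 'a::cstar_algebra) corr"
  assumes hilbert_module: "hilbert_module X"
begin

sublocale ract_c: complex_bilinear "ract X"
  using hilbert_module by unfold_locales (simp add: hilbert_module_def)

lemma ip_add_right: "ip X x (y + z) = ip X x y + ip X x z"
  and ip_scaleC_right: "ip X x (c *\<^sub>C y) = c *\<^sub>C ip X x y"
  and ip_ract_right: "ip X x (ract X y a) = ip X x y * a"
  and star_ip: "star (ip X x y) = ip X y x"
  and norm_ip_self: "norm (ip X x x) = (norm x)\<^sup>2"
  using hilbert_module by (auto simp: hilbert_module_def)

lemma ip_add_left: "ip X (x + y) z = ip X x z + ip X y z"
  using star_ip[of z "x + y"] star_ip[of z x] star_ip[of z y] by (simp add: ip_add_right)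

lemma ip_scaleC_left: "ip X (c *\<^sub>C x) y = cnj c *\<^sub>C ip X x y"
  using star_ip[of y "c *\<^sub>C x"] star_ip[of y x] by (simp add: ip_scaleC_right star_scaleC)

lemma ip_ract_left: "ip X (ract X x a) y = star a * ip X x y"
  using star_ip[of y "ract X x a"] star_ip[of y x] by (simp add: ip_ract_right)

lemma ip_scaleR_right: "ip X x (r *\<^sub>R y) = r *\<^sub>R ip X x y"
  using ip_scaleC_right[of x "complex_of_real r"] by (simp add: scaleC_of_real)

lemma ip_scaleR_left: "ip X (r *\<^sub>R x) y = r *\<^sub>R ip X x y"
  using ip_scaleC_left[of "complex_of_real r"] by (simp add: scaleC_of_real)

text \<open>The sharp constant is 1, but polarization suffices here.\<close>

lemma norm_ip_le: "norm (ip X x y) \<le> norm x * norm y * 4"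
proof (cases "x = 0 \<or> y = 0")
  case True
  then show ?thesis using ip_scaleR_left[of 0 0] ip_scaleR_right[of _ 0 0] by auto
next
  case False
  have unit: "norm (ip X x y) \<le> 4" if "norm x = 1" "norm y = 1" for x y
  proof -
    define N where "N z = ip X z z" for z
    have N: "norm (N (x + c *\<^sub>C y)) \<le> 4" if "cmod c = 1" for c
    proof -
      have "norm (x + c *\<^sub>C y) \<le> 2"
        using norm_triangle_ineq[of x "c *\<^sub>C y"] that \<open>norm x = 1\<close> \<open>norm y = 1\<close>
        by (simp add: norm_scaleC)
      then have "(norm (x + c *\<^sub>C y))\<^sup>2 \<le> 2\<^sup>2" by (intro power_mono) auto
      then show ?thesis by (simp add: N_def norm_ip_self)
    qed
    have expand: "N (x + c *\<^sub>C y) = ip X x x + c *\<^sub>C ip X x y + cnj c *\<^sub>C ip X y x + (cnj c * c) *\<^sub>C ip X y y" for c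
      by (simp add: N_def ip_add_left ip_add_right ip_scaleC_left ip_scaleC_right scaleC_scaleC
          scaleC_add_right mult.commute)
    have "4 *\<^sub>R ip X x y = (N (x + 1 *\<^sub>C y) - N (x + (- 1) *\<^sub>C y)) -
        \<i> *\<^sub>C (N (x + \<i> *\<^sub>C y) - N (x + (- \<i>) *\<^sub>C y))"
    proof -
      have *: "\<i> *\<^sub>C \<i> *\<^sub>C a = - a" for a :: 'a by (simp add: scaleC_scaleC)
      have **: "4 *\<^sub>R a = a + a + a + a" for a :: 'a
        using scaleR_scaleR[of 2 2 a] by (simp add: scaleR_2 add.assoc)
      show ?thesis
        unfolding expand by (simp add: scaleC_diff scaleC_add_right * **)
    qed
    also have "norm \<dots> \<le> (4 + 4) + cmod \<i> * (4 + 4)"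
      unfolding norm_scaleC[symmetric]
      by (intro order_trans[OF norm_triangle_ineq4] add_mono order_refl N)
        (auto simp only: norm_scaleC norm_ii mult_1 norm_one norm_minus_cancel
          intro!: order_trans[OF norm_triangle_ineq4] add_mono N)
    finally show ?thesis by simp
  qed
  define x' y' where "x' = inverse (norm x) *\<^sub>R x" and "y' = inverse (norm y) *\<^sub>R y"
  have "norm x' = 1" "norm y' = 1" using False by (auto simp: x'_def y'_def)
  moreover have "ip X x y = (norm x * norm y) *\<^sub>R ip X x' y'"
  proof -
    have "norm x * norm y * (inverse (norm x) * inverse (norm y)) = 1" using False by (simp add: field_simps)
    then show ?thesis by (simp add: x'_def y'_def ip_scaleR_left ip_scaleR_right mult.commute mult.left_commute)
  qed
  ultimately show ?thesis using unit[of x' y'] by (simp add: mult_left_mono)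
qed

lemma bounded_bilinear_ip: "bounded_bilinear (ip X)"
  by (rule bounded_bilinear.intro)
    (auto simp: ip_add_left ip_add_right ip_scaleR_left ip_scaleR_right intro: norm_ip_le)

sublocale ip: bounded_bilinear "ip X" by (rule bounded_bilinear_ip)

lemma norm_ract_le: "norm (ract X x a) \<le> norm x * norm a"
proof -
  have "(norm (ract X x a))\<^sup>2 = norm (star a * ip X x x * a)"
    by (simp add: norm_ip_self[symmetric] ip_ract_left ip_ract_right mult.assoc)
  also have "\<dots> \<le> norm (star a) * norm (ip X x x) * norm a"
    by (meson mult_right_mono norm_ge_zero norm_mult_ineq order_trans)
  also have "\<dots> = (norm x * norm a)\<^sup>2"
    by (simp add: norm_ip_self power2_eq_square)
  finally show ?thesis by (rule power2_le_imp_le) simp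
qed

lemma bounded_bilinear_ract: "bounded_bilinear (ract X)"
  by (rule ract_c.bounded_bilinearI[where K = 1]) (simp add: norm_ract_le)

sublocale ract: bounded_bilinear "ract X" by (rule bounded_bilinear_ract)

lemma ip_eq_0_iff: "ip X x x = 0 \<longleftrightarrow> x = 0"
  using norm_ip_self[of x] by auto

lemma eq_if_ip_eq_left: "(\<And>z. ip X x z = ip X y z) \<Longrightarrow> x = y"
  using ip_eq_0_iff[of "x - y"] by (simp add: ip.diff_left)

lemma eq_if_ip_eq_right: "(\<And>z. ip X z x = ip X z y) \<Longrightarrow> x = y"
  using ip_eq_0_iff[of "x - y"] by (simp add: ip.diff_right)

text \<open>With e = <x, x> z a local unit for b = <x, x>, the inner square of x - x e is (1 - e) b
  (1 - e), which is small, and x e = x <x, x z>. It makes K(X) X dense.\<close>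

lemma module_local_unit:
  assumes "\<epsilon> > 0"
  obtains z where "norm (x - ract X x (ip X x (ract X x z))) < \<epsilon>"
proof -
  obtain e z where e: "unit_contraction e" "star e = e" "e = ip X x x * z"
    "norm (ip X x x - ip X x x * e) < \<epsilon>\<^sup>2"
    by (rule selfadjoint_local_unit[of "ip X x x" "\<epsilon>\<^sup>2"]) (use assms in \<open>auto simp: star_ip\<close>)
  define b where "b = ip X x x"
  have "ip X (x - ract X x e) (x - ract X x e) = (b - b * e) - e * (b - b * e)"
    by (simp add: ip.diff_left ip.diff_right ip_ract_left ip_ract_right e(2) b_def algebra_simps)
  then have "(norm (x - ract X x e))\<^sup>2 \<le> norm (b - b * e)"
    using unit_contractionD(2)[OF e(1), of "b - b * e"] by (simp add: norm_ip_self[symmetric])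
  then have "norm (x - ract X x e) < \<epsilon>"
    using e(4) assms power_less_imp_less_base[of _ 2 \<epsilon>] by (simp add: b_def)
  then show thesis using that[of z] by (simp add: e(3) ip_ract_right)
qed

lemma ract_ip_dense: "closure (span {ract X x (ip X y z) |x y z. True}) = UNIV" (is "closure (span ?S) = _")
proof -
  have "x \<in> closure (span ?S)" for x
    unfolding closure_approachable
  proof (intro allI impI)
    fix \<epsilon> :: real assume "\<epsilon> > 0"
    then obtain z where "norm (x - ract X x (ip X x (ract X x z))) < \<epsilon>"
      using module_local_unit by blast
    moreover have "ract X x (ip X x (ract X x z)) \<in> span ?S" by (intro span_base) blast
    ultimately show "\<exists>y\<in>span ?S. dist y x < \<epsilon>" 
      by (auto simp: dist_norm norm_minus_commute)
  qed
  then show ?thesis by auto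
qed

definition theta :: "'x \<Rightarrow> 'x \<Rightarrow> 'x \<Rightarrow>\<^sub>L 'x" where
  "theta x y = Blinfun (\<lambda>z. ract X x (ip X y z))"

lemma theta_apply [simp]: "blinfun_apply (theta x y) z = ract X x (ip X y z)"
  unfolding theta_def
  by (subst bounded_linear_Blinfun_apply)
    (auto intro!: bounded_linear_compose[OF ract.bounded_linear_right ip.bounded_linear_right])

lemma compacts_eq: "compacts X = closure (span {theta x y |x y. True})"
proof -
  have "(\<exists>x y. \<forall>z. blinfun_apply T z = ract X x (ip X y z)) \<longleftrightarrow> (\<exists>x y. T = theta x y)" for T
    by (metis blinfun_eqI theta_apply)
  then show ?thesis by (simp add: compacts_def)
qed

lemma theta_compact: "theta x y \<in> compacts X"
  unfolding compacts_eq by (rule subsetD[OF closure_subset], rule span_base) blast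

lemma bounded_bilinear_theta: "bounded_bilinear theta"
proof (rule bounded_bilinear.intro)
  show "theta (x + x') y = theta x y + theta x' y" "theta x (y + y') = theta x y + theta x y'"
    "theta (r *\<^sub>R x) y = r *\<^sub>R theta x y" "theta x (r *\<^sub>R y) = r *\<^sub>R theta x y" for x x' y y' and r
    by (auto intro!: blinfun_eqI simp: blinfun.add_left blinfun.scaleR_left ip_add_left ip_scaleR_left
        ract.add_left ract.add_right ract.scaleR_left ract.scaleR_right)
  have "norm (theta x y) \<le> norm x * norm y * 4" for x y
  proof (rule norm_blinfun_bound)
    fix z
    have "norm (ract X x (ip X y z)) \<le> norm x * (norm y * norm z * 4)"
      by (rule order_trans[OF norm_ract_le mult_left_mono[OF norm_ip_le]]) simp
    then show "norm (blinfun_apply (theta x y) z) \<le> norm x * norm y * 4 * norm z"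
      by (simp add: mult.assoc mult.left_commute)
  qed simp
  then show "\<exists>K. \<forall>x y. norm (theta x y) \<le> norm x * norm y * K" by blast
qed

end

lemma hilbert_module_self_corr: "hilbert_module (self_corr :: ('a::cstar_algebra, 'a) corr)"
  unfolding hilbert_module_def self_corr_def cbilinear_def
  by (auto simp: algebra_simps scaleC_mult_left scaleC_mult_right norm_star_mult_self)

interpretation self: hilbert_mod "self_corr :: ('a::cstar_algebra, 'a) corr"
  by unfold_locales (rule hilbert_module_self_corr)

lemma self_corr_simps [simp]:
  "ract (self_corr :: ('a::cstar_algebra, 'a) corr) = (*)"
  "ip (self_corr :: ('a, 'a) corr) a b = star a * b"
  "phi (self_corr :: ('a, 'a) corr) = blinfun_mult_right"
  by (simp_all add: self_corr_def)

section \<open>Adjointable operators\<close>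

locale hilbert_pair = X: hilbert_mod X + Y: hilbert_mod Y
  for X :: "('x::cbanach, 'a::cstar_algebra) corr" and Y :: "('y::cbanach, 'a) corr"
begin

lemma adjoint_eqI:
  assumes "\<And>x y. ip Y (blinfun_apply T x) y = ip X x (blinfun_apply S y)"
  shows "adjoint X Y T = S"
  unfolding adjoint_def
proof (rule the_equality)
  show "S' = S" if "\<forall>x y. ip Y (blinfun_apply T x) y = ip X x (blinfun_apply S' y)" for S'
    by (intro blinfun_eqI X.eq_if_ip_eq_right) (simp add: that[rule_format, symmetric] assms)
qed (use assms in blast)

lemma ip_adjoint:
  assumes "T \<in> adjointable X Y"
  shows "ip Y (blinfun_apply T x) y = ip X x (blinfun_apply (adjoint X Y T) y)"
proof -
  obtain S where S: "\<And>x y. ip Y (blinfun_apply T x) y = ip X x (blinfun_apply S y)"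
    using assms by (auto simp: adjointable_def)
  then show ?thesis using adjoint_eqI[OF S] by simp
qed

lemma ip_adjoint':
  assumes "T \<in> adjointable X Y"
  shows "ip Y y (blinfun_apply T x) = ip X (blinfun_apply (adjoint X Y T) y) x"
  using arg_cong[OF ip_adjoint[OF assms, of x y], of star] by (simp only: X.star_ip Y.star_ip)

lemma adjointableI: "(\<And>x y. ip Y (blinfun_apply T x) y = ip X x (blinfun_apply S y)) \<Longrightarrow> T \<in> adjointable X Y"
  by (auto simp: adjointable_def)

lemma adjointable_ract:
  "T \<in> adjointable X Y \<Longrightarrow> blinfun_apply T (ract X x a) = ract Y (blinfun_apply T x) a"
  by (rule Y.eq_if_ip_eq_left) (simp add: ip_adjoint X.ip_ract_left Y.ip_ract_left)

lemma adjointable_scaleC: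
  "T \<in> adjointable X Y \<Longrightarrow> blinfun_apply T (c *\<^sub>C x) = c *\<^sub>C blinfun_apply T x"
  by (rule Y.eq_if_ip_eq_left) (simp add: ip_adjoint X.ip_scaleC_left Y.ip_scaleC_left)

lemma norm_adjoint_le:
  assumes "T \<in> adjointable X Y"
  shows "norm (adjoint X Y T) \<le> 4 * norm T"
proof (rule norm_blinfun_bound)
  fix y
  define x where "x = blinfun_apply (adjoint X Y T) y"
  have "norm x * norm x = norm (ip Y (blinfun_apply T x) y)"
    using X.norm_ip_self[of x] ip_adjoint[OF assms, of x y] by (simp add: power2_eq_square x_def)
  also have "\<dots> \<le> norm (blinfun_apply T x) * norm y * 4" by (rule Y.norm_ip_le)
  also have "\<dots> \<le> (norm T * norm x) * norm y * 4"
    by (intro mult_right_mono norm_blinfun) auto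
  also have "\<dots> = (4 * norm T * norm y) * norm x" by simp
  finally show "norm (blinfun_apply (adjoint X Y T) y) \<le> 4 * norm T * norm y"
    unfolding x_def by (cases "norm x = 0") (simp_all add: mult_le_cancel_right x_def)
qed simp

end

lemma adjoint_adjointable:
  assumes "hilbert_module X" "hilbert_module Y" "T \<in> adjointable X Y"
  shows "adjoint X Y T \<in> adjointable Y X" "adjoint Y X (adjoint X Y T) = T"
proof -
  interpret XY: hilbert_pair X Y by (intro hilbert_pair.intro hilbert_mod.intro assms)
  interpret YX: hilbert_pair Y X by (intro hilbert_pair.intro hilbert_mod.intro assms)
  have *: "ip X (blinfun_apply (adjoint X Y T) y) x = ip Y y (blinfun_apply T x)" for x y
    using XY.ip_adjoint'[OF assms(3), of y x] by simp
  show "adjoint X Y T \<in> adjointable Y X" by (rule YX.adjointableI[where S = T]) (rule *)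
  show "adjoint Y X (adjoint X Y T) = T" by (rule YX.adjoint_eqI) (rule *)
qed

section \<open>Correspondences\<close>

lemma blinfun_compose_assoc: "(S o\<^sub>L T) o\<^sub>L U = S o\<^sub>L (T o\<^sub>L U)"
  by (rule blinfun_eqI) simp

lemma blinfun_mult_right_apply [simp]: "blinfun_apply (blinfun_mult_right a) b = a * b"
  by (simp add: blinfun_mult_right.rep_eq)

lemma norm_blinfun_mult_right [simp]: "norm (blinfun_mult_right (a :: 'a::cstar_algebra)) = norm a"
proof (rule order_antisym)
  show "norm (blinfun_mult_right a) \<le> norm a"
    by (rule norm_blinfun_bound) (auto simp: norm_mult_ineq)
  have "norm a * norm a \<le> norm (blinfun_mult_right a) * norm a"
    using norm_blinfun[of "blinfun_mult_right a" "star a"]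
    by (simp add: norm_mult_star_self power2_eq_square)
  then show "norm a \<le> norm (blinfun_mult_right a)"
    by (cases "a = 0") (simp_all add: mult_le_cancel_right)
qed

lemma bounded_linear_blinfun_mult_right:
  "bounded_linear (blinfun_mult_right :: 'a::cstar_algebra \<Rightarrow> 'a \<Rightarrow>\<^sub>L 'a)"
  by (rule bounded_linear_intro[where K = 1])
    (auto intro!: blinfun_eqI simp: blinfun.add_left blinfun.scaleR_left algebra_simps)

lemma correspondence_self_corr: "correspondence (self_corr :: ('a::cstar_algebra, 'a) corr)"
proof -
  interpret hilbert_pair "self_corr :: ('a, 'a) corr" self_corr by unfold_locales
  have *: "ip self_corr (blinfun_apply (phi self_corr a) x) y =
    ip self_corr x (blinfun_apply (phi self_corr (star a)) y)" for a x y :: 'a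
    by (simp add: mult.assoc)
  show ?thesis
    unfolding correspondence_def
    using hilbert_module_self_corr adjointableI[OF *] adjoint_eqI[OF *]
    by (auto intro!: blinfun_eqI
        simp: blinfun.add_left scaleC_blinfun.rep_eq algebra_simps scaleC_mult_left)
qed

locale corresp = hilbert_mod X for X :: "('x::cbanach, 'a::cstar_algebra) corr" +
  assumes correspondence: "correspondence X"
begin

sublocale op: hilbert_pair X X by unfold_locales

lemma phi_adjointable: "phi X a \<in> adjointable X X"
  and phi_add: "phi X (a + b) = phi X a + phi X b"
  and phi_scaleC: "phi X (c *\<^sub>C a) = c *\<^sub>C phi X a"
  and phi_mult: "phi X (a * b) = phi X a o\<^sub>L phi X b"
  and phi_star: "phi X (star a) = adjoint X X (phi X a)"
  using correspondence by (auto simp: correspondence_def)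

lemma ip_phi_left: "ip X (blinfun_apply (phi X a) x) y = ip X x (blinfun_apply (phi X (star a)) y)"
  by (simp add: op.ip_adjoint[OF phi_adjointable] phi_star)

lemma phi_scaleR: "phi X (r *\<^sub>R a) = r *\<^sub>R phi X a"
  using phi_scaleC[of "complex_of_real r"] by (simp add: scaleC_of_real)

lemma linear_phi: "linear (phi X)"
  by (rule linearI) (simp_all add: phi_add phi_scaleR)

text \<open>Boundedness of \<open>phi X\<close> is derived from its algebraic properties: 2 i h is
  the difference of the unitaries 1 + w and 1 + \<open>star w\<close>, which act on X as
  isometries.\<close>

lemma norm_phi_selfadjoint_le:
  assumes "star h = h" "(norm h)\<^sup>2 \<le> 3 / 4"
  shows "norm (blinfun_apply (phi X h) x) \<le> norm x"
proof -
  obtain w where w: "w + star w + star w * w = 0" "w + star w + w * star w = 0"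
    "w - star w = 2 *\<^sub>R (\<i> *\<^sub>C h)"
    using selfadjoint_unitary[OF assms] by metis
  have iso: "norm (x + blinfun_apply (phi X v) x) = norm x" if "v + star v + star v * v = 0" for v
  proof -
    have "ip X (x + blinfun_apply (phi X v) x) (x + blinfun_apply (phi X v) x) =
      ip X x x + ip X x (blinfun_apply (phi X (v + star v + star v * v)) x)"
      by (simp add: ip_add_left ip_add_right ip_phi_left phi_add phi_mult blinfun.add_left)
    then have "ip X (x + blinfun_apply (phi X v) x) (x + blinfun_apply (phi X v) x) = ip X x x"
      using that by (simp add: linear_0[OF linear_phi] ip.zero_right)
    then have "(norm (x + blinfun_apply (phi X v) x))\<^sup>2 = (norm x)\<^sup>2" by (metis norm_ip_self)
    then show ?thesis by simp
  qed
  have "2 *\<^sub>R (\<i> *\<^sub>C blinfun_apply (phi X h) x) = blinfun_apply (phi X (w - star w)) x"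
    by (simp add: w(3) phi_scaleR phi_scaleC blinfun.scaleR_left scaleC_blinfun.rep_eq)
  also have "\<dots> = (x + blinfun_apply (phi X w) x) - (x + blinfun_apply (phi X (star w)) x)"
    by (simp add: linear_diff[OF linear_phi] blinfun.diff_left)
  finally have "norm (2 *\<^sub>R (\<i> *\<^sub>C blinfun_apply (phi X h) x)) \<le> norm x + norm x"
    using iso[of w] iso[of "star w"] w(1,2)
    by (metis (no_types, lifting) add.commute norm_triangle_ineq4 star_simps(5))
  then show ?thesis by (simp add: norm_scaleC)
qed

text \<open>Scaling a self-adjoint element to norm 1/2 costs a factor 2, and splitting a into real
  and imaginary parts another 2.\<close>

lemma norm_phi_le: "norm (phi X a) \<le> norm a * 4"
proof -
  have sa: "norm (blinfun_apply (phi X h) x) \<le> 2 * norm h * norm x" if h: "star h = h" for h x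
  proof (cases "h = 0")
    case False
    define g where "g = (1 / (2 * norm h)) *\<^sub>R h"
    have g: "star g = g" "norm g = 1 / 2" using False h by (simp_all add: g_def)
    have "norm (blinfun_apply (phi X g) x) \<le> norm x"
      by (rule norm_phi_selfadjoint_le[OF g(1)]) (simp add: power2_eq_square g(2))
    moreover have "blinfun_apply (phi X g) x = (1 / (2 * norm h)) *\<^sub>R blinfun_apply (phi X h) x"
      by (simp add: g_def phi_scaleR blinfun.scaleR_left)
    ultimately show ?thesis using False by (simp add: field_simps)
  qed (simp add: linear_0[OF linear_phi])
  define h k where "h = (1 / 2) *\<^sub>R (a + star a)" and "k = (1 / 2) *\<^sub>R (\<i> *\<^sub>C (star a - a))"
  have hk: "star h = h" "star k = k"
    by (simp_all add: h_def k_def star_scaleC add.commute scaleC_diff)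
  have nh: "norm h \<le> norm a" using norm_triangle_ineq[of a "star a"] by (simp add: h_def)
  have nk: "norm k \<le> norm a" using norm_triangle_ineq4[of "star a" a] by (simp add: k_def norm_scaleC)
  have a: "a = h + \<i> *\<^sub>C k"
    by (simp add: h_def k_def scaleC_scaleR scaleC_scaleC scaleR_add_right scaleR_diff_right
        flip: scaleR_left.add)
  show ?thesis
  proof (rule norm_blinfun_bound)
    fix x
    have "norm (blinfun_apply (phi X a) x) \<le> norm (blinfun_apply (phi X h) x) + norm (\<i> *\<^sub>C blinfun_apply (phi X k) x)"
      unfolding a by (simp add: phi_add phi_scaleC blinfun.add_left scaleC_blinfun.rep_eq norm_triangle_ineq
        del: norm_scaleC)
    also have "\<dots> \<le> 2 * norm h * norm x + 2 * norm k * norm x"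
      using sa[OF hk(1), of x] sa[OF hk(2), of x] by (simp add: norm_scaleC)
    also have "\<dots> \<le> 2 * norm a * norm x + 2 * norm a * norm x"
      using nh nk by (intro add_mono mult_right_mono mult_left_mono) auto
    finally show "norm (blinfun_apply (phi X a) x) \<le> norm a * 4 * norm x" by simp
  qed simp
qed

lemma bounded_linear_phi: "bounded_linear (phi X)"
  by (rule bounded_linear_intro[where K = 4]) (auto simp: phi_add phi_scaleR norm_phi_le)

end

locale nondegenerate_corresp = corresp X for X :: "('x::cbanach, 'a::cstar_algebra) corr" +
  assumes nondegenerate: "nondegenerate X"
begin

lemma phi_dense: "closure (span {blinfun_apply (phi X a) x |a x. True}) = UNIV"
  using nondegenerate by (simp add: nondegenerate_def)

text \<open>Nondegeneracy reduces the claim to vectors phi a y, where it is e a \<rightarrow> a. The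
  uniform bound 8 is the 4 of \<open>norm_phi_le\<close> times the 2 of
  \<open>norm_unit_contraction\<close>.\<close>

lemma tendsto_phi_approx_unit: "((\<lambda>e. blinfun_apply (phi X e) x) \<longlongrightarrow> x) approx_unit"
proof (rule tendsto_on_closure_span[where V = "\<lambda>e x. blinfun_apply (phi X e) x" and W = "\<lambda>x. x" and B = 8
    and S = "{blinfun_apply (phi X a) x |a x. True}"])
  show "\<forall>\<^sub>F e in approx_unit. \<forall>v. norm (blinfun_apply (phi X e) v) \<le> 8 * norm v"
    using approx_unit_contraction
  proof eventually_elim
    case (elim e)
    have "norm (phi X e) \<le> 8" using norm_phi_le[of e] norm_unit_contraction[OF elim] by linarith
    then show ?case by (meson mult_right_mono norm_blinfun norm_ge_zero order_trans)
  qed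
  show "x \<in> closure (span {blinfun_apply (phi X a) x |a x. True})" unfolding phi_dense by simp
  fix s assume "s \<in> {blinfun_apply (phi X a) x |a x. True}"
  then obtain a y where s: "s = blinfun_apply (phi X a) y" by blast
  have "((\<lambda>e. blinfun_apply (phi X (e * a)) y) \<longlongrightarrow> blinfun_apply (phi X a) y) approx_unit"
    by (intro tendsto_intros bounded_linear.tendsto[OF bounded_linear_phi] approx_unit_left)
  then show "((\<lambda>e. blinfun_apply (phi X e) s) \<longlongrightarrow> s) approx_unit" by (simp add: s phi_mult)
qed (auto simp: blinfun.bounded_linear_right bounded_linear.linear)

text \<open>Here A acts on all bounded operators by composition; the convergence that Cohen
  factorization asks for at T comes from the operators \<open>theta x y\<close>, which phi e moves
  to \<open>theta (phi e x) y\<close>.\<close>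

lemma compact_factor_left:
  assumes "T \<in> compacts X"
  obtains a S where "T = phi X a o\<^sub>L S"
proof (rule cohen_factorization)
  show bb: "bounded_bilinear (\<lambda>a T :: 'x \<Rightarrow>\<^sub>L 'x. phi X a o\<^sub>L T)"
    by (rule bounded_bilinear.comp[OF bounded_bilinear_blinfun_compose bounded_linear_phi bounded_linear_ident])
  show "((\<lambda>e. phi X e o\<^sub>L T) \<longlongrightarrow> T) approx_unit"
  proof (rule tendsto_on_closure_span[where V = "\<lambda>e T. phi X e o\<^sub>L T" and W = "\<lambda>x. x" and B = 8
    and S = "{theta x y |x y. True}"])
    show "\<forall>\<^sub>F e in approx_unit. \<forall>T :: 'x \<Rightarrow>\<^sub>L 'x. norm (phi X e o\<^sub>L T) \<le> 8 * norm T"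
      using approx_unit_contraction
    proof eventually_elim
      case (elim e)
      have "norm (phi X e) \<le> 8" using norm_phi_le[of e] norm_unit_contraction[OF elim] by linarith
      then show ?case by (meson mult_right_mono norm_blinfun_compose norm_ge_zero order_trans)
    qed
    show "T \<in> closure (span {theta x y |x y. True})" using assms by (simp add: compacts_eq)
    fix S assume "S \<in> {theta x y |x y. True}"
    then obtain x y where S: "S = theta x y" by blast
    have "phi X e o\<^sub>L S = theta (blinfun_apply (phi X e) x) y" for e
      by (rule blinfun_eqI) (simp add: S op.adjointable_ract[OF phi_adjointable])
    moreover have "((\<lambda>e. theta (blinfun_apply (phi X e) x) y) \<longlongrightarrow> S) approx_unit"
      unfolding S by (intro bounded_bilinear.tendsto[OF bounded_bilinear_theta] tendsto_const tendsto_phi_approx_unit)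
    ultimately show "((\<lambda>e. phi X e o\<^sub>L S) \<longlongrightarrow> S) approx_unit" by simp
  qed (auto intro!: bounded_linear.linear bounded_bilinear.bounded_linear_right[OF bb])
qed (auto simp: phi_mult blinfun_compose_assoc intro: that)

text \<open>Composition on the right is made a left action by inserting \<open>star\<close>. It is
  then conjugate linear in a, which does no harm since Cohen factorization is stated for real
  bilinear actions.\<close>

lemma compact_factor_right:
  assumes "T \<in> compacts X"
  obtains a S where "T = S o\<^sub>L phi X (star a)"
proof (rule cohen_factorization)
  have "bounded_linear (\<lambda>a. phi X (star a))"
    by (rule bounded_linear_compose[OF bounded_linear_phi bounded_linear_star])
  then show bb: "bounded_bilinear (\<lambda>a T :: 'x \<Rightarrow>\<^sub>L 'x. T o\<^sub>L phi X (star a))"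
    by (rule bounded_bilinear.comp[OF bounded_bilinear.flip[OF bounded_bilinear_blinfun_compose]
          _ bounded_linear_ident])
  show "((\<lambda>e. T o\<^sub>L phi X (star e)) \<longlongrightarrow> T) approx_unit"
  proof (rule tendsto_on_closure_span[where V = "\<lambda>e T. T o\<^sub>L phi X (star e)" and W = "\<lambda>x. x" and B = 8
    and S = "{theta x y |x y. True}"])
    show "\<forall>\<^sub>F e in approx_unit. \<forall>T :: 'x \<Rightarrow>\<^sub>L 'x. norm (T o\<^sub>L phi X (star e)) \<le> 8 * norm T"
      using approx_unit_contraction
    proof eventually_elim
      case (elim e)
      have "norm (phi X (star e)) \<le> 8"
        using norm_phi_le[of "star e"] norm_unit_contraction[OF elim] by simp
      then show ?case
        by (metis mult.commute mult_right_mono norm_blinfun_compose norm_ge_zero order_trans)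
    qed
    show "T \<in> closure (span {theta x y |x y. True})" using assms by (simp add: compacts_eq)
    fix S assume "S \<in> {theta x y |x y. True}"
    then obtain x y where S: "S = theta x y" by blast
    have "S o\<^sub>L phi X (star e) = theta x (blinfun_apply (phi X e) y)" for e
      by (rule blinfun_eqI) (simp add: S ip_phi_left)
    moreover have "((\<lambda>e. theta x (blinfun_apply (phi X e) y)) \<longlongrightarrow> S) approx_unit"
      unfolding S by (intro bounded_bilinear.tendsto[OF bounded_bilinear_theta] tendsto_const tendsto_phi_approx_unit)
    ultimately show "((\<lambda>e. S o\<^sub>L phi X (star e)) \<longlongrightarrow> S) approx_unit" by simp
  qed (auto intro!: bounded_linear.linear bounded_bilinear.bounded_linear_right[OF bb])
qed (auto simp: phi_mult blinfun_compose_assoc intro: that)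

end

section \<open>Strict topologies\<close>

lemma nondegenerate_self_corr: "nondegenerate (self_corr :: ('a::cstar_algebra, 'a) corr)"
proof -
  have "a \<in> closure (span {blinfun_apply (phi self_corr b) c |b c. True})" for a :: 'a
  proof (rule Lim_in_closed_set[OF closed_closure _ approx_unit_not_bot approx_unit_left])
    have "e * a \<in> span {blinfun_apply (phi self_corr b) c |b c. True}" for e
      by (rule span_base) auto
    then show "\<forall>\<^sub>F e in approx_unit. e * a \<in> closure (span {blinfun_apply (phi self_corr b) c |b c. True})"
      using closure_subset by (intro always_eventually) blast
  qed
  then show ?thesis unfolding nondegenerate_def by blast
qed

interpretation self: nondegenerate_corresp "self_corr :: ('a::cstar_algebra, 'a) corr"
  by unfold_locales (rule correspondence_self_corr nondegenerate_self_corr)+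

lemma blinfun_mult_right_multiplier: "blinfun_mult_right a \<in> multipliers self_corr"
  using self.phi_adjointable[of a] by (simp add: multipliers_def)

text \<open>Left multiplication by a product a e has rank one, and a e tends to a.\<close>

lemma blinfun_mult_right_compact: "blinfun_mult_right a \<in> compacts (self_corr :: ('a::cstar_algebra, 'a) corr)"
proof -
  have "((\<lambda>e. blinfun_mult_right (a * e)) \<longlongrightarrow> blinfun_mult_right a) approx_unit"
    by (intro bounded_linear.tendsto[OF bounded_linear_blinfun_mult_right] approx_unit_right)
  moreover have "blinfun_mult_right (a * e) \<in> compacts self_corr" for e
  proof -
    have "blinfun_mult_right (a * e) = self.theta a (star e)"
      by (rule blinfun_eqI) (simp add: mult.assoc)
    then show ?thesis using self.theta_compact by simp
  qed
  ultimately show ?thesis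
    by (intro Lim_in_closed_set[OF _ _ approx_unit_not_bot])
      (auto simp: compacts_def intro: always_eventually)
qed

lemma multiplier_mult:
  assumes "l \<in> multipliers (self_corr :: ('a::cstar_algebra, 'a) corr)"
  shows "blinfun_apply l (a * b) = blinfun_apply l a * b"
  using self.op.adjointable_ract assms by (simp add: multipliers_def)

lemma star_mult_multiplier:
  assumes "l \<in> multipliers (self_corr :: ('a::cstar_algebra, 'a) corr)"
  shows "star a * blinfun_apply l b = star (blinfun_apply (adjoint self_corr self_corr l) a) * b"
  using self.op.ip_adjoint'[of l a b] assms by (simp add: multipliers_def)

lemma continuous_map_strict_iff:
  "continuous_map Z (strict X) m \<longleftrightarrow> (\<forall>z\<in>topspace Z. m z \<in> multipliers X) \<and>
     (\<forall>T\<in>compacts X. continuous_map Z euclidean (\<lambda>z. T o\<^sub>L m z)) \<and>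
     (\<forall>a. continuous_map Z euclidean (\<lambda>z. blinfun_apply (m z) a))" (is "?L = ?R")
proof
  let ?f = "\<lambda>m. (\<lambda>T\<in>compacts X. T o\<^sub>L m, \<lambda>a\<in>UNIV. blinfun_apply m a)"
  let ?P = "prod_topology (product_topology (\<lambda>_. euclidean) (compacts X)) (product_topology (\<lambda>_. euclidean) UNIV)"
  {
    assume L: ?L
    have "topspace (strict X) = multipliers X"
      by (auto simp: strict_def topspace_pullback_topology)
    then have mem: "\<forall>z\<in>topspace Z. m z \<in> multipliers X"
      using continuous_map_image_subset_topspace[OF L] by auto
    have f: "continuous_map (strict X) ?P ?f"
      using continuous_map_pullback[OF continuous_map_id, of "multipliers X" ?f ?P]
      by (simp add: strict_def)
    have "continuous_map Z ?P (?f \<circ> m)" using L f by (rule continuous_map_compose)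
    then show ?R
      using mem by (auto simp: continuous_map_pairwise o_def continuous_map_componentwise)
  next
    assume R: ?R
    show ?L
      unfolding strict_def
    proof (rule continuous_map_pullback')
      show "continuous_map Z ?P (?f \<circ> m)"
        using R by (auto simp: continuous_map_pairwise o_def continuous_map_componentwise)
    qed (use R in auto)
  }
qed

lemma topspace_strict: "topspace (strict X) = multipliers X"
  by (auto simp: strict_def topspace_pullback_topology)

lemma continuous_map_strict_L_iff:
  "continuous_map Z (strict_L X) h \<longleftrightarrow> (\<forall>z\<in>topspace Z. h z \<in> adjointable X X) \<and>
     (\<forall>T\<in>compacts X. continuous_map Z euclidean (\<lambda>z. T o\<^sub>L h z)) \<and>
     (\<forall>T\<in>compacts X. continuous_map Z euclidean (\<lambda>z. h z o\<^sub>L T))" (is "?L = ?R")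
proof
  let ?f = "\<lambda>S. (\<lambda>T\<in>compacts X. T o\<^sub>L S, \<lambda>T\<in>compacts X. S o\<^sub>L T)"
  let ?P = "prod_topology (product_topology (\<lambda>_. euclidean) (compacts X)) (product_topology (\<lambda>_. euclidean) (compacts X))"
  {
    assume L: ?L
    have "topspace (strict_L X) = adjointable X X"
      by (auto simp: strict_L_def topspace_pullback_topology)
    then have mem: "\<forall>z\<in>topspace Z. h z \<in> adjointable X X"
      using continuous_map_image_subset_topspace[OF L] by auto
    have f: "continuous_map (strict_L X) ?P ?f"
      using continuous_map_pullback[OF continuous_map_id, of "adjointable X X" ?f ?P]
      by (simp add: strict_L_def)
    have "continuous_map Z ?P (?f \<circ> h)" using L f by (rule continuous_map_compose)
    then show ?R
      using mem by (auto simp: continuous_map_pairwise o_def continuous_map_componentwise)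
  next
    assume R: ?R
    show ?L
      unfolding strict_L_def
    proof (rule continuous_map_pullback')
      show "continuous_map Z ?P (?f \<circ> h)"
        using R by (auto simp: continuous_map_pairwise o_def continuous_map_componentwise)
    qed (use R in auto)
  }
qed

lemma limitin_strictI:
  assumes l: "l \<in> multipliers X" and f: "\<And>e. f e \<in> multipliers X"
    and T: "\<And>T. T \<in> compacts X \<Longrightarrow> ((\<lambda>e. T o\<^sub>L f e) \<longlongrightarrow> T o\<^sub>L l) F"
    and a: "\<And>a. ((\<lambda>e. blinfun_apply (f e) a) \<longlongrightarrow> blinfun_apply l a) F"
  shows "limitin (strict X) f l F"
proof -
  let ?f = "\<lambda>m. (\<lambda>T\<in>compacts X. T o\<^sub>L m, \<lambda>a\<in>UNIV. blinfun_apply m a)"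
  let ?P = "prod_topology (product_topology (\<lambda>_. euclidean) (compacts X)) (product_topology (\<lambda>_. euclidean) UNIV)"
  have lim: "limitin ?P (?f \<circ> f) (?f l) F"
    using T a by (auto simp: limitin_pairwise limitin_componentwise o_def)
  show ?thesis
    unfolding limitin_def
  proof (intro conjI allI impI)
    show "l \<in> topspace (strict X)" using l by (simp add: topspace_strict)
    fix U assume "openin (strict X) U \<and> l \<in> U"
    then obtain V where V: "openin ?P V" "U = ?f -` V \<inter> multipliers X" "?f l \<in> V"
      unfolding strict_def openin_pullback_topology by auto
    then have "\<forall>\<^sub>F e in F. (?f \<circ> f) e \<in> V" using lim unfolding limitin_def by blast
    then show "\<forall>\<^sub>F e in F. f e \<in> U" using V(2) f by (auto elim: eventually_mono)
  qed
qed

text \<open>Multipliers are strict limits of elements of A along the explicit family l e. On the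
  compact side, T = S (star a) turns T (l e) into S (b e) with b the adjoint of (adjoint l) a, and b
  e tends to b in norm.\<close>

lemma strict_approx:
  fixes l :: "'a::cstar_algebra \<Rightarrow>\<^sub>L 'a"
  assumes l: "l \<in> multipliers self_corr"
  shows "limitin (strict self_corr) (\<lambda>e. blinfun_mult_right (blinfun_apply l e)) l approx_unit"
proof (rule limitin_strictI[OF l blinfun_mult_right_multiplier])
  fix T assume "T \<in> compacts (self_corr :: ('a, 'a) corr)"
  then obtain a S where T: "T = S o\<^sub>L blinfun_mult_right (star a)"
    using self.compact_factor_right by (metis self_corr_simps(3))
  define b where "b = star (blinfun_apply (adjoint self_corr self_corr l) a)"
  have "T o\<^sub>L blinfun_mult_right (blinfun_apply l e) = S o\<^sub>L blinfun_mult_right (b * e)" for e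
    unfolding T b_def by (rule blinfun_eqI) (simp add: star_mult_multiplier[OF l, symmetric] mult.assoc[symmetric])
  moreover have "((\<lambda>e. S o\<^sub>L blinfun_mult_right (b * e)) \<longlongrightarrow> S o\<^sub>L blinfun_mult_right b) approx_unit"
    by (intro tendsto_intros bounded_bilinear.tendsto[OF bounded_bilinear_blinfun_compose]
        bounded_linear.tendsto[OF bounded_linear_blinfun_mult_right] approx_unit_right)
  moreover have "S o\<^sub>L blinfun_mult_right b = T o\<^sub>L l"
    unfolding T b_def by (rule blinfun_eqI) (simp add: star_mult_multiplier[OF l])
  ultimately show "((\<lambda>e. T o\<^sub>L blinfun_mult_right (blinfun_apply l e)) \<longlongrightarrow> T o\<^sub>L l) approx_unit" by simp
next
  fix a
  have "((\<lambda>e. blinfun_apply l (e * a)) \<longlongrightarrow> blinfun_apply l a) approx_unit"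
    by (intro tendsto_intros approx_unit_left)
  then show "((\<lambda>e. blinfun_apply (blinfun_mult_right (blinfun_apply l e)) a) \<longlongrightarrow> blinfun_apply l a) approx_unit"
    by (simp add: multiplier_mult[OF l])
qed

text \<open>The embedding of A into its multipliers is isometric, so its inverse is continuous on
  the range.\<close>

lemma continuous_map_of_blinfun_mult_right:
  fixes b :: "'z \<Rightarrow> 'a::cstar_algebra"
  assumes "continuous_map Z euclidean (\<lambda>z. blinfun_mult_right (b z))"
  shows "continuous_map Z euclidean b"
proof -
  let ?L = "blinfun_mult_right :: 'a \<Rightarrow> 'a \<Rightarrow>\<^sub>L 'a"
  have d: "dist (?L x) (?L y) = dist x y" for x y
    using linear_diff[OF bounded_linear.linear[OF bounded_linear_blinfun_mult_right], of x y]
    by (simp add: dist_norm flip: norm_blinfun_mult_right)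
  have inj: "inj ?L" by (rule injI) (metis d dist_eq_0_iff)
  have "continuous_on (range ?L) (inv ?L)"
    unfolding continuous_on_iff by (auto simp: inv_f_f[OF inj] d)
  moreover have "continuous_map Z (top_of_set (range ?L)) (\<lambda>z. ?L (b z))"
    using assms by (auto intro: continuous_map_into_subtopology)
  ultimately have "continuous_map Z euclidean (inv ?L \<circ> (\<lambda>z. ?L (b z)))"
    by (intro continuous_map_compose) auto
  then show ?thesis by (simp add: o_def inv_f_f[OF inj])
qed

section \<open>The strict extension of the left action\<close>

context nondegenerate_corresp
begin

lemma phi_phi: "blinfun_apply (phi X a) (blinfun_apply (phi X b) x) = blinfun_apply (phi X (a * b)) x"
  by (simp add: phi_mult)

lemma norm_phi_multiplier_le:
  assumes "unit_contraction e"
  shows "norm (phi X (blinfun_apply l e)) \<le> 8 * norm l"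
proof -
  have "norm (phi X (blinfun_apply l e)) \<le> norm (blinfun_apply l e) * 4" by (rule norm_phi_le)
  also have "\<dots> \<le> (norm l * norm e) * 4" by (intro mult_right_mono norm_blinfun) simp
  also have "\<dots> \<le> (norm l * 2) * 4"
    by (intro mult_right_mono mult_left_mono norm_unit_contraction[OF assms]) auto
  finally show ?thesis by simp
qed

text \<open>The operators phi (l e) are bounded by 8 times the norm of l and converge to the
  prescribed values on the vectors phi a x, since (l e) a = l (e a). Hence the prescription is
  consistent on the span and satisfies the same bound.\<close>

lemma ex_multiplier_action:
  assumes l: "l \<in> multipliers self_corr"
  shows "\<exists>T. (\<forall>a x. blinfun_apply T (blinfun_apply (phi X a) x) = blinfun_apply (phi X (blinfun_apply l a)) x) \<and>
    norm T \<le> 8 * norm l"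
proof -
  define S where "S = {(blinfun_apply (phi X a) x, blinfun_apply (phi X (blinfun_apply l a)) x) |a x. True}"
  have lim: "((\<lambda>e. blinfun_apply (phi X (blinfun_apply l e)) w) \<longlongrightarrow> y) approx_unit" if "(w, y) \<in> span S" for w y
  proof -
    have "((\<lambda>e. blinfun_apply (phi X (blinfun_apply l e)) (fst p)) \<longlongrightarrow> snd p) approx_unit" if "p \<in> span S" for p
      using that
    proof (induction rule: span_induct_alt)
      case base
      then show ?case by (simp add: blinfun.zero_right)
    next
      case (step c p q)
      then obtain a x where p: "p = (blinfun_apply (phi X a) x, blinfun_apply (phi X (blinfun_apply l a)) x)"
        by (auto simp: S_def)
      have "((\<lambda>e. blinfun_apply (phi X (blinfun_apply l (e * a))) x) \<longlongrightarrow> snd p) approx_unit"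
        unfolding p by (auto intro!: tendsto_intros bounded_linear.tendsto[OF bounded_linear_phi] approx_unit_left)
      then have "((\<lambda>e. blinfun_apply (phi X (blinfun_apply l e)) (fst p)) \<longlongrightarrow> snd p) approx_unit"
        by (simp add: p multiplier_mult[OF l] phi_mult)
      then show ?case using step.IH
        by (auto simp: blinfun.add_right blinfun.scaleR_right intro!: tendsto_intros)
    qed
    from this[OF that] show ?thesis by simp
  qed
  have le: "norm y \<le> 8 * norm l * norm w" if "(w, y) \<in> span S" for w y
  proof (rule tendsto_upperbound[OF tendsto_norm[OF lim[OF that]]])
    show "\<forall>\<^sub>F e in approx_unit. norm (blinfun_apply (phi X (blinfun_apply l e)) w) \<le> 8 * norm l * norm w"
      using approx_unit_contraction
    proof eventually_elim
      case (elim e)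
      show ?case
        using order_trans[OF norm_blinfun mult_right_mono[OF norm_phi_multiplier_le[OF elim]]] by simp
    qed
  qed (rule approx_unit_not_bot)
  have "fst ` S = {blinfun_apply (phi X a) x |a x. True}"
    unfolding S_def by force
  then have "closure (fst ` span S) = UNIV"
    using phi_dense linear_span_image[of fst S] by (simp add: linear_fst)
  then obtain T where T: "bounded_linear T" "\<And>w y. (w, y) \<in> span S \<Longrightarrow> T w = y"
    "\<And>w. norm (T w) \<le> 8 * norm l * norm w"
    using bounded_linear_extension_of_relation[OF subspace_span le] by metis
  have "T (blinfun_apply (phi X a) x) = blinfun_apply (phi X (blinfun_apply l a)) x" for a x
    by (rule T(2), rule span_base) (auto simp: S_def)
  moreover have "norm (Blinfun T) \<le> 8 * norm l"
    by (rule norm_blinfun_bound) (auto simp: bounded_linear_Blinfun_apply[OF T(1)] T(3))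
  ultimately show ?thesis by (intro exI[of _ "Blinfun T"]) (simp add: bounded_linear_Blinfun_apply[OF T(1)])
qed

lemma blinfun_eq_on_phi:
  fixes S T :: "'x \<Rightarrow>\<^sub>L 'v::real_normed_vector"
  assumes "\<And>a x. blinfun_apply S (blinfun_apply (phi X a) x) = blinfun_apply T (blinfun_apply (phi X a) x)"
  shows "S = T"
proof (rule blinfun_eqI)
  fix x
  show "blinfun_apply S x = blinfun_apply T x"
    by (rule bounded_linear_eq_on_dense[OF _ _ _ phi_dense])
      (use assms in \<open>auto intro: blinfun.bounded_linear_right\<close>)
qed

definition multiplier_action :: "('a \<Rightarrow>\<^sub>L 'a) \<Rightarrow> 'x \<Rightarrow>\<^sub>L 'x" where
  "multiplier_action l = (SOME T. (\<forall>a x. blinfun_apply T (blinfun_apply (phi X a) x) =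
     blinfun_apply (phi X (blinfun_apply l a)) x) \<and> norm T \<le> 8 * norm l)"

lemma multiplier_action:
  assumes "l \<in> multipliers self_corr"
  shows "blinfun_apply (multiplier_action l) (blinfun_apply (phi X a) x) = blinfun_apply (phi X (blinfun_apply l a)) x"
    and "norm (multiplier_action l) \<le> 8 * norm l"
  using someI_ex[OF ex_multiplier_action[OF assms]] unfolding multiplier_action_def by blast+

lemma multiplier_action_compose_phi:
  assumes "l \<in> multipliers self_corr"
  shows "multiplier_action l o\<^sub>L phi X a = phi X (blinfun_apply l a)"
  by (rule blinfun_eqI) (simp add: multiplier_action[OF assms])

lemma phi_compose_multiplier_action:
  assumes l: "l \<in> multipliers self_corr"
  shows "phi X (star a) o\<^sub>L multiplier_action l = phi X (star (blinfun_apply (adjoint self_corr self_corr l) a))"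
  by (rule blinfun_eq_on_phi)
    (simp add: multiplier_action[OF l] star_mult_multiplier[OF l] phi_phi)

lemma multiplier_action_mult: "multiplier_action (blinfun_mult_right a) = phi X a"
  by (rule blinfun_eq_on_phi)
    (simp add: multiplier_action[OF blinfun_mult_right_multiplier] phi_mult)

text \<open>The adjoint is the action of the adjoint multiplier. The identity is verified on vectors
  phi a x and phi b y and extended by density in one argument at a time.\<close>

lemma multiplier_action_adjointable:
  assumes l: "l \<in> multipliers self_corr"
  shows "multiplier_action l \<in> adjointable X X"
proof (rule op.adjointableI)
  define k where "k = adjoint self_corr self_corr l"
  have k: "k \<in> multipliers self_corr"
    using adjoint_adjointable[OF hilbert_module_self_corr hilbert_module_self_corr] l
    by (simp add: multipliers_def k_def)
  have kl: "adjoint self_corr self_corr k = l"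
    using adjoint_adjointable(2)[OF hilbert_module_self_corr hilbert_module_self_corr] l
    by (simp add: multipliers_def k_def)
  fix x y
  have 1: "ip X (blinfun_apply (multiplier_action l) (blinfun_apply (phi X a) x)) (blinfun_apply (phi X b) y) =
    ip X (blinfun_apply (phi X a) x) (blinfun_apply (multiplier_action k) (blinfun_apply (phi X b) y))" for a b x y
    using star_mult_multiplier[OF k, of a b] kl
    by (simp add: multiplier_action[OF l] multiplier_action[OF k] ip_phi_left phi_phi)
  have 2: "ip X (blinfun_apply (multiplier_action l) (blinfun_apply (phi X a) x)) y =
    ip X (blinfun_apply (phi X a) x) (blinfun_apply (multiplier_action k) y)" for a x y
    by (rule bounded_linear_eq_on_dense[OF _ _ _ phi_dense, of "\<lambda>y. ip X _ y" "\<lambda>y. ip X _ (blinfun_apply (multiplier_action k) y)"])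
      (auto simp: 1 intro: ip.bounded_linear_right bounded_linear_compose[OF ip.bounded_linear_right blinfun.bounded_linear_right])
  show "ip X (blinfun_apply (multiplier_action l) x) y = ip X x (blinfun_apply (multiplier_action k) y)"
    by (rule bounded_linear_eq_on_dense[OF _ _ _ phi_dense, of "\<lambda>x. ip X (blinfun_apply (multiplier_action l) x) y" "\<lambda>x. ip X x _"])
      (auto simp: 2 intro: ip.bounded_linear_left bounded_linear_compose[OF ip.bounded_linear_left blinfun.bounded_linear_right])
qed

text \<open>Each seminorm of \<open>strict_L X\<close> is reduced to one of the strict topology of
  M(A). For T = phi b R the composite l T is phi (l b) R. For T = S phi (star a) the composite T l
  is S phi c, where left multiplication by c is (star a) l; as left multiplication by
  \<open>star a\<close> is compact, c depends continuously on l.\<close>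

lemma continuous_multiplier_action:
  "continuous_map (strict self_corr) (strict_L X) (restrict multiplier_action (multipliers self_corr))"
  unfolding continuous_map_strict_L_iff
proof (intro conjI ballI)
  let ?M = "multipliers (self_corr :: ('a, 'a) corr)"
  \<comment> \<open>Unfolding continuity of the identity yields continuity of l \<mapsto> T l and of
    l \<mapsto> l a on the strict topology.\<close>
  have id: "continuous_map (strict self_corr) (strict (self_corr :: ('a, 'a) corr)) (\<lambda>l. l)" by simp
  note strict = id[unfolded continuous_map_strict_iff topspace_strict]
  show "restrict multiplier_action ?M z \<in> adjointable X X" if "z \<in> topspace (strict self_corr)" for z
    using that by (simp add: topspace_strict multiplier_action_adjointable)
  fix T assume T: "T \<in> compacts X"
  obtain a S where T1: "T = S o\<^sub>L phi X (star a)" using compact_factor_right[OF T] .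
  have "continuous_map (strict self_corr) euclidean (\<lambda>l. blinfun_mult_right (star (blinfun_apply (adjoint self_corr self_corr l) a)))"
  proof (rule continuous_map_eq)
    show "continuous_map (strict self_corr) euclidean (\<lambda>l. blinfun_mult_right (star a) o\<^sub>L l)"
      using strict blinfun_mult_right_compact by blast
    show "blinfun_mult_right (star a) o\<^sub>L l = blinfun_mult_right (star (blinfun_apply (adjoint self_corr self_corr l) a))"
      if "l \<in> topspace (strict self_corr)" for l
      using that by (intro blinfun_eqI) (simp add: topspace_strict star_mult_multiplier)
  qed
  then have c: "continuous_map (strict self_corr) euclidean (\<lambda>l. star (blinfun_apply (adjoint self_corr self_corr l) a))"
    by (rule continuous_map_of_blinfun_mult_right)
  have "continuous_on UNIV (\<lambda>b. S o\<^sub>L phi X b)"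
    by (intro linear_continuous_on bounded_linear_compose[OF _ bounded_linear_phi]
        bounded_bilinear.bounded_linear_right[OF bounded_bilinear_blinfun_compose])
  then have "continuous_map (strict self_corr) euclidean ((\<lambda>b. S o\<^sub>L phi X b) \<circ> (\<lambda>l. star (blinfun_apply (adjoint self_corr self_corr l) a)))"
    by (intro continuous_map_compose[OF c]) simp
  then show "continuous_map (strict self_corr) euclidean (\<lambda>l. T o\<^sub>L restrict multiplier_action ?M l)"
    by (rule continuous_map_eq) (simp add: topspace_strict T1 blinfun_compose_assoc phi_compose_multiplier_action)
  obtain b R where T2: "T = phi X b o\<^sub>L R" using compact_factor_left[OF T] .
  have "continuous_on UNIV (\<lambda>b. phi X b o\<^sub>L R)"
    by (intro linear_continuous_on bounded_linear_compose[OF _ bounded_linear_phi]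
        bounded_bilinear.bounded_linear_left[OF bounded_bilinear_blinfun_compose])
  then have "continuous_map (strict self_corr) euclidean ((\<lambda>b. phi X b o\<^sub>L R) \<circ> (\<lambda>l. blinfun_apply l b))"
    using strict by (intro continuous_map_compose) auto
  then show "continuous_map (strict self_corr) euclidean (\<lambda>l. restrict multiplier_action ?M l o\<^sub>L T)"
    by (rule continuous_map_eq)
      (simp add: topspace_strict T2 multiplier_action_compose_phi flip: blinfun_compose_assoc)
qed

text \<open>A strictly continuous extension of \<open>\<phi>\<close> is determined by its values on the net
  \<open>l e \<rightarrow> l\<close>, tested against \<open>K(X)\<close>.\<close>

lemma strict_ext_eq: "strict_ext X = restrict multiplier_action (multipliers self_corr)"
  unfolding strict_ext_def
proof (rule the_equality)
  let ?M = "multipliers (self_corr :: ('a, 'a) corr)" and ?E = "restrict multiplier_action (multipliers self_corr)"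
  have E: "?E \<in> extensional ?M \<and> continuous_map (strict self_corr) (strict_L X) ?E \<and>
    (\<forall>a. ?E (blinfun_mult_right a) = phi X a)"
    using continuous_multiplier_action by (simp add: blinfun_mult_right_multiplier multiplier_action_mult)
  then show "?E \<in> extensional ?M \<and> continuous_map (strict self_corr) (strict_L X) ?E \<and>
    (\<forall>a. ?E (blinfun_mult_right a) = phi X a)" .
  have lim: "((\<lambda>e. phi X (blinfun_apply l e) o\<^sub>L T) \<longlongrightarrow> h l o\<^sub>L T) approx_unit"
    if h: "h \<in> extensional ?M \<and> continuous_map (strict self_corr) (strict_L X) h \<and>
      (\<forall>a. h (blinfun_mult_right a) = phi X a)" and "l \<in> ?M" "T \<in> compacts X" for h l T
  proof -
    have "continuous_map (strict self_corr) euclidean (\<lambda>l. h l o\<^sub>L T)"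
      using h \<open>T \<in> compacts X\<close> by (simp add: continuous_map_strict_L_iff)
    from continuous_map_limit[OF this strict_approx[OF \<open>l \<in> ?M\<close>]] show ?thesis using h by (simp add: o_def)
  qed
  fix h
  assume h: "h \<in> extensional ?M \<and> continuous_map (strict self_corr) (strict_L X) h \<and>
    (\<forall>a. h (blinfun_mult_right a) = phi X a)"
  show "h = ?E"
  proof (rule extensionalityI[of _ ?M])
    fix l assume l: "l \<in> ?M"
    have comp: "h l o\<^sub>L T = ?E l o\<^sub>L T" if "T \<in> compacts X" for T
      using lim[OF h l that] lim[OF E l that] tendsto_unique[OF approx_unit_not_bot] by blast
    have *: "blinfun_apply (h l) (ract X x (ip X y z)) = blinfun_apply (?E l) (ract X x (ip X y z))" for x y z
      using arg_cong[OF comp[OF theta_compact[of x y]], of "\<lambda>T. blinfun_apply T z"] by simp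
    show "h l = ?E l"
    proof (rule blinfun_eqI)
      fix x
      show "blinfun_apply (h l) x = blinfun_apply (?E l) x"
        by (rule bounded_linear_eq_on_dense[OF _ _ _ ract_ip_dense])
          (use * in \<open>auto intro: blinfun.bounded_linear_right\<close>)
    qed
  qed (use h E in auto)
qed

lemma strict_ext_phi:
  assumes "l \<in> multipliers self_corr"
  shows "blinfun_apply (strict_ext X l) (blinfun_apply (phi X a) x) = blinfun_apply (phi X (blinfun_apply l a)) x"
  using multiplier_action(1)[OF assms] assms by (simp add: strict_ext_eq)

lemma norm_strict_ext_le:
  assumes "l \<in> multipliers self_corr"
  shows "norm (strict_ext X l) \<le> 8 * norm l"
  using multiplier_action(2)[OF assms] assms by (simp add: strict_ext_eq)

end

section \<open>Elementary tensors in \<open>C\<^sub>0(G, X)\<close>\<close>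

lemma Hausdorff_space_euclidean: "Hausdorff_space (euclidean :: 'g::t2_space topology)"
  unfolding Hausdorff_space_def disjnt_def by simp (metis hausdorff)

lemma ex_bump:
  fixes r :: "'g::t2_space"
  assumes lc: "locally_compact_space (euclidean :: 'g topology)" and U: "open U" "r \<in> U"
  obtains h :: "'g \<Rightarrow> real" and \<beta> :: "('g, complex) c0" where
    "continuous_on UNIV h" "h r = 1" "\<And>s. 0 \<le> h s" "\<And>s. h s \<le> 1" "\<And>s. s \<notin> U \<Longrightarrow> h s = 0"
    "\<And>s. c0_apply \<beta> s = complex_of_real (h s)"
proof -
  obtain V K where V: "open V" "compact K" "r \<in> V" "V \<subseteq> K"
  proof -
    have "\<exists>V K. open V \<and> compact K \<and> r \<in> V \<and> V \<subseteq> K"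
      using lc by (simp add: locally_compact_space_def)
    then show ?thesis using that by blast
  qed
  have "completely_regular_space (euclidean :: 'g topology)"
    using locally_compact_regular_imp_completely_regular_space[OF lc] Hausdorff_space_euclidean by blast
  \<comment> \<open>Separating r from the complement of U \<inter> V, with V inside a compact set,
    makes the bump vanish outside that compact set.\<close>
  moreover have "closed (- (U \<inter> V))" "r \<notin> - (U \<inter> V)" using U V by auto
  ultimately obtain f :: "'g \<Rightarrow> real" where f: "continuous_map euclidean (top_of_set {0..1}) f" "f r = 0"
    "f ` (- (U \<inter> V)) \<subseteq> {1}"
    unfolding completely_regular_space_def closed_closedin by (metis Diff_iff UNIV_I topspace_euclidean)
  define h where "h s = 1 - f s" for s
  have fc: "continuous_on UNIV f" and f01: "f s \<in> {0..1}" for s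
    using f(1) by (auto simp: continuous_map_in_subtopology)
  have h: "continuous_on UNIV h" "h r = 1" "\<And>s. 0 \<le> h s" "\<And>s. h s \<le> 1" "\<And>s. s \<notin> U \<inter> V \<Longrightarrow> h s = 0"
    using fc f f01 by (auto simp: h_def intro!: continuous_intros)
  have "(\<lambda>s. complex_of_real (h s)) \<in> c0_set"
  proof (rule c0_setI)
    show "continuous_on UNIV (\<lambda>s. complex_of_real (h s))" by (intro continuous_intros h)
    fix e :: real assume "e > 0"
    then have "norm (complex_of_real (h s)) < e" if "s \<notin> K" for s
    proof -
      have "s \<notin> U \<inter> V" using V(4) that by blast
      then show ?thesis using h(5)[of s] \<open>e > 0\<close> by simp
    qed
    then show "\<exists>K. compact K \<and> (\<forall>s. s \<notin> K \<longrightarrow> norm (complex_of_real (h s)) < e)" using V by blast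
  qed
  then show thesis using that[of h "Abs_c0 (\<lambda>s. complex_of_real (h s))"] h
    by (auto simp: Abs_c0_inverse)
qed

section \<open>Pointwise operations on functions vanishing at infinity\<close>

lemmas c0_rep_eq = zero_c0.rep_eq plus_c0.rep_eq minus_c0.rep_eq uminus_c0.rep_eq scaleR_c0.rep_eq
  scaleC_c0.rep_eq times_c0.rep_eq star_c0.rep_eq

lemma bounded_linear_c0_apply: "bounded_linear (\<lambda>f. c0_apply f r)"
  by (rule bounded_linear_intro[where K = 1]) (simp_all add: c0_rep_eq norm_c0_upper)

lemma c0_apply_sum: "c0_apply (\<Sum>i\<in>I. f i) r = (\<Sum>i\<in>I. c0_apply (f i) r)"
  using linear_sum[OF bounded_linear.linear[OF bounded_linear_c0_apply]] .

lemma continuous_c0_apply: "continuous_on S (c0_apply f)"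
  using c0_continuous[OF c0_apply] continuous_on_subset by blast

definition c0_map2 :: "('x::real_normed_vector \<Rightarrow> 'y::real_normed_vector \<Rightarrow> 'z::real_normed_vector) \<Rightarrow>
    ('g::topological_space, 'x) c0 \<Rightarrow> ('g, 'y) c0 \<Rightarrow> ('g, 'z) c0" where
  "c0_map2 B f g = Abs_c0 (\<lambda>r. B (c0_apply f r) (c0_apply g r))"

lemma c0_map2_apply:
  assumes "bounded_bilinear B"
  shows "c0_apply (c0_map2 B f g) r = B (c0_apply f r) (c0_apply g r)"
proof -
  obtain K where K: "K > 0" "\<And>x y. norm (B x y) \<le> norm x * norm y * K"
    using bounded_bilinear.pos_bounded[OF assms] by blast
  have "(\<lambda>r. B (c0_apply f r) (c0_apply g r)) \<in> c0_set"
  proof (rule c0_dominated[OF c0_apply])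
    show "continuous_on UNIV (\<lambda>r. B (c0_apply f r) (c0_apply g r))"
      by (rule bounded_bilinear.continuous_on[OF assms continuous_c0_apply continuous_c0_apply])
    fix r
    have "norm (B (c0_apply f r) (c0_apply g r)) \<le> norm (c0_apply f r) * norm (c0_apply g r) * K" by (rule K)
    also have "\<dots> \<le> norm f * norm (c0_apply g r) * K"
      using K(1) by (intro mult_right_mono norm_c0_upper) auto
    finally show "norm (B (c0_apply f r) (c0_apply g r)) \<le> (norm f * K) * norm (c0_apply g r)"
      by (simp add: mult_ac)
  qed
  then show ?thesis by (simp add: c0_map2_def Abs_c0_inverse)
qed

lemma bounded_bilinear_c0_map2:
  assumes "bounded_bilinear B"
  shows "bounded_bilinear (c0_map2 B)"
proof -
  interpret bounded_bilinear B by (rule assms)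
  obtain K where K: "K > 0" "\<And>x y. norm (B x y) \<le> norm x * norm y * K" using pos_bounded by blast
  note app = c0_map2_apply[OF assms]
  have "norm (c0_map2 B f g) \<le> norm f * norm g * K" for f :: "('e::topological_space, 'a) c0" and g
  proof (rule norm_c0_least)
    fix r
    have "norm (B (c0_apply f r) (c0_apply g r)) \<le> norm (c0_apply f r) * norm (c0_apply g r) * K" by (rule K)
    also have "\<dots> \<le> norm f * norm g * K"
      using K(1) by (intro mult_right_mono mult_mono norm_c0_upper) auto
    finally show "norm (c0_apply (c0_map2 B f g) r) \<le> norm f * norm g * K" by (simp add: app)
  qed
  then show ?thesis
    by (intro bounded_bilinear.intro)
      (auto intro!: c0_eqI simp: app c0_rep_eq add_left add_right scaleR_left scaleR_right)
qed

definition c0_elem :: "'x::cbanach \<Rightarrow> ('g::topological_space, complex) c0 \<Rightarrow> ('g, 'x) c0" where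
  "c0_elem x g = Abs_c0 (\<lambda>r. c0_apply g r *\<^sub>C x)"

lemma c0_elem_apply [simp]: "c0_apply (c0_elem x g) r = c0_apply g r *\<^sub>C x"
proof -
  have "(\<lambda>r. c0_apply g r *\<^sub>C x) \<in> c0_set"
    by (rule c0_dominated[OF c0_apply, where C = "norm x"])
      (auto intro!: continuous_intros continuous_c0_apply simp: norm_scaleC mult.commute)
  then show ?thesis by (simp add: c0_elem_def Abs_c0_inverse)
qed

lemma cbilinear_c0_elem: "cbilinear c0_elem"
  unfolding cbilinear_def
  by (auto intro!: c0_eqI simp: c0_rep_eq scaleC_add_left scaleC_add_right scaleC_scaleC
      scaleC_complex_def mult.commute)

interpretation elem: complex_bilinear c0_elem
  by unfold_locales (rule cbilinear_c0_elem)

text \<open>A partition of unity subordinate to a finite cover on which \<open>f\<close> is almost constant.\<close>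

lemma c0_elem_dense:
  assumes lc: "locally_compact_space (euclidean :: 'g::t2_space topology)"
  shows "closure (span {c0_elem x g |x g. True}) = (UNIV :: ('g, 'x::cbanach) c0 set)"
proof -
  have "\<exists>F\<in>span {c0_elem x g |x g. True}. dist F f < \<epsilon>" if "\<epsilon> > 0" for f :: "('g, 'x) c0" and \<epsilon>
  proof -
    define \<delta> where "\<delta> = \<epsilon> / 3"
    have \<delta>: "\<delta> > 0" using that by (simp add: \<delta>_def)
    obtain K where K: "compact K" "\<And>r. r \<notin> K \<Longrightarrow> norm (c0_apply f r) < \<delta>"
      using c0_vanishes[OF c0_apply \<delta>] by blast
    define U where "U c = {s. norm (c0_apply f s - c0_apply f c) < \<delta>}" for c
    have U: "open (U c)" "c \<in> U c" for c
      unfolding U_def using \<delta> by (auto intro!: open_Collect_less continuous_intros continuous_c0_apply)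
    have "\<exists>(h :: 'g \<Rightarrow> real) \<beta> :: ('g, complex) c0. continuous_on UNIV h \<and> h c = 1 \<and> (\<forall>s. 0 \<le> h s) \<and> (\<forall>s. h s \<le> 1) \<and>
      (\<forall>s. s \<notin> U c \<longrightarrow> h s = 0) \<and> (\<forall>s. c0_apply \<beta> s = complex_of_real (h s))" for c
      by (rule ex_bump[OF lc U]) blast
    then obtain h :: "'g \<Rightarrow> 'g \<Rightarrow> real" and \<beta> :: "'g \<Rightarrow> ('g, complex) c0" where h: "\<And>c. continuous_on UNIV (h c)"
      "\<And>c. h c c = 1" "\<And>c s. 0 \<le> h c s" "\<And>c s. s \<notin> U c \<Longrightarrow> h c s = 0"
      "\<And>c s. c0_apply (\<beta> c) s = complex_of_real (h c s)" by metis
    have "open {s. h c s > 1 / 2}" for c by (intro open_Collect_less continuous_intros h)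
    moreover have "K \<subseteq> (\<Union>c\<in>K. {s. h c s > 1 / 2})"
    proof
      fix c assume "c \<in> K"
      then show "c \<in> (\<Union>c\<in>K. {s. h c s > 1 / 2})" by (intro UN_I[of c]) (simp_all add: h(2))
    qed
    ultimately obtain C where C: "C \<subseteq> K" "finite C" "K \<subseteq> (\<Union>c\<in>C. {s. h c s > 1 / 2})"
      using compactE_image[OF K(1)] by metis
    define H where "H s = (\<Sum>c\<in>C. h c s)" for s
    \<comment> \<open>Truncating at 1/2 keeps the denominator away from zero everywhere and changes
      nothing on K, where H is at least 1/2. So the functions p c sum to 1 on K, and p c \<le> 2 h c
      lets them vanish at infinity.\<close>
    define q where "q s = max (H s) (1 / 2)" for s
    have q: "q s \<ge> 1 / 2" "q s > 0" "H s \<le> q s" for s unfolding q_def by (simp_all add: less_max_iff_disj)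
    have qc: "continuous_on UNIV q" unfolding q_def H_def by (intro continuous_intros h)
    have HK: "H s \<ge> 1 / 2" if s: "s \<in> K" for s
    proof -
      obtain c where c: "c \<in> C" "h c s > 1 / 2" using subsetD[OF C(3) s] by auto
      then show ?thesis using member_le_sum[of c C "\<lambda>c. h c s"] h(3) C(2) by (fastforce simp: H_def)
    qed
    define p where "p c s = h c s / q s" for c s
    have p: "0 \<le> p c s" "\<bar>p c s\<bar> \<le> 2 * \<bar>h c s\<bar>" "s \<notin> U c \<Longrightarrow> p c s = 0" for c s
    proof -
      show "0 \<le> p c s" using h(3) q(2)[of s] by (simp add: p_def)
      show "\<bar>p c s\<bar> \<le> 2 * \<bar>h c s\<bar>"
        using mult_left_mono[OF q(1)[of s], of "2 * \<bar>h c s\<bar>"] q(2)[of s] by (simp add: p_def abs_divide pos_divide_le_eq)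
      show "s \<notin> U c \<Longrightarrow> p c s = 0" using h(4) by (simp add: p_def)
    qed
    have psum: "(\<Sum>c\<in>C. p c s) = H s / q s" for s by (simp add: p_def H_def sum_divide_distrib)
    have "(\<lambda>s. complex_of_real (p c s)) \<in> c0_set" for c
    proof (rule c0_dominated[OF c0_apply[of "\<beta> c"], where C = 2])
      show "continuous_on UNIV (\<lambda>s. complex_of_real (p c s))"
        unfolding p_def using q(2) by (intro continuous_intros h qc) (simp add: less_imp_neq[symmetric])
    qed (simp add: h(5) p(2))
    then have "\<exists>P. \<forall>s. c0_apply P s = complex_of_real (p c s)" for c by (metis Abs_c0_inverse)
    then obtain P :: "'g \<Rightarrow> ('g, complex) c0" where P: "\<And>c s. c0_apply (P c) s = complex_of_real (p c s)" by metis
    define F where "F = (\<Sum>c\<in>C. c0_elem (c0_apply f c) (P c))"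
    have "F \<in> span {c0_elem x g |x g. True}"
      unfolding F_def by (intro span_sum span_base) blast
    moreover have "norm (f - F) \<le> 2 * \<delta>"
    proof (rule norm_c0_least)
      fix s
      define a where "a = H s / q s"
      have a: "0 \<le> a" "a \<le> 1" using q[of s] h(3) by (auto simp: a_def H_def sum_nonneg)
      have "c0_apply (f - F) s = c0_apply f s - (\<Sum>c\<in>C. p c s *\<^sub>R c0_apply f c)"
        by (simp add: F_def c0_rep_eq c0_apply_sum P scaleC_of_real)
      \<comment> \<open>The sum is small because p c lives where f is close to its value at c; the
        last term is zero on K and small off K.\<close>
      also have "\<dots> = (\<Sum>c\<in>C. p c s *\<^sub>R (c0_apply f s - c0_apply f c)) + (1 - a) *\<^sub>R c0_apply f s"
        by (simp add: scaleR_diff_right sum_subtractf scaleR_left.sum[symmetric] psum a_def algebra_simps)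
      also have "norm \<dots> \<le> norm (\<Sum>c\<in>C. p c s *\<^sub>R (c0_apply f s - c0_apply f c)) + norm ((1 - a) *\<^sub>R c0_apply f s)"
        by (rule norm_triangle_ineq)
      also have "norm (\<Sum>c\<in>C. p c s *\<^sub>R (c0_apply f s - c0_apply f c)) \<le> (\<Sum>c\<in>C. p c s * \<delta>)"
      proof (rule sum_norm_le)
        fix c
        show "norm (p c s *\<^sub>R (c0_apply f s - c0_apply f c)) \<le> p c s * \<delta>"
          using p(1)[of c s] p(3)[of s c] by (cases "s \<in> U c") (auto simp: U_def intro!: mult_left_mono)
      qed
      also have "\<dots> = a * \<delta>" by (simp add: sum_distrib_right[symmetric] psum a_def)
      also have "a * \<delta> \<le> \<delta>" using a \<delta> by (simp add: mult_left_le_one_le)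
      also have "norm ((1 - a) *\<^sub>R c0_apply f s) \<le> \<delta>"
      proof (cases "s \<in> K")
        case True
        then have "a = 1" using HK[OF True] by (auto simp: a_def q_def max_def)
        then show ?thesis using \<delta> by simp
      next
        case False
        have "(1 - a) * norm (c0_apply f s) \<le> 1 * \<delta>"
          using a K(2)[OF False] \<delta> by (intro mult_mono) auto
        then show ?thesis using a by simp
      qed
      finally show "norm (c0_apply (f - F) s) \<le> 2 * \<delta>" by simp
    qed
    ultimately show ?thesis using \<delta> that
      by (intro bexI[of _ F]) (auto simp: dist_norm norm_minus_commute \<delta>_def)
  qed
  then show ?thesis unfolding set_eq_iff closure_approachable by blast
qed

section \<open>Tensor products with \<open>C\<^sub>0(G)\<close>\<close>

text \<open>It has the exact shape of the premise in the fourth clause of \<open>min_tensor\<close>,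
  so that clause can be folded.\<close>

definition independent_upto :: "nat \<Rightarrow> (nat \<Rightarrow> 'b::complex_normed_vector) \<Rightarrow> bool" where
  "independent_upto n b \<longleftrightarrow> (\<forall>c. (\<Sum>i<n. c i *\<^sub>C b i) = 0 \<longrightarrow> (\<forall>i<n. c i = 0))"

text \<open>Two bilinear maps are treated together because the elementary tensor and the function
  must be rewritten by the same coefficients. A dependent b j is expressed by the others and
  absorbed into their left factors, which shortens the sum by one.\<close>

lemma reduce_to_independent:
  fixes \<beta>1 :: "'a::complex_normed_vector \<Rightarrow> 'b::complex_normed_vector \<Rightarrow> 'c::complex_normed_vector"
    and \<beta>2 :: "'a \<Rightarrow> 'b \<Rightarrow> 'd::complex_normed_vector" and n :: nat
  assumes "cbilinear \<beta>1" "cbilinear \<beta>2"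
  shows "\<exists>m a' b'. independent_upto m b' \<and>
    (\<Sum>i<n. \<beta>1 (a i) (b i)) = (\<Sum>i<m. \<beta>1 (a' i) (b' i)) \<and>
    (\<Sum>i<n. \<beta>2 (a i) (b i)) = (\<Sum>i<m. \<beta>2 (a' i) (b' i))"
proof (induction n arbitrary: a b)
  case 0
  show ?case by (intro exI[of _ 0]) (simp add: independent_upto_def)
next
  case (Suc k)
  interpret b1: complex_bilinear \<beta>1 using assms by unfold_locales
  interpret b2: complex_bilinear \<beta>2 using assms by unfold_locales
  show ?case
  proof (cases "independent_upto (Suc k) b")
    case False
    then obtain c j where c: "(\<Sum>i<Suc k. c i *\<^sub>C b i) = 0" "j < Suc k" "c j \<noteq> 0"
      by (auto simp: independent_upto_def)
    \<comment> \<open>The dependent index j is moved to the last place, so that the remaining terms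
      are again indexed by an initial segment.\<close>
    define p where "p = Transposition.transpose j k"
    have perm: "p permutes {..<Suc k}" unfolding p_def using c(2) by (intro permutes_swap_id) auto
    have pk: "p k = j" by (simp add: p_def)
    define d where "d i = - c (p i) / c j" for i
    have "(\<Sum>i<k. c (p i) *\<^sub>C b (p i)) + c j *\<^sub>C b j = 0"
      using c(1) sum.permute[OF perm, of "\<lambda>i. c i *\<^sub>C b i"] by (simp add: pk)
    then have "c j *\<^sub>C b j = - (\<Sum>i<k. c (p i) *\<^sub>C b (p i))" by (simp add: add_eq_0_iff)
    then have "(1 / c j) *\<^sub>C (c j *\<^sub>C b j) = (1 / c j) *\<^sub>C (- (\<Sum>i<k. c (p i) *\<^sub>C b (p i)))" by simp
    then have bj: "b j = (\<Sum>i<k. d i *\<^sub>C b (p i))"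
      using c(3) by (simp add: scaleC_scaleC scaleC_sum d_def sum_negf[symmetric] del: sum_negf)
    define a1 where "a1 i = a (p i) + d i *\<^sub>C a j" for i
    have red: "(\<Sum>i<Suc k. \<beta> (a i) (b i)) = (\<Sum>i<k. \<beta> (a1 i) (b (p i)))"
      if "cbilinear \<beta>" for \<beta> :: "'a \<Rightarrow> 'b \<Rightarrow> 'e::complex_normed_vector"
    proof -
      interpret complex_bilinear \<beta> using that by unfold_locales
      have "(\<Sum>i<Suc k. \<beta> (a i) (b i)) = (\<Sum>i<k. \<beta> (a (p i)) (b (p i))) + \<beta> (a j) (b j)"
        using sum.permute[OF perm, of "\<lambda>i. \<beta> (a i) (b i)"] by (simp add: pk)
      also have "\<beta> (a j) (b j) = (\<Sum>i<k. \<beta> (d i *\<^sub>C a j) (b (p i)))"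
        by (subst bj) (simp add: sum_right scaleC_left scaleC_right)
      finally show ?thesis by (simp add: a1_def add_left sum.distrib)
    qed
    show ?thesis
      using Suc.IH[of a1 "\<lambda>i. b (p i)"] red[OF assms(1)] red[OF assms(2)] by metis
  qed blast
qed

text \<open>The graph of the identification, tensor first and function second, kept as a relation
  because neither side is known to determine the other in advance.\<close>

definition tensor_graph :: "('x::cbanach \<Rightarrow> ('g::topological_space, complex) c0 \<Rightarrow> 'z::cbanach) \<Rightarrow> ('z \<times> ('g, 'x) c0) set" where
  "tensor_graph u = span {(u x g, c0_elem x g) |x g. True}"

lemma tensor_graph_base: "(u x g, c0_elem x g) \<in> tensor_graph u"
  unfolding tensor_graph_def by (rule span_base) blast

lemma subspace_tensor_graph: "subspace (tensor_graph u)"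
  unfolding tensor_graph_def by (rule subspace_span)

lemma fst_tensor_graph: "fst ` tensor_graph u = span {u x g |x g. True}"
proof -
  have "fst ` {(u x g, c0_elem x g) |x g. True} = {u x g |x g. True}" by force
  then show ?thesis unfolding tensor_graph_def by (simp add: linear_span_image[symmetric] linear_fst)
qed

lemma snd_tensor_graph: "snd ` tensor_graph u = span {c0_elem x g |x g. True}"
proof -
  have "snd ` {(u x g, c0_elem x g) |x g. True} = {c0_elem x g |x g. True}" by force
  then show ?thesis unfolding tensor_graph_def by (simp add: linear_span_image[symmetric] linear_snd)
qed

lemma tensor_graph_sum:
  assumes "cbilinear u" "p \<in> tensor_graph u"
  shows "\<exists>(n::nat) a g. p = ((\<Sum>i<n. u (a i) (g i)), (\<Sum>i<n. c0_elem (a i) (g i)))"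
  using assms(2) unfolding tensor_graph_def
proof (induction rule: span_induct_alt)
  case base
  show ?case by (intro exI[of _ 0]) (simp add: zero_prod_def)
next
  case (step c q p)
  interpret complex_bilinear u using assms(1) by unfold_locales
  obtain x h where q: "q = (u x h, c0_elem x h)" using step by blast
  obtain n :: nat and a g where p: "p = ((\<Sum>i<n. u (a i) (g i)), (\<Sum>i<n. c0_elem (a i) (g i)))"
    using step by blast
  have "c *\<^sub>R q + p = ((\<Sum>i<Suc n. u ((a(n := c *\<^sub>R x)) i) ((g(n := h)) i)), (\<Sum>i<Suc n. c0_elem ((a(n := c *\<^sub>R x)) i) ((g(n := h)) i)))"
    by (simp add: p q scaleR_left elem.scaleR_left add.commute)
  then show ?case by blast
qed

text \<open>Although the span is real, elementary tensors absorb complex scalars.\<close>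

lemma tensor_graph_scaleC:
  assumes "cbilinear u" "(z, f) \<in> tensor_graph u"
  shows "(c *\<^sub>C z, c *\<^sub>C f) \<in> tensor_graph u"
proof -
  interpret complex_bilinear u using assms(1) by unfold_locales
  obtain n :: nat and a g where p: "(z, f) = ((\<Sum>i<n. u (a i) (g i)), (\<Sum>i<n. c0_elem (a i) (g i)))"
    using tensor_graph_sum[OF assms] by blast
  have "(c *\<^sub>C z, c *\<^sub>C f) = (\<Sum>i<n. (u (c *\<^sub>C a i) (g i), c0_elem (c *\<^sub>C a i) (g i)))"
    using p by (simp add: scaleC_sum scaleC_left elem.scaleC_left sum_prod)
  then show ?thesis
    by (simp add: subspace_sum[OF subspace_tensor_graph] tensor_graph_base)
qed

text \<open>It is applied to pairs from a tensor graph, so that a single bilinear map compares the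
  tensor side with the function side.\<close>

lemma bilinear_on_spans:
  assumes B: "\<And>y. linear (\<lambda>x. B x y)" "\<And>x. linear (B x)" and R: "subspace R"
    and base: "\<And>x y. x \<in> S \<Longrightarrow> y \<in> S' \<Longrightarrow> B x y \<in> R"
    and x: "x \<in> span S" and y: "y \<in> span S'"
  shows "B x y \<in> R"
proof -
  have 1: "B s y \<in> R" if "s \<in> S" for s
  proof -
    have "subspace {y. B s y \<in> R}" using linear_subspace_vimage[OF B(2) R] by (simp add: vimage_def)
    then have "span S' \<subseteq> {y. B s y \<in> R}" using base[OF that] by (intro span_minimal) auto
    then show ?thesis using y by blast
  qed
  have "subspace {x. B x y \<in> R}" using linear_subspace_vimage[OF B(1) R] by (simp add: vimage_def)
  then have "span S \<subseteq> {x. B x y \<in> R}" using 1 by (intro span_minimal) auto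
  then show ?thesis using x by blast
qed

definition isometric_iso :: "('a::real_normed_vector \<Rightarrow> 'b::real_normed_vector) \<Rightarrow> bool" where
  "isometric_iso J \<longleftrightarrow> bounded_linear J \<and> (\<forall>x. norm (J x) = norm x) \<and> surj J"

text \<open>R is extended in both directions. The extension J is isometric because equality of norms
  is a closed condition on its graph, and it is surjective because the extension T of the opposite
  direction is a right inverse.\<close>

lemma isometric_extension:
  fixes R :: "('a::banach \<times> 'b::banach) set"
  assumes R: "subspace R" and eq: "\<And>x y. (x, y) \<in> R \<Longrightarrow> norm x = norm y"
    and dense: "closure (fst ` R) = UNIV" "closure (snd ` R) = UNIV"
  obtains J where "isometric_iso J" "\<And>x y. (x, y) \<in> R \<Longrightarrow> J y = x"
proof -
  have "linear (prod.swap :: 'a \<times> 'b \<Rightarrow> _)" by (rule linearI) auto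
  then have R': "subspace (prod.swap ` R)" using R by (rule linear_subspace_image)
  have fst': "fst ` prod.swap ` R = snd ` R" by (simp add: image_comp)
  obtain T where T: "bounded_linear T" "\<And>x y. (x, y) \<in> R \<Longrightarrow> T x = y"
    using bounded_linear_extension_of_relation[OF R _ dense(1), of 1] eq by (metis mult_1 order_refl)
  have "norm y \<le> 1 * norm x" if "(x, y) \<in> prod.swap ` R" for x y using that eq by auto
  then obtain J where J: "bounded_linear J" "\<And>x y. (x, y) \<in> prod.swap ` R \<Longrightarrow> J x = y"
    "\<And>x. (x, J x) \<in> closure (prod.swap ` R)"
    using bounded_linear_extension_of_relation[OF R', of 1] dense(2) fst' by metis
  have J': "J y = x" if "(x, y) \<in> R" for x y using that by (intro J(2)) force
  have "closed {p :: 'b \<times> 'a. norm (snd p) = norm (fst p)}"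
    by (intro closed_Collect_eq continuous_intros)
  then have "closure (prod.swap ` R) \<subseteq> {p. norm (snd p) = norm (fst p)}"
    using eq by (intro closure_minimal) auto
  then have "norm (J y) = norm y" for y using J(3)[of y] by auto
  moreover have "J (T x) = x" for x
  proof (rule bounded_linear_eq_on_dense[of "\<lambda>x. J (T x)" "\<lambda>x. x" "fst ` R"])
    show "bounded_linear (\<lambda>x. J (T x))" by (rule bounded_linear_compose[OF J(1) T(1)])
    show "closure (span (fst ` R)) = UNIV"
      using dense(1) closure_mono[OF span_superset[of "fst ` R"]] by auto
    show "J (T s) = s" if "s \<in> fst ` R" for s
      using that T(2) J' by fastforce
  qed (rule bounded_linear_ident)
  then have "surj J" by (metis surjI)
  ultimately show thesis using that[of J] J(1) J' by (simp add: isometric_iso_def)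
qed

lemma c0_tensor_isometric_iso:
  fixes u :: "'x::cbanach \<Rightarrow> ('g::t2_space, complex) c0 \<Rightarrow> 'z::cbanach"
  assumes lc: "locally_compact_space (euclidean :: 'g topology)"
    and dense: "closure (span {u x g |x g. True}) = UNIV"
    and eq: "\<And>z f. (z, f) \<in> tensor_graph u \<Longrightarrow> norm z = norm f"
  shows "isometric_iso (c0_tensor u)" "(z, f) \<in> tensor_graph u \<Longrightarrow> c0_tensor u f = z"
proof -
  obtain J where J: "isometric_iso J" "\<And>z f. (z, f) \<in> tensor_graph u \<Longrightarrow> J f = z"
  proof (rule isometric_extension[OF subspace_tensor_graph eq])
    show "closure (fst ` tensor_graph u) = UNIV" "closure (snd ` tensor_graph u) = UNIV"
      unfolding fst_tensor_graph snd_tensor_graph by (rule dense c0_elem_dense[OF lc])+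
  qed blast+
  have "c0_tensor u = J"
    unfolding c0_tensor_def
  proof (rule the_equality)
    have "J (c0_elem x g) = u x g" for x g by (rule J(2)[OF tensor_graph_base])
    then show J': "bounded_linear J \<and> (\<forall>x g. J (Abs_c0 (\<lambda>r. c0_apply g r *\<^sub>C x)) = u x g)"
      using J(1) by (simp add: isometric_iso_def c0_elem_def)
    fix J2 assume J2: "bounded_linear J2 \<and> (\<forall>x g. J2 (Abs_c0 (\<lambda>r. c0_apply g r *\<^sub>C x)) = u x g)"
    have "J2 f = J f" for f
    proof (rule bounded_linear_eq_on_dense[OF _ _ _ c0_elem_dense[OF lc]])
      fix s :: "('g, 'x) c0" assume "s \<in> {c0_elem x g |x g. True}"
      then obtain x g where s: "s = c0_elem x g" by blast
      show "J2 s = J s" unfolding s c0_elem_def using J2 J' by simp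
    qed (use J2 J' in simp_all)
    then show "J2 = J" by blast
  qed
  then show "isometric_iso (c0_tensor u)" "(z, f) \<in> tensor_graph u \<Longrightarrow> c0_tensor u f = z"
    using J by auto
qed

lemma c0_elem_mult: "c0_elem a g * c0_elem b h = c0_elem (a * b) (g * h)"
  for a b :: "'a::cstar_algebra"
  by (rule c0_eqI) (simp add: c0_rep_eq scaleC_mult_left scaleC_mult_right scaleC_scaleC mult.commute)

lemma star_c0_elem: "star (c0_elem a g) = c0_elem (star a) (star g)" for a :: "'a::cstar_algebra"
  by (rule c0_eqI) (simp add: c0_rep_eq star_scaleC star_complex_def)

section \<open>The minimal tensor product with C_0(G)\<close>

locale c0_min_tensor =
  fixes t :: "'a::cstar_algebra \<Rightarrow> ('g::t2_space, complex) c0 \<Rightarrow> 'c::cstar_algebra"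
  assumes lc: "locally_compact_space (euclidean :: 'g topology)" and min_tensor: "min_tensor t"
begin

lemma cbilinear_t: "cbilinear t"
  and t_mult: "t a g * t b h = t (a * b) (g * h)"
  and star_t: "star (t a g) = t (star a) (star g)"
  and t_independent: "independent_upto n gs \<Longrightarrow> (\<Sum>i<n. t (as i) (gs i)) = 0 \<Longrightarrow> i < n \<Longrightarrow> as i = 0"
  and t_dense: "closure (span {t a g |a g. True}) = UNIV"
  and norm_t: "norm (t a g) = norm a * norm g"
  and t_minimal: "cstar_norm_on (span {t a g |a g. True}) \<gamma> \<Longrightarrow> z \<in> span {t a g |a g. True} \<Longrightarrow> norm z \<le> \<gamma> z"
proof -
  note * = min_tensor[unfolded min_tensor_def, folded independent_upto_def]
  show "cbilinear t" using * by (rule conjunct1)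
  note * = conjunct2[OF *]
  show "t a g * t b h = t (a * b) (g * h)" for a g b h using * by simp
  note * = conjunct2[OF *]
  show "star (t a g) = t (star a) (star g)" for a g using * by simp
  note * = conjunct2[OF *]
  show "as i = 0" if "independent_upto n gs" "(\<Sum>i<n. t (as i) (gs i)) = 0" "i < n" for n gs as i
    using conjunct1[OF *] that by simp
  note * = conjunct2[OF *]
  show "closure (span {t a g |a g. True}) = UNIV" using * by (rule conjunct1)
  note * = conjunct2[OF *]
  show "norm (t a g) = norm a * norm g" for a g using * by simp
  note * = conjunct2[OF *]
  show "norm z \<le> \<gamma> z"
    if "cstar_norm_on (span {t a g |a g. True}) \<gamma>" "z \<in> span {t a g |a g. True}" for \<gamma> z
    using * that by blast
qed

sublocale t: complex_bilinear t by unfold_locales (rule cbilinear_t)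

text \<open>Once the functions g' are independent, the independence clause of
  \<open>min_tensor\<close> kills every coefficient a'.\<close>

lemma tensor_graph_zero_left:
  assumes "(0, f) \<in> tensor_graph t"
  shows "f = 0"
proof -
  obtain n :: nat and a g where "0 = (\<Sum>i<n. t (a i) (g i))" "f = (\<Sum>i<n. c0_elem (a i) (g i))"
    using tensor_graph_sum[OF cbilinear_t assms] by blast
  then obtain m a' g' where red: "independent_upto m g'" "0 = (\<Sum>i<m. t (a' i) (g' i))" "f = (\<Sum>i<m. c0_elem (a' i) (g' i))"
    using reduce_to_independent[OF cbilinear_t cbilinear_c0_elem, where n = n and a = a and b = g] by metis
  have "a' i = 0" if "i < m" for i using t_independent[OF red(1) red(2)[symmetric] that] .
  then show ?thesis using red(3) by simp
qed

text \<open>Now the algebra elements are made independent, whence the flipped bilinear maps;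
  evaluation at each point then kills the functions g'.\<close>

lemma tensor_graph_zero_right:
  assumes "(z, 0) \<in> tensor_graph t"
  shows "z = 0"
proof -
  have swap: "cbilinear (\<lambda>g a. t a g)" "cbilinear (\<lambda>g a. c0_elem a g :: ('g, 'a) c0)"
    by (simp_all add: cbilinear_def t.add_left t.add_right t.scaleC_left t.scaleC_right
        elem.add_left elem.add_right elem.scaleC_left elem.scaleC_right)
  obtain n :: nat and a g where "z = (\<Sum>i<n. t (a i) (g i))" "0 = (\<Sum>i<n. c0_elem (a i) (g i))"
    using tensor_graph_sum[OF cbilinear_t assms] by blast
  then obtain m g' a' where red: "independent_upto m a'" "z = (\<Sum>i<m. t (a' i) (g' i))" "0 = (\<Sum>i<m. c0_elem (a' i) (g' i))"
    using reduce_to_independent[OF swap, where n = n and a = g and b = a] by metis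
  have "g' i = 0" if "i < m" for i
  proof (rule c0_eqI)
    fix r
    have "(\<Sum>i<m. c0_apply (g' i) r *\<^sub>C a' i) = c0_apply (\<Sum>i<m. c0_elem (a' i) (g' i)) r"
      by (simp add: c0_apply_sum)
    then have "(\<Sum>i<m. c0_apply (g' i) r *\<^sub>C a' i) = 0" by (simp add: red(3)[symmetric] c0_rep_eq)
    from red(1)[unfolded independent_upto_def, rule_format, OF this that]
    show "c0_apply (g' i) r = c0_apply 0 r" by (simp add: c0_rep_eq)
  qed
  then show ?thesis using red(2) by simp
qed

lemma tensor_graph_unique: "(z, f) \<in> tensor_graph t \<Longrightarrow> (z, f') \<in> tensor_graph t \<Longrightarrow> f = f'"
  using tensor_graph_zero_left[of "f - f'"] subspace_diff[OF subspace_tensor_graph, of "(z, f)" t "(z, f')"] by simp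

lemma tensor_graph_mult:
  assumes "(z, f) \<in> tensor_graph t" "(z', f') \<in> tensor_graph t"
  shows "(z * z', f * f') \<in> tensor_graph t"
proof -
  define B where "B p q = (fst p * fst q, snd p * snd q)" for p q :: "'c \<times> ('g, 'a) c0"
  have "B (z, f) (z', f') \<in> tensor_graph t"
  proof (rule bilinear_on_spans[OF _ _ subspace_tensor_graph _ assms[unfolded tensor_graph_def]])
    show "linear (\<lambda>x. B x y)" "linear (B x)" for x y
      by (auto intro!: linearI simp: B_def algebra_simps)
    show "B x y \<in> tensor_graph t" if "x \<in> {(t x g, c0_elem x g) |x g. True}" "y \<in> {(t x g, c0_elem x g) |x g. True}" for x y
      using that by (auto simp: B_def t_mult c0_elem_mult tensor_graph_base)
  qed
  then show ?thesis by (simp add: B_def)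
qed

lemma tensor_graph_star:
  assumes "(z, f) \<in> tensor_graph t"
  shows "(star z, star f) \<in> tensor_graph t"
proof -
  define S where "S p = (star (fst p), star (snd p))" for p :: "'c \<times> ('g, 'a) c0"
  have "linear S" by (auto intro!: linearI simp: S_def)
  then have "subspace {p. S p \<in> tensor_graph t}"
    using linear_subspace_vimage[OF _ subspace_tensor_graph] by (simp add: vimage_def)
  then have "span {(t x g, c0_elem x g) |x g. True} \<subseteq> {p. S p \<in> tensor_graph t}"
    by (intro span_minimal) (auto simp: S_def star_t star_c0_elem tensor_graph_base)
  then have "S (z, f) \<in> tensor_graph t" using assms unfolding tensor_graph_def by blast
  then show ?thesis by (simp add: S_def)
qed

text \<open>This carries the sup norm to the span of the elementary tensors, where f is unique;
  \<open>cstar_norm_on\<close> inspects no other values.\<close>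

definition c0_norm :: "'c \<Rightarrow> real" where
  "c0_norm z = norm (THE f :: ('g, 'a) c0. (z, f) \<in> tensor_graph t)"

lemma c0_norm_eq:
  assumes "(z, f) \<in> tensor_graph t"
  shows "c0_norm z = norm f"
proof -
  have "(THE f. (z, f) \<in> tensor_graph t) = f" using assms tensor_graph_unique by blast
  then show ?thesis by (simp add: c0_norm_def)
qed

text \<open>The sup norm is a C*-norm on the algebraic tensor product, hence dominates the minimal one.\<close>

lemma norm_tensor_le:
  assumes "(z, f) \<in> tensor_graph t"
  shows "norm z \<le> norm f"
proof -
  have "cstar_norm_on (fst ` tensor_graph t) c0_norm"
    unfolding cstar_norm_on_def
  proof (intro conjI ballI allI)
    fix x c assume "x \<in> fst ` tensor_graph t"
    then obtain f where f: "(x, f) \<in> tensor_graph t" by auto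
    show "0 \<le> c0_norm x" by (simp add: c0_norm_def)
    show "c0_norm x = 0 \<longleftrightarrow> x = 0"
      using f tensor_graph_zero_left tensor_graph_zero_right c0_norm_eq[OF f] by auto
    show "c0_norm (c *\<^sub>C x) = cmod c * c0_norm x"
      using c0_norm_eq[OF tensor_graph_scaleC[OF cbilinear_t f]] c0_norm_eq[OF f] by (simp add: norm_scaleC)
    show "c0_norm (star x * x) = (c0_norm x)\<^sup>2"
      using c0_norm_eq[OF tensor_graph_mult[OF tensor_graph_star[OF f] f]] c0_norm_eq[OF f]
      by (simp add: norm_star_mult_self)
    fix y assume "y \<in> fst ` tensor_graph t"
    then obtain h where h: "(y, h) \<in> tensor_graph t" by auto
    have "(x + y, f + h) \<in> tensor_graph t" using subspace_add[OF subspace_tensor_graph f h] by simp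
    then show "c0_norm (x + y) \<le> c0_norm x + c0_norm y"
      using c0_norm_eq[OF f] c0_norm_eq[OF h] by (simp add: c0_norm_eq norm_triangle_ineq)
    show "c0_norm (x * y) \<le> c0_norm x * c0_norm y"
      using c0_norm_eq[OF f] c0_norm_eq[OF h] c0_norm_eq[OF tensor_graph_mult[OF f h]]
      by (simp add: norm_mult_ineq)
  qed
  moreover have "z \<in> fst ` tensor_graph t" using assms by force
  ultimately show ?thesis
    unfolding fst_tensor_graph c0_norm_eq[OF assms, symmetric] by (rule t_minimal)
qed

text \<open>Near \<open>r\<close> the function \<open>f\<close> is almost constant, so that multiplication by a bump at \<open>r\<close> turns
  it almost into an elementary tensor, whose norm is known.\<close>

lemma norm_tensor_ge:
  assumes zf: "(z, f) \<in> tensor_graph t"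
  shows "norm f \<le> norm z"
proof (rule norm_c0_least)
  fix r
  \<comment> \<open>For this b the C*-identity makes the norm of f r * b equal to the square of the
    norm of b.\<close>
  define b where "b = star (c0_apply f r)"
  show "norm (c0_apply f r) \<le> norm z"
  proof (rule field_le_epsilon)
    fix \<epsilon> :: real assume \<epsilon>: "\<epsilon> > 0"
    define U where "U = {s. norm (c0_apply f s - c0_apply f r) < \<epsilon>}"
    have "open U" "r \<in> U"
      unfolding U_def using \<epsilon> by (auto intro!: open_Collect_less continuous_intros continuous_c0_apply)
    then obtain h \<beta> where h: "h r = 1" "\<And>s. 0 \<le> h s" "\<And>s. h s \<le> 1" "\<And>s. s \<notin> U \<Longrightarrow> h s = (0::real)"
      "\<And>s. c0_apply (\<beta> :: ('g, complex) c0) s = complex_of_real (h s)"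
      using ex_bump[OF lc] by metis
    have "norm \<beta> \<le> 1" using h by (intro norm_c0_least) simp
    moreover have "1 \<le> norm \<beta>" using norm_c0_upper[of \<beta> r] h by simp
    ultimately have \<beta>: "norm \<beta> = 1" by simp
    \<comment> \<open>This is the error of replacing z * t b \<beta> by an elementary tensor. It
      belongs to the graph, so the inequality already proved bounds it by a sup norm.\<close>
    define w where "w = z * t b \<beta> - t (c0_apply f r * b) \<beta>"
    have "(w, f * c0_elem b \<beta> - c0_elem (c0_apply f r * b) \<beta>) \<in> tensor_graph t"
      using subspace_diff[OF subspace_tensor_graph tensor_graph_mult[OF zf tensor_graph_base] tensor_graph_base]
      by (simp add: w_def)
    then have "norm w \<le> norm (f * c0_elem b \<beta> - c0_elem (c0_apply f r * b) \<beta>)" by (rule norm_tensor_le)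
    also have "\<dots> \<le> \<epsilon> * norm b"
    proof (rule norm_c0_least)
      fix s
      have "c0_apply (f * c0_elem b \<beta> - c0_elem (c0_apply f r * b) \<beta>) s = h s *\<^sub>R ((c0_apply f s - c0_apply f r) * b)"
        by (simp add: c0_rep_eq h(5) scaleC_of_real algebra_simps)
      also have "norm \<dots> = h s * norm ((c0_apply f s - c0_apply f r) * b)" using h(2) by simp
      also have "\<dots> \<le> \<epsilon> * norm b"
      proof (cases "s \<in> U")
        case True
        have "h s * norm ((c0_apply f s - c0_apply f r) * b) \<le> 1 * (\<epsilon> * norm b)"
          using True h \<epsilon> by (intro mult_mono order_trans[OF norm_mult_ineq] mult_right_mono) (auto simp: U_def)
        then show ?thesis by simp
      qed (use h(4) \<epsilon> in simp)
      finally show "norm (c0_apply (f * c0_elem b \<beta> - c0_elem (c0_apply f r * b) \<beta>) s) \<le> \<epsilon> * norm b" .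
    qed
    finally have w: "norm w \<le> \<epsilon> * norm b" .
    have "(norm b)\<^sup>2 = norm (c0_apply f r * b)"
      by (simp add: b_def norm_mult_star_self)
    also have "\<dots> = norm (z * t b \<beta> - w)" by (simp add: w_def norm_t \<beta>)
    also have "\<dots> \<le> norm z * norm (t b \<beta>) + norm w"
      by (rule order_trans[OF norm_triangle_ineq4]) (simp add: norm_mult_ineq)
    also have "\<dots> \<le> (norm z + \<epsilon>) * norm b" using w by (simp add: norm_t \<beta> algebra_simps)
    finally have "norm b * norm b \<le> (norm z + \<epsilon>) * norm b" by (simp add: power2_eq_square)
    then have "norm b \<le> norm z + \<epsilon>" using \<epsilon> by (cases "b = 0") (simp_all add: mult_le_cancel_right)
    then show "norm (c0_apply f r) \<le> norm z + \<epsilon>" by (simp add: b_def)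
  qed
qed

lemma c0_tensor_t: "isometric_iso (c0_tensor t)" "(z, f) \<in> tensor_graph t \<Longrightarrow> c0_tensor t f = z"
proof -
  have eq: "norm z = norm f" if "(z, f) \<in> tensor_graph t" for z f
    using norm_tensor_le[OF that] norm_tensor_ge[OF that] by simp
  show "isometric_iso (c0_tensor t)" "(z, f) \<in> tensor_graph t \<Longrightarrow> c0_tensor t f = z"
    using c0_tensor_isometric_iso[OF lc t_dense eq] by auto
qed

text \<open>It makes A an instance of X with u = t, so results on exterior tensor products also
  cover the coefficient algebras.\<close>

lemma exterior_tensor_self: "exterior_tensor self_corr self_corr self_corr t t"
  unfolding exterior_tensor_def
  using t_dense by (simp add: correspondence_self_corr cbilinear_t t_mult star_t)

end

section \<open>Exterior tensor products with C_0(G)\<close>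

lemma bounded_bilinear_eq_on_dense:
  assumes f: "bounded_bilinear f" and g: "bounded_bilinear g"
    and eq: "\<And>s s'. s \<in> S \<Longrightarrow> s' \<in> S' \<Longrightarrow> f s s' = g s s'"
    and S: "closure (span S) = UNIV" and S': "closure (span S') = UNIV"
  shows "f x y = g x y"
proof -
  have "f s y = g s y" if "s \<in> S" for s
    by (rule bounded_linear_eq_on_dense[OF bounded_bilinear.bounded_linear_right[OF f]
          bounded_bilinear.bounded_linear_right[OF g] eq[OF that] S'])
  then show ?thesis
    by (rule bounded_linear_eq_on_dense[OF bounded_bilinear.bounded_linear_left[OF f]
          bounded_bilinear.bounded_linear_left[OF g] _ S])
qed

lemma bounded_linear_compose_bilinear:
  assumes L: "bounded_linear L" and B: "bounded_bilinear B"
  shows "bounded_bilinear (\<lambda>x y. L (B x y))"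
proof -
  interpret L: bounded_linear L by (rule L)
  interpret B: bounded_bilinear B by (rule B)
  obtain K where K: "K > 0" "\<And>x. norm (L x) \<le> norm x * K" using L.pos_bounded by blast
  obtain M where M: "\<And>x y. norm (B x y) \<le> norm x * norm y * M" using B.bounded by blast
  have "norm (L (B x y)) \<le> norm x * norm y * (M * K)" for x y
  proof -
    have "norm (L (B x y)) \<le> norm (B x y) * K" by (rule K)
    also have "\<dots> \<le> (norm x * norm y * M) * K" using K(1) by (intro mult_right_mono M) simp
    finally show ?thesis by (simp add: mult.assoc)
  qed
  then show ?thesis
    by (intro bounded_bilinear.intro)
      (auto simp: B.add_left B.add_right B.scaleR_left B.scaleR_right L.add L.scaleR)
qed

lemma (in corresp) bounded_bilinear_phi: "bounded_bilinear (\<lambda>a. blinfun_apply (phi X a))"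
  using bounded_bilinear.comp[OF bounded_bilinear_blinfun_apply bounded_linear_phi bounded_linear_ident] .

lemma (in hilbert_mod) norm_c0_ip_self:
  "norm (c0_map2 (ip X) f f :: ('g::topological_space, 'a) c0) = (norm f)\<^sup>2"
proof (rule order_antisym)
  have app: "norm (c0_apply (c0_map2 (ip X) f f) r) = (norm (c0_apply f r))\<^sup>2" for r
    by (simp add: c0_map2_apply[OF bounded_bilinear_ip] norm_ip_self)
  show "norm (c0_map2 (ip X) f f) \<le> (norm f)\<^sup>2"
    by (rule norm_c0_least) (simp add: app power_mono norm_c0_upper)
  have "norm f \<le> sqrt (norm (c0_map2 (ip X) f f))"
  proof (rule norm_c0_least)
    fix r
    show "norm (c0_apply f r) \<le> sqrt (norm (c0_map2 (ip X) f f))"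
      using norm_c0_upper[of "c0_map2 (ip X) f f" r] by (intro real_le_rsqrt) (simp add: app)
  qed
  then show "(norm f)\<^sup>2 \<le> norm (c0_map2 (ip X) f f)"
    by (metis norm_ge_zero power_mono real_sqrt_pow2)
qed

locale c0_exterior = nondegenerate_corresp X + c0_min_tensor t
  for X :: "('x::cbanach, 'a::cstar_algebra) corr"
    and t :: "'a \<Rightarrow> ('g::t2_space, complex) c0 \<Rightarrow> 'c::cstar_algebra" +
  fixes XG :: "('z::cbanach, 'c) corr" and u :: "'x \<Rightarrow> ('g, complex) c0 \<Rightarrow> 'z"
  assumes exterior: "exterior_tensor X self_corr XG t u"
begin

lemma correspondence_XG: "correspondence XG"
  and cbilinear_u: "cbilinear u"
  and ip_u: "ip XG (u x g) (u x' g') = t (ip X x x') (star g * g')"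
  and phi_u: "blinfun_apply (phi XG (t a h)) (u x g) = u (blinfun_apply (phi X a) x) (h * g)"
  and u_dense: "closure (span {u x g |x g. True}) = UNIV"
proof -
  note * = exterior[unfolded exterior_tensor_def]
  show "correspondence XG" using * by (rule conjunct1)
  note * = conjunct2[OF *]
  show "cbilinear u" using * by (rule conjunct1)
  note * = conjunct2[OF *]
  show "ip XG (u x g) (u x' g') = t (ip X x x') (star g * g')" for x g x' g' using * by simp
  note * = conjunct2[OF conjunct2[OF *]]
  show "blinfun_apply (phi XG (t a h)) (u x g) = u (blinfun_apply (phi X a) x) (h * g)" for x g a h using * by simp
  show "closure (span {u x g |x g. True}) = UNIV" using conjunct2[OF *] .
qed

sublocale u: complex_bilinear u by unfold_locales (rule cbilinear_u)

sublocale Z: corresp XG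
  by unfold_locales (use correspondence_XG in \<open>simp_all add: correspondence_def\<close>)

lemma norm_u: "norm (u x g) = norm x * norm g"
proof -
  have "(norm (u x g))\<^sup>2 = (norm x * norm g)\<^sup>2"
    using Z.norm_ip_self[of "u x g"]
    by (simp add: ip_u norm_t norm_ip_self norm_star_mult_self power_mult_distrib)
  then show ?thesis by (simp add: power2_eq_iff_nonneg)
qed

lemma bounded_bilinear_u: "bounded_bilinear u"
  by (rule u.bounded_bilinearI[where K = 1]) (simp add: norm_u)

abbreviation "Jt \<equiv> c0_tensor t"
abbreviation "Ju \<equiv> c0_tensor u"

lemma Jt_elem: "Jt (c0_elem a g) = t a g"
  by (rule c0_tensor_t(2)[OF tensor_graph_base])

lemma bounded_linear_Jt: "bounded_linear Jt" and norm_Jt: "norm (Jt f) = norm f" and surj_Jt: "surj Jt"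
  using c0_tensor_t(1) by (simp_all add: isometric_iso_def)

lemma c0_ip_elem: "c0_map2 (ip X) (c0_elem x g) (c0_elem x' g') = c0_elem (ip X x x') (star g * g')"
  by (rule c0_eqI)
    (simp add: c0_map2_apply[OF bounded_bilinear_ip] ip_scaleC_left ip_scaleC_right c0_rep_eq
      star_complex_def scaleC_scaleC mult.commute)

text \<open>The map B measures the discrepancy of the two inner products. It vanishes on generators,
  hence on the whole graph, and on the diagonal this is the equality of norms.\<close>

lemma tensor_graph_norm:
  assumes "(z, f) \<in> tensor_graph u"
  shows "norm z = norm f"
proof -
  define B where "B p q = ip XG (fst p) (fst q) - Jt (c0_map2 (ip X) (snd p) (snd q))" for p q :: "'z \<times> ('g, 'x) c0"
  interpret m: bounded_bilinear "c0_map2 (ip X) :: ('g, 'x) c0 \<Rightarrow> _"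
    by (rule bounded_bilinear_c0_map2[OF bounded_bilinear_ip])
  interpret Jt: bounded_linear Jt by (rule bounded_linear_Jt)
  have "B (z, f) (z, f) \<in> {0}"
  proof (rule bilinear_on_spans[where B = B, OF _ _ _ _ assms[unfolded tensor_graph_def] assms[unfolded tensor_graph_def]])
    show "linear (\<lambda>x. B x y)" "linear (B x)" for x y
      by (auto intro!: linearI simp: B_def Z.ip_add_left Z.ip_add_right Z.ip_scaleR_left Z.ip_scaleR_right
          m.add_left m.add_right m.scaleR_left m.scaleR_right Jt.add Jt.scaleR scaleR_diff_right)
    show "B x y \<in> {0}" if "x \<in> {(u x g, c0_elem x g) |x g. True}" "y \<in> {(u x g, c0_elem x g) |x g. True}" for x y
      using that by (auto simp: B_def ip_u c0_ip_elem Jt_elem)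
  qed simp
  then have "(norm z)\<^sup>2 = (norm f)\<^sup>2"
    by (simp add: B_def norm_Jt norm_c0_ip_self flip: Z.norm_ip_self)
  then show ?thesis by simp
qed

lemma c0_tensor_u: "isometric_iso Ju"
  by (rule c0_tensor_isometric_iso(1)[OF lc u_dense tensor_graph_norm])

lemma Ju_elem: "Ju (c0_elem x g) = u x g"
  by (rule c0_tensor_isometric_iso(2)[OF lc u_dense tensor_graph_norm tensor_graph_base])

lemma bounded_linear_Ju: "bounded_linear Ju" and norm_Ju: "norm (Ju f) = norm f" and surj_Ju: "surj Ju"
  using c0_tensor_u by (simp_all add: isometric_iso_def)

lemma inj_Jt: "inj Jt" and inj_Ju: "inj Ju"
proof -
  have "inj J" if "bounded_linear J" "\<And>f. norm (J f) = norm f" for J :: "('g, 'e::real_normed_vector) c0 \<Rightarrow> 'f::real_normed_vector"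
  proof (rule injI)
    fix x y assume "J x = J y"
    then have "norm (x - y) = 0"
      using linear_diff[OF bounded_linear.linear[OF that(1)], of x y] that(2)[of "x - y"] by simp
    then show "x = y" by simp
  qed
  then show "inj Jt" "inj Ju" using bounded_linear_Jt norm_Jt bounded_linear_Ju norm_Ju by blast+
qed

lemma Ju_scaleC: "Ju (c *\<^sub>C f) = c *\<^sub>C Ju f"
  by (rule bounded_linear_eq_on_dense[OF _ _ _ c0_elem_dense[OF lc], of "\<lambda>f. Ju (c *\<^sub>C f)" "\<lambda>f. c *\<^sub>C Ju f"])
    (auto simp: Ju_elem u.scaleC_left simp flip: elem.scaleC_left
      intro: bounded_linear_compose[OF bounded_linear_Ju bounded_linear_scaleC]
        bounded_linear_compose[OF bounded_linear_scaleC bounded_linear_Ju])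

lemma ip_Ju: "ip XG (Ju f) (Ju g) = Jt (c0_map2 (ip X) f g)"
proof (rule bounded_bilinear_eq_on_dense[OF _ _ _ c0_elem_dense[OF lc] c0_elem_dense[OF lc],
      of "\<lambda>f g. ip XG (Ju f) (Ju g)" "\<lambda>f g. Jt (c0_map2 (ip X) f g)"])
  show "bounded_bilinear (\<lambda>f g. ip XG (Ju f) (Ju g))"
    by (rule bounded_bilinear.comp[OF Z.bounded_bilinear_ip bounded_linear_Ju bounded_linear_Ju])
  show "bounded_bilinear (\<lambda>f g. Jt (c0_map2 (ip X) f g))"
    by (rule bounded_linear_compose_bilinear[OF bounded_linear_Jt bounded_bilinear_c0_map2[OF bounded_bilinear_ip]])
qed (auto simp: Ju_elem Jt_elem ip_u c0_ip_elem)

lemma phi_Ju: "blinfun_apply (phi XG (Jt a)) (Ju f) = Ju (c0_map2 (\<lambda>a. blinfun_apply (phi X a)) a f)"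
proof (rule bounded_bilinear_eq_on_dense[OF _ _ _ c0_elem_dense[OF lc] c0_elem_dense[OF lc],
      of "\<lambda>a f. blinfun_apply (phi XG (Jt a)) (Ju f)" "\<lambda>a f. Ju (c0_map2 (\<lambda>a. blinfun_apply (phi X a)) a f)"])
  show "bounded_bilinear (\<lambda>a f. blinfun_apply (phi XG (Jt a)) (Ju f))"
    by (rule bounded_bilinear.comp[OF Z.bounded_bilinear_phi bounded_linear_Jt bounded_linear_Ju])
  show "bounded_bilinear (\<lambda>a f. Ju (c0_map2 (\<lambda>a. blinfun_apply (phi X a)) a f))"
    by (rule bounded_linear_compose_bilinear[OF bounded_linear_Ju bounded_bilinear_c0_map2[OF bounded_bilinear_phi]])
  fix s :: "('g, 'a) c0" and s' :: "('g, 'x) c0"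
  assume "s \<in> {c0_elem x g |x g. True}" "s' \<in> {c0_elem x g |x g. True}"
  then obtain a h x g where s: "s = c0_elem a h" "s' = c0_elem x g" by blast
  have "c0_map2 (\<lambda>a. blinfun_apply (phi X a)) s s' = c0_elem (blinfun_apply (phi X a) x) (h * g)"
    by (rule c0_eqI)
      (simp add: s c0_map2_apply[OF bounded_bilinear_phi] phi_scaleC scaleC_blinfun.rep_eq
        op.adjointable_scaleC[OF phi_adjointable] c0_rep_eq scaleC_scaleC)
  then show "blinfun_apply (phi XG (Jt s)) (Ju s') = Ju (c0_map2 (\<lambda>a. blinfun_apply (phi X a)) s s')"
    by (simp add: s Ju_elem Jt_elem phi_u)
qed

text \<open>The tensor u x g is approached through u (phi a x) (h * g), with one approximate unit in
  C_0(G) and another in A.\<close>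

lemma nondegenerate_XG: "nondegenerate XG"
proof -
  define D where "D = closure (span {blinfun_apply (phi XG c) z |c z. True})"
  have D: "closed D" "subspace D" unfolding D_def by (auto intro: subspace_closure subspace_span)
  interpret u: bounded_bilinear u by (rule bounded_bilinear_u)
  have 1: "u (blinfun_apply (phi X a) x) (h * g) \<in> D" for a x h g
    unfolding D_def phi_u[symmetric] by (rule subsetD[OF closure_subset], rule span_base) blast
  have 2: "u (blinfun_apply (phi X a) x) g \<in> D" for a x g
    by (rule Lim_in_closed_set[OF D(1) _ approx_unit_not_bot, of "\<lambda>e. u (blinfun_apply (phi X a) x) (e * g)"])
      (auto intro!: 1 always_eventually u.tendsto tendsto_const approx_unit_left)
  have 3: "u x g \<in> D" for x g
    by (rule Lim_in_closed_set[OF D(1) _ approx_unit_not_bot, of "\<lambda>e. u (blinfun_apply (phi X e) x) g"])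
      (auto intro!: 2 always_eventually u.tendsto tendsto_const tendsto_phi_approx_unit)
  have "closure (span {u x g |x g. True}) \<subseteq> D"
    by (intro closure_minimal span_minimal D) (auto intro: 3)
  then show ?thesis unfolding nondegenerate_def u_dense D_def by blast
qed

end

sublocale c0_exterior \<subseteq> Z: nondegenerate_corresp XG
  by unfold_locales (rule nondegenerate_XG)

section \<open>Pointwise operators\<close>

definition strongly_bounded :: "('g::topological_space \<Rightarrow> 'v::real_normed_vector \<Rightarrow>\<^sub>L 'w::real_normed_vector) \<Rightarrow> bool" where
  "strongly_bounded m \<longleftrightarrow> bounded (range m) \<and> (\<forall>v. continuous_on UNIV (\<lambda>r. blinfun_apply (m r) v))"

lemma strongly_boundedE:
  assumes "strongly_bounded m"
  obtains B where "B > 0" "\<And>r. norm (m r) \<le> B"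
proof -
  obtain B where "B > 0" "\<forall>x\<in>range m. norm x \<le> B"
    using assms unfolding strongly_bounded_def bounded_pos by blast
  then show thesis using that by blast
qed

lemma strongly_boundedI:
  assumes "\<And>r. norm (m r) \<le> B" "\<And>v r. ((\<lambda>s. blinfun_apply (m s) v) \<longlongrightarrow> blinfun_apply (m r) v) (at r)"
  shows "strongly_bounded m"
  unfolding strongly_bounded_def continuous_on_def using assms by (auto intro!: boundedI)

lemma strongly_bounded_continuous:
  fixes m :: "'g::topological_space \<Rightarrow> 'v::real_normed_vector \<Rightarrow>\<^sub>L 'w::real_normed_vector"
  assumes m: "strongly_bounded m" and f: "continuous_on UNIV f"
  shows "continuous_on UNIV (\<lambda>r. blinfun_apply (m r) (f r))"
  unfolding continuous_on_def
proof
  fix r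
  obtain B where B: "B > 0" "\<And>r. norm (m r) \<le> B" using strongly_boundedE[OF m] by metis
  have "((\<lambda>s. f s - f r) \<longlongrightarrow> 0) (at r)"
    by (rule LIM_zero) (use f in \<open>simp add: continuous_on_def\<close>)
  then have "((\<lambda>s. blinfun_apply (m s) (f s - f r)) \<longlongrightarrow> 0) (at r)"
  proof (rule tendsto_0_le)
    show "\<forall>\<^sub>F s in at r. norm (blinfun_apply (m s) (f s - f r)) \<le> norm (f s - f r) * B"
      using order_trans[OF norm_blinfun mult_right_mono[OF B(2)]]
      by (intro always_eventually allI) (metis mult.commute norm_ge_zero)
  qed
  moreover have "((\<lambda>s. blinfun_apply (m s) (f r)) \<longlongrightarrow> blinfun_apply (m r) (f r)) (at r)"
    using m by (auto simp: strongly_bounded_def continuous_on_def)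
  ultimately have "((\<lambda>s. blinfun_apply (m s) (f s - f r) + blinfun_apply (m s) (f r)) \<longlongrightarrow> 0 + blinfun_apply (m r) (f r)) (at r)"
    by (rule tendsto_add)
  then show "((\<lambda>r. blinfun_apply (m r) (f r)) \<longlongrightarrow> blinfun_apply (m r) (f r)) (at r)"
    by (simp add: blinfun.diff_right)
qed

lemma strongly_bounded_compose:
  assumes m: "strongly_bounded m" and n: "strongly_bounded n"
  shows "strongly_bounded (\<lambda>r. m r o\<^sub>L n r)"
proof -
  obtain B C where BC: "\<And>r. norm (m r) \<le> B" "\<And>r. norm (n r) \<le> C" "B > 0"
    using strongly_boundedE[OF m] strongly_boundedE[OF n] by metis
  have "norm (m r o\<^sub>L n r) \<le> B * C" for r
    using BC by (intro order_trans[OF norm_blinfun_compose] mult_mono) (auto intro: less_imp_le)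
  moreover have "continuous_on UNIV (\<lambda>r. blinfun_apply (m r o\<^sub>L n r) v)" for v
    using strongly_bounded_continuous[OF m] n by (simp add: strongly_bounded_def)
  ultimately show ?thesis unfolding strongly_bounded_def by (auto intro!: boundedI)
qed

lemma pw_apply:
  fixes m :: "'g::topological_space \<Rightarrow> 'v::cbanach \<Rightarrow>\<^sub>L 'w::cbanach"
  assumes m: "strongly_bounded m"
  shows "c0_apply (pw m f) r = blinfun_apply (m r) (c0_apply f r)"
proof -
  obtain B where B: "\<And>r. norm (m r) \<le> B" using strongly_boundedE[OF m] by metis
  have "(\<lambda>r. blinfun_apply (m r) (c0_apply f r)) \<in> c0_set"
  proof (rule c0_dominated[OF c0_apply])
    show "continuous_on UNIV (\<lambda>r. blinfun_apply (m r) (c0_apply f r))"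
      by (rule strongly_bounded_continuous[OF m continuous_c0_apply])
    show "norm (blinfun_apply (m r) (c0_apply f r)) \<le> B * norm (c0_apply f r)" for r
      by (rule order_trans[OF norm_blinfun mult_right_mono[OF B]]) simp
  qed
  then show ?thesis by (simp add: pw_def Abs_c0_inverse)
qed

lemma bounded_linear_pw:
  fixes m :: "'g::topological_space \<Rightarrow> 'v::cbanach \<Rightarrow>\<^sub>L 'w::cbanach"
  assumes m: "strongly_bounded m"
  shows "bounded_linear (pw m)"
proof -
  obtain B where B: "B > 0" "\<And>r. norm (m r) \<le> B" using strongly_boundedE[OF m] by metis
  have "norm (pw m f) \<le> norm f * B" for f
  proof (rule norm_c0_least)
    fix r
    have "norm (blinfun_apply (m r) (c0_apply f r)) \<le> B * norm f"
      using B by (intro order_trans[OF norm_blinfun] mult_mono norm_c0_upper) auto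
    then show "norm (c0_apply (pw m f) r) \<le> norm f * B" by (simp add: pw_apply[OF m] mult.commute)
  qed
  then show ?thesis
    by (intro bounded_linear_intro[where K = B])
      (auto intro!: c0_eqI simp: pw_apply[OF m] c0_rep_eq blinfun.add_right blinfun.scaleR_right)
qed

lemma bounded_linear_inv:
  assumes "isometric_iso J"
  shows "bounded_linear (inv J)"
proof -
  interpret J: bounded_linear J using assms by (simp add: isometric_iso_def)
  have inv: "J (inv J y) = y" for y using assms by (simp add: isometric_iso_def surj_f_inv_f)
  have inj: "x = y" if "J x = J y" for x y
  proof -
    have "norm (x - y) = norm (J (x - y))" using assms by (simp add: isometric_iso_def)
    then show ?thesis using that by (simp add: J.diff)
  qed
  have "norm (inv J y) = norm y" for y
    using assms inv[of y] unfolding isometric_iso_def by metis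
  then show ?thesis
    by (intro bounded_linear_intro[where K = 1]) (auto intro!: inj simp: inv J.add J.scaleR)
qed

text \<open>One notion serves three kinds of operators: \<open>psi\<close>, with identifications Jt
  and Ju, its adjoint, with Ju and Jt, and the left action, with Ju on both sides.\<close>

definition pw_op :: "(('g::topological_space, 'v::cbanach) c0 \<Rightarrow> 'c::real_normed_vector) \<Rightarrow>
    (('g, 'w::cbanach) c0 \<Rightarrow> 'd::real_normed_vector) \<Rightarrow> ('g \<Rightarrow> 'v \<Rightarrow>\<^sub>L 'w) \<Rightarrow> 'c \<Rightarrow>\<^sub>L 'd" where
  "pw_op J J' m = Blinfun (\<lambda>c. J' (pw m (inv J c)))"

lemma psi_eq: "psi t u m = pw_op (c0_tensor t) (c0_tensor u) m"
  by (simp add: psi_def pw_op_def)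

lemma pw_op_apply:
  assumes J: "isometric_iso J" and J': "isometric_iso J'" and m: "strongly_bounded m"
  shows "blinfun_apply (pw_op J J' m) (J f) = J' (pw m f)"
proof -
  have "bounded_linear J'" using J' by (simp add: isometric_iso_def)
  then have "bounded_linear (\<lambda>c. J' (pw m (inv J c)))"
    by (rule bounded_linear_compose[OF _ bounded_linear_compose[OF bounded_linear_pw[OF m] bounded_linear_inv[OF J]]])
  moreover have "J (inv J (J f)) = J f" using J by (simp add: isometric_iso_def surj_f_inv_f)
  then have "inv J (J f) = f"
  proof -
    interpret J: bounded_linear J using J by (simp add: isometric_iso_def)
    have "norm (inv J (J f) - f) = norm (J (inv J (J f) - f))" using J by (simp add: isometric_iso_def)
    then show ?thesis using \<open>J (inv J (J f)) = J f\<close> by (simp add: J.diff)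
  qed
  ultimately show ?thesis by (simp add: pw_op_def bounded_linear_Blinfun_apply)
qed

lemma Cb_strict_iff:
  "m \<in> Cb_strict X \<longleftrightarrow> (\<forall>r. m r \<in> multipliers X) \<and>
     (\<forall>T\<in>compacts X. continuous_on UNIV (\<lambda>r. T o\<^sub>L m r)) \<and> strongly_bounded m"
  unfolding Cb_strict_def strongly_bounded_def by (auto simp: continuous_map_strict_iff)

lemma strongly_bounded_add:
  assumes m: "strongly_bounded m" and n: "strongly_bounded n"
  shows "strongly_bounded (\<lambda>r. m r + n r)"
proof -
  obtain B C where "\<And>r. norm (m r) \<le> B" "\<And>r. norm (n r) \<le> C"
    using strongly_boundedE[OF m] strongly_boundedE[OF n] by metis
  then have "norm (m r + n r) \<le> B + C" for r by (rule norm_triangle_mono)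
  then show ?thesis
    using m n unfolding strongly_bounded_def
    by (auto intro!: boundedI continuous_on_add simp: blinfun.add_left)
qed

lemma strongly_bounded_scaleC:
  fixes m :: "'g::topological_space \<Rightarrow> 'v::real_normed_vector \<Rightarrow>\<^sub>L 'w::complex_normed_vector"
  assumes m: "strongly_bounded m"
  shows "strongly_bounded (\<lambda>r. c *\<^sub>C m r)"
proof -
  obtain B where "\<And>r. norm (m r) \<le> B" using strongly_boundedE[OF m] by metis
  then have "norm (c *\<^sub>C m r) \<le> cmod c * B" for r by (simp add: norm_scaleC mult_left_mono)
  then show ?thesis
    using m unfolding strongly_bounded_def
    by (auto intro!: boundedI bounded_linear.continuous_on[OF bounded_linear_scaleC] simp: scaleC_blinfun.rep_eq)
qed

lemma bounded_bilinear_scaleC: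
  "bounded_bilinear (scaleC :: complex \<Rightarrow> 'v::complex_normed_vector \<Rightarrow> 'v)"
proof -
  have "cbilinear (scaleC :: complex \<Rightarrow> 'v \<Rightarrow> 'v)"
    by (simp add: cbilinear_def scaleC_add_left scaleC_add_right scaleC_scaleC scaleC_complex_def mult.commute)
  then interpret complex_bilinear "scaleC :: complex \<Rightarrow> 'v \<Rightarrow> 'v" by unfold_locales
  show ?thesis by (rule bounded_bilinearI[where K = 1]) (simp add: norm_scaleC)
qed

lemma norm_c0_elem_le: "norm (c0_elem x g) \<le> norm x * norm g"
proof (rule norm_c0_least)
  fix r
  show "norm (c0_apply (c0_elem x g) r) \<le> norm x * norm g"
    using mult_left_mono[OF norm_c0_upper[of g r] norm_ge_zero[of x]] by (simp add: norm_scaleC mult.commute)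
qed

lemma bounded_linear_c0_elem: "bounded_linear (\<lambda>x. c0_elem x g)"
  by (rule bounded_linear_intro[where K = "norm g"])
    (simp_all add: elem.add_left elem.scaleR_left norm_c0_elem_le)

lemma ex_unit_bump:
  assumes lc: "locally_compact_space (euclidean :: 'g::t2_space topology)"
  shows "\<exists>\<beta> :: ('g, complex) c0. c0_apply \<beta> r = 1 \<and> norm \<beta> \<le> 1"
proof -
  obtain h :: "'g \<Rightarrow> real" and \<beta> :: "('g, complex) c0" where h: "h r = 1" "\<And>s. 0 \<le> h s" "\<And>s. h s \<le> 1"
    "\<And>s. c0_apply \<beta> s = complex_of_real (h s)"
    using ex_bump[OF lc open_UNIV UNIV_I] by metis
  then have "norm \<beta> \<le> 1" by (intro norm_c0_least) simp
  then show ?thesis using h(1) h(4)[of r] by (intro exI[of _ \<beta>]) simp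
qed

text \<open>By locality m r v may be computed from any function with value v at r; a bump of norm at
  most 1 times v gives the bound K.\<close>

lemma fibrewise_operator:
  fixes M :: "('g::t2_space, 'v::cbanach) c0 \<Rightarrow> ('g, 'w::cbanach) c0"
  assumes lc: "locally_compact_space (euclidean :: 'g topology)" and M: "bounded_linear M"
    and M_scaleC: "\<And>c f. M (c *\<^sub>C f) = c *\<^sub>C M f"
    and local: "\<And>f f' r. c0_apply f r = c0_apply f' r \<Longrightarrow> c0_apply (M f) r = c0_apply (M f') r"
  obtains m where "strongly_bounded m" "\<And>f r. c0_apply (M f) r = blinfun_apply (m r) (c0_apply f r)"
proof -
  obtain \<beta> :: "'g \<Rightarrow> ('g, complex) c0" where \<beta>: "\<And>r. c0_apply (\<beta> r) r = 1" "\<And>r. norm (\<beta> r) \<le> 1"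
    using ex_unit_bump[OF lc] by metis
  obtain K where K: "K > 0" "\<And>f. norm (M f) \<le> norm f * K" using bounded_linear.pos_bounded[OF M] by blast
  define m where "m r = Blinfun (\<lambda>v. c0_apply (M (c0_elem v (\<beta> r))) r)" for r
  have bl: "bounded_linear (\<lambda>v. c0_apply (M (c0_elem v (\<beta> r))) r)" for r
    by (rule bounded_linear_compose[OF bounded_linear_c0_apply bounded_linear_compose[OF M bounded_linear_c0_elem]])
  have m: "blinfun_apply (m r) v = c0_apply (M (c0_elem v (\<beta> r))) r" for r v
    by (simp add: m_def bounded_linear_Blinfun_apply[OF bl])
  have app: "c0_apply (M f) r = blinfun_apply (m r) (c0_apply f r)" for f r
    unfolding m by (rule local) (simp add: \<beta>)
  have m_scaleC: "blinfun_apply (m r) (c *\<^sub>C v) = c *\<^sub>C blinfun_apply (m r) v" for r c v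
    by (simp add: m elem.scaleC_left M_scaleC c0_rep_eq)
  have "norm (m r) \<le> K" for r
  proof (rule norm_blinfun_bound)
    fix v
    have "norm (blinfun_apply (m r) v) \<le> norm (M (c0_elem v (\<beta> r)))" unfolding m by (rule norm_c0_upper)
    also have "\<dots> \<le> norm (c0_elem v (\<beta> r)) * K" by (rule K)
    also have "\<dots> \<le> (norm v * norm (\<beta> r)) * K" using K(1) by (intro mult_right_mono norm_c0_elem_le) simp
    also have "\<dots> \<le> (norm v * 1) * K" using K(1) \<beta>(2) by (intro mult_right_mono mult_left_mono) auto
    finally show "norm (blinfun_apply (m r) v) \<le> K * norm v" by (simp add: mult.commute)
  qed (use K(1) in simp)
  moreover have "((\<lambda>s. blinfun_apply (m s) v) \<longlongrightarrow> blinfun_apply (m r) v) (at r)" for v r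
  proof -
    \<comment> \<open>The bump at r is kept fixed while the point s moves: near r it is nonzero, and
      m s v is F s divided by the value of the bump at s. Thus continuity of F gives continuity of
      m.\<close>
    define F where "F = M (c0_elem v (\<beta> r))"
    have F: "c0_apply F s = c0_apply (\<beta> r) s *\<^sub>C blinfun_apply (m s) v" for s
      by (simp add: F_def app m_scaleC)
    have lim_F: "((\<lambda>s. c0_apply F s) \<longlongrightarrow> c0_apply F r) (at r)"
      and lim_b: "((\<lambda>s. c0_apply (\<beta> r) s) \<longlongrightarrow> 1) (at r)"
      using continuous_c0_apply[of UNIV F] continuous_c0_apply[of UNIV "\<beta> r"] \<beta>(1)[of r]
      unfolding continuous_on_def by (simp_all, metis)
    have "((\<lambda>s. inverse (c0_apply (\<beta> r) s) *\<^sub>C c0_apply F s) \<longlongrightarrow> inverse 1 *\<^sub>C c0_apply F r) (at r)"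
      by (intro bounded_bilinear.tendsto[OF bounded_bilinear_scaleC] tendsto_inverse lim_F lim_b) simp
    moreover have "\<forall>\<^sub>F s in at r. inverse (c0_apply (\<beta> r) s) *\<^sub>C c0_apply F s = blinfun_apply (m s) v"
      by (rule eventually_mono[OF tendsto_imp_eventually_ne[OF lim_b one_neq_zero]])
        (simp add: F scaleC_scaleC)
    ultimately have "((\<lambda>s. blinfun_apply (m s) v) \<longlongrightarrow> inverse 1 *\<^sub>C c0_apply F r) (at r)"
      by (rule Lim_transform_eventually)
    then show ?thesis by (simp add: F \<beta>(1))
  qed
  ultimately have "strongly_bounded m" by (rule strongly_boundedI)
  then show thesis using that app by blast
qed

lemma pw_op_compose:
  assumes J: "isometric_iso J" and J': "isometric_iso J'" and J'': "isometric_iso J''"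
    and m: "strongly_bounded m" and n: "strongly_bounded n"
  shows "pw_op J J'' (\<lambda>r. m r o\<^sub>L n r) = pw_op J' J'' m o\<^sub>L pw_op J J' n"
proof (rule blinfun_eqI)
  fix c
  obtain f where c: "c = J f" using J unfolding isometric_iso_def by (metis surj_def)
  have mn: "strongly_bounded (\<lambda>r. m r o\<^sub>L n r)" by (rule strongly_bounded_compose[OF m n])
  have "pw (\<lambda>r. m r o\<^sub>L n r) f = pw m (pw n f)"
    by (rule c0_eqI) (simp add: pw_apply[OF m] pw_apply[OF n] pw_apply[OF mn])
  then show "blinfun_apply (pw_op J J'' (\<lambda>r. m r o\<^sub>L n r)) c = blinfun_apply (pw_op J' J'' m o\<^sub>L pw_op J J' n) c"
    by (simp add: c pw_op_apply[OF J J'' mn] pw_op_apply[OF J J' n] pw_op_apply[OF J' J'' m])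
qed

section \<open>Strictly continuous functions\<close>

context hilbert_mod
begin

text \<open>\<open>(m r)\<^sup>*\<close> is strongly continuous on the dense set \<open>K(X) X\<close>, because
  \<open>(m r)\<^sup>* T\<^sup>* = (T m r)\<^sup>*\<close>.\<close>

lemma strongly_bounded_adjoint:
  assumes m: "m \<in> Cb_strict X"
  shows "strongly_bounded (\<lambda>r. adjoint self_corr X (m r))"
proof -
  interpret mul: hilbert_pair self_corr X by unfold_locales
  have mr: "m r \<in> adjointable self_corr X" for r using m by (simp add: Cb_strict_iff multipliers_def)
  obtain B where B: "B > 0" "\<And>r. norm (m r) \<le> B"
    using m strongly_boundedE[of m] unfolding Cb_strict_iff by metis
  have le: "norm (adjoint self_corr X (m r)) \<le> 4 * B" for r
    using mul.norm_adjoint_le[OF mr, of r] B(2)[of r] by linarith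
  show ?thesis
  proof (rule strongly_boundedI[OF le])
    fix v r
    show "((\<lambda>s. blinfun_apply (adjoint self_corr X (m s)) v) \<longlongrightarrow> blinfun_apply (adjoint self_corr X (m r)) v) (at r)"
    proof (rule tendsto_on_closure_span[where V = "\<lambda>s v. blinfun_apply (adjoint self_corr X (m s)) v"
          and W = "\<lambda>v. blinfun_apply (adjoint self_corr X (m r)) v"
          and S = "{ract X x (ip X y z) |x y z. True}" and B = "4 * B"])
      show "\<forall>\<^sub>F s in at r. \<forall>v. norm (blinfun_apply (adjoint self_corr X (m s)) v) \<le> 4 * B * norm v"
        using order_trans[OF norm_blinfun mult_right_mono[OF le]] by (intro always_eventually allI) simp
      show "v \<in> closure (span {ract X x (ip X y z) |x y z. True})" unfolding ract_ip_dense by simp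
      fix w assume "w \<in> {ract X x (ip X y z) |x y z. True}"
      then obtain x y z where w: "w = ract X x (ip X y z)" by blast
      let ?D = "\<lambda>s. (theta y x o\<^sub>L m s) - (theta y x o\<^sub>L m r)"
      let ?e = "\<lambda>s. blinfun_apply (adjoint self_corr X (m s)) w - blinfun_apply (adjoint self_corr X (m r)) w"
      have "theta y x \<in> compacts X" by (rule theta_compact)
      then have "((\<lambda>s. theta y x o\<^sub>L m s) \<longlongrightarrow> theta y x o\<^sub>L m r) (at r)"
        using m by (simp add: Cb_strict_iff continuous_on_def)
      then have "(?D \<longlongrightarrow> 0) (at r)" by (rule LIM_zero)
      then have "(?e \<longlongrightarrow> 0) (at r)"
      proof (rule tendsto_0_le)
        have "norm (?e s) \<le> norm (?D s) * (4 * norm z)" for s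
        proof -
          have ad: "ip X (ract X y (ip X x v)) z = ip X v w" for v
            by (simp add: w ip_ract_left ip_ract_right star_ip)
          have "ip X (blinfun_apply (?D s) a) z = ip self_corr a (?e s)" for a
            unfolding self.ip.diff_right mul.ip_adjoint[OF mr, symmetric]
            by (simp only: blinfun.diff_left blinfun_apply_blinfun_compose theta_apply ip.diff_left ad)
          then have "norm (?e s) * norm (?e s) = norm (ip X (blinfun_apply (?D s) (?e s)) z)"
            using self.norm_ip_self[of "?e s"] by (simp add: power2_eq_square)
          also have "\<dots> \<le> norm (blinfun_apply (?D s) (?e s)) * norm z * 4" by (rule norm_ip_le)
          also have "\<dots> \<le> (norm (?D s) * norm (?e s)) * norm z * 4"
            by (intro mult_right_mono norm_blinfun) auto
          finally have "norm (?e s) * norm (?e s) \<le> (norm (?D s) * (4 * norm z)) * norm (?e s)"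
            by (simp add: mult_ac)
          then show ?thesis by (cases "norm (?e s) = 0") (simp_all add: mult_le_cancel_right)
        qed
        then show "\<forall>\<^sub>F s in at r. norm (?e s) \<le> norm (?D s) * (4 * norm z)" by simp
      qed
      then show "((\<lambda>s. blinfun_apply (adjoint self_corr X (m s)) w) \<longlongrightarrow> blinfun_apply (adjoint self_corr X (m r)) w) (at r)"
        by (rule LIM_zero_cancel)
    qed (auto simp: blinfun.bounded_linear_right bounded_linear.linear)
  qed
qed

text \<open>For a rank-one operator, \<open>theta x y\<close> composed with m r is a \<mapsto> x
  (star (n r y)) a, so strong continuity of n gives norm continuity; the bound on m extends it to
  all compact operators.\<close>

lemma Cb_strictI:
  assumes m: "strongly_bounded m" and n: "strongly_bounded n"
    and adj: "\<And>r a x. ip X (blinfun_apply (m r) a) x = star a * blinfun_apply (n r) x"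
  shows "m \<in> Cb_strict X"
proof -
  interpret mul: hilbert_pair self_corr X by unfold_locales
  obtain B where B: "B > 0" "\<And>r. norm (m r) \<le> B" using strongly_boundedE[OF m] by metis
  have adj': "ip X x (blinfun_apply (m r) a) = star (blinfun_apply (n r) x) * a" for r a x
    using arg_cong[OF adj[of r a x], of star] by (simp add: star_ip)
  have "m r \<in> multipliers X" for r
    unfolding multipliers_def by (rule mul.adjointableI[where S = "n r"]) (simp add: adj)
  moreover have "continuous_on UNIV (\<lambda>r. T o\<^sub>L m r)" if T: "T \<in> compacts X" for T
    unfolding continuous_on_def
  proof
    fix r
    show "((\<lambda>s. T o\<^sub>L m s) \<longlongrightarrow> T o\<^sub>L m r) (at r)"
    proof (rule tendsto_on_closure_span[where V = "\<lambda>s T. T o\<^sub>L m s" and W = "\<lambda>T. T o\<^sub>L m r"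
          and S = "{theta x y |x y. True}" and B = B])
      show "\<forall>\<^sub>F s in at r. \<forall>T :: 'x \<Rightarrow>\<^sub>L 'x. norm (T o\<^sub>L m s) \<le> B * norm T"
      proof (intro always_eventually allI)
        fix s and T :: "'x \<Rightarrow>\<^sub>L 'x"
        have "norm (T o\<^sub>L m s) \<le> norm T * norm (m s)" by (rule norm_blinfun_compose)
        also have "\<dots> \<le> norm T * B" by (intro mult_left_mono B) simp
        finally show "norm (T o\<^sub>L m s) \<le> B * norm T" by (simp add: mult.commute)
      qed
      show "T \<in> closure (span {theta x y |x y. True})" using T by (simp add: compacts_eq)
      fix R assume "R \<in> {theta x y |x y. True}"
      then obtain x y where R: "R = theta x y" by blast
      have "((\<lambda>s. blinfun_apply (n s) y) \<longlongrightarrow> blinfun_apply (n r) y) (at r)"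
        using n by (simp add: strongly_bounded_def continuous_on_def)
      then have "((\<lambda>s. blinfun_apply (n s) y - blinfun_apply (n r) y) \<longlongrightarrow> 0) (at r)" by (rule LIM_zero)
      then have "((\<lambda>s. (R o\<^sub>L m s) - (R o\<^sub>L m r)) \<longlongrightarrow> 0) (at r)"
      proof (rule tendsto_0_le)
        have "norm ((R o\<^sub>L m s) - (R o\<^sub>L m r)) \<le> norm (blinfun_apply (n s) y - blinfun_apply (n r) y) * norm x" for s
        proof (rule norm_blinfun_bound)
          fix a
          let ?d = "blinfun_apply (n s) y - blinfun_apply (n r) y"
          have "blinfun_apply ((R o\<^sub>L m s) - (R o\<^sub>L m r)) a = ract X x (star ?d * a)"
            by (simp add: R blinfun.diff_left adj' ract.diff_right left_diff_distrib)
          also have "norm \<dots> \<le> norm x * norm (star ?d * a)" by (rule norm_ract_le)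
          also have "\<dots> \<le> norm x * (norm ?d * norm a)"
            using norm_mult_ineq[of "star ?d" a] by (intro mult_left_mono) (simp_all del: star_simps)
          finally show "norm (blinfun_apply ((R o\<^sub>L m s) - (R o\<^sub>L m r)) a) \<le> norm ?d * norm x * norm a"
            by (simp add: mult_ac)
        qed simp
        then show "\<forall>\<^sub>F s in at r. norm ((R o\<^sub>L m s) - (R o\<^sub>L m r)) \<le> norm (blinfun_apply (n s) y - blinfun_apply (n r) y) * norm x"
          by simp
      qed
      then show "((\<lambda>s. R o\<^sub>L m s) \<longlongrightarrow> R o\<^sub>L m r) (at r)" by (rule LIM_zero_cancel)
    qed (auto intro!: bounded_linear.linear bounded_bilinear.bounded_linear_left[OF bounded_bilinear_blinfun_compose])
  qed
  ultimately show ?thesis using m by (simp add: Cb_strict_iff)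
qed

end

text \<open>On vectors phi a x the extension is phi (l r a) x, which is continuous in r;
  nondegeneracy and the uniform bound do the rest.\<close>

lemma (in nondegenerate_corresp) strongly_bounded_strict_ext:
  fixes l :: "'g::topological_space \<Rightarrow> 'a \<Rightarrow>\<^sub>L 'a"
  assumes l: "l \<in> Cb_strict self_corr"
  shows "strongly_bounded (\<lambda>r. strict_ext X (l r))"
proof -
  have lr: "l r \<in> multipliers self_corr" for r using l by (simp add: Cb_strict_iff)
  obtain B where B: "B > 0" "\<And>r. norm (l r) \<le> B"
    using l strongly_boundedE[of l] unfolding Cb_strict_iff by metis
  have le: "norm (strict_ext X (l r)) \<le> 8 * B" for r
    using norm_strict_ext_le[OF lr, of r] B(2)[of r] by linarith
  show ?thesis
  proof (rule strongly_boundedI[OF le])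
    fix v r
    show "((\<lambda>s. blinfun_apply (strict_ext X (l s)) v) \<longlongrightarrow> blinfun_apply (strict_ext X (l r)) v) (at r)"
    proof (rule tendsto_on_closure_span[where V = "\<lambda>s v. blinfun_apply (strict_ext X (l s)) v"
          and W = "\<lambda>v. blinfun_apply (strict_ext X (l r)) v"
          and S = "{blinfun_apply (phi X a) x |a x. True}" and B = "8 * B"])
      show "\<forall>\<^sub>F s in at r. \<forall>v. norm (blinfun_apply (strict_ext X (l s)) v) \<le> 8 * B * norm v"
        using order_trans[OF norm_blinfun mult_right_mono[OF le]] by (intro always_eventually allI) simp
      show "v \<in> closure (span {blinfun_apply (phi X a) x |a x. True})" unfolding phi_dense by simp
      fix w assume "w \<in> {blinfun_apply (phi X a) x |a x. True}"
      then obtain a x where w: "w = blinfun_apply (phi X a) x" by blast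
      have "((\<lambda>s. blinfun_apply (l s) a) \<longlongrightarrow> blinfun_apply (l r) a) (at r)"
        using l by (simp add: Cb_strict_iff strongly_bounded_def continuous_on_def)
      then show "((\<lambda>s. blinfun_apply (strict_ext X (l s)) w) \<longlongrightarrow> blinfun_apply (strict_ext X (l r)) w) (at r)"
        unfolding w strict_ext_phi[OF lr]
        by (rule bounded_bilinear.tendsto[OF bounded_bilinear_phi _ tendsto_const])
    qed (auto simp: blinfun.bounded_linear_right bounded_linear.linear)
  qed
qed

section \<open>The isomorphism\<close>

lemma (in c0_min_tensor) c0_exterior_self: "c0_exterior self_corr t self_corr t"
  by unfold_locales (rule exterior_tensor_self)

context c0_exterior
begin

lemma Jt_star_mult: "star (Jt f) * Jt g = Jt (star f * g)"
proof -
  interpret T: c0_exterior self_corr t self_corr t by (rule c0_exterior_self)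
  have "c0_map2 (ip self_corr) f g = star f * g"
    by (rule c0_eqI) (simp add: c0_map2_apply[OF self.bounded_bilinear_ip] c0_rep_eq)
  then show ?thesis using T.ip_Ju[of f g] by simp
qed

lemma Jt_scaleC: "Jt (c *\<^sub>C f) = c *\<^sub>C Jt f"
proof -
  interpret T: c0_exterior self_corr t self_corr t by (rule c0_exterior_self)
  show ?thesis by (rule T.Ju_scaleC)
qed

lemma psi_apply:
  assumes "strongly_bounded m"
  shows "blinfun_apply (psi t u m) (Jt f) = Ju (pw m f)"
  unfolding psi_eq by (rule pw_op_apply[OF c0_tensor_t(1) c0_tensor_u assms])

lemma psi_eqI:
  assumes "strongly_bounded m" "\<And>f. Ju (pw m f) = blinfun_apply S (Jt f)"
  shows "psi t u m = S"
proof (rule blinfun_eqI)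
  fix c
  obtain f where "c = Jt f" using surj_Jt by (metis surj_def)
  then show "blinfun_apply (psi t u m) c = blinfun_apply S c" using psi_apply[OF assms(1)] assms(2) by simp
qed

lemma psi_add:
  assumes m: "strongly_bounded m" and n: "strongly_bounded n"
  shows "psi t u (\<lambda>r. m r + n r) = psi t u m + psi t u n"
proof (rule psi_eqI)
  show mn: "strongly_bounded (\<lambda>r. m r + n r)" by (rule strongly_bounded_add[OF m n])
  fix f
  have "pw (\<lambda>r. m r + n r) f = pw m f + pw n f"
    by (rule c0_eqI) (simp add: pw_apply[OF m] pw_apply[OF n] pw_apply[OF mn] c0_rep_eq blinfun.add_left)
  then show "Ju (pw (\<lambda>r. m r + n r) f) = blinfun_apply (psi t u m + psi t u n) (Jt f)"
    using linear_add[OF bounded_linear.linear[OF bounded_linear_Ju]]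
    by (simp add: psi_apply m n blinfun.add_left)
qed

lemma psi_scaleC:
  assumes m: "strongly_bounded m"
  shows "psi t u (\<lambda>r. c *\<^sub>C m r) = c *\<^sub>C psi t u m"
proof (rule psi_eqI)
  show cm: "strongly_bounded (\<lambda>r. c *\<^sub>C m r)" by (rule strongly_bounded_scaleC[OF m])
  fix f
  have "pw (\<lambda>r. c *\<^sub>C m r) f = c *\<^sub>C pw m f"
    by (rule c0_eqI) (simp add: pw_apply[OF m] pw_apply[OF cm] c0_rep_eq scaleC_blinfun.rep_eq)
  then show "Ju (pw (\<lambda>r. c *\<^sub>C m r) f) = blinfun_apply (c *\<^sub>C psi t u m) (Jt f)"
    by (simp add: psi_apply m scaleC_blinfun.rep_eq Ju_scaleC)
qed

text \<open>Adjoints are taken fibrewise: after the identifications both sides are the function with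
  value <m r (f r), g r> at r.\<close>

lemma ip_psi:
  assumes m: "m \<in> Cb_strict X"
  shows "ip XG (blinfun_apply (psi t u m) c) z =
    ip self_corr c (blinfun_apply (pw_op Ju Jt (\<lambda>r. adjoint self_corr X (m r))) z)"
proof -
  interpret mul: hilbert_pair self_corr X by unfold_locales
  have mr: "m r \<in> adjointable self_corr X" and sb: "strongly_bounded m" for r
    using m by (simp_all add: Cb_strict_iff multipliers_def)
  note ad = strongly_bounded_adjoint[OF m]
  obtain f where c: "c = Jt f" using surj_Jt by (metis surj_def)
  obtain g where z: "z = Ju g" using surj_Ju by (metis surj_def)
  have "c0_map2 (ip X) (pw m f) g = star f * pw (\<lambda>r. adjoint self_corr X (m r)) g"
    by (rule c0_eqI)
      (simp add: c0_map2_apply[OF bounded_bilinear_ip] pw_apply[OF sb] pw_apply[OF ad] c0_rep_eq mul.ip_adjoint[OF mr])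
  then show ?thesis
    by (simp add: c z psi_apply[OF sb] ip_Ju pw_op_apply[OF c0_tensor_u c0_tensor_t(1) ad] Jt_star_mult)
qed

lemma psi_multiplier: "m \<in> Cb_strict X \<Longrightarrow> psi t u m \<in> multipliers XG"
  and adjoint_psi: "m \<in> Cb_strict X \<Longrightarrow>
    adjoint self_corr XG (psi t u m) = pw_op Ju Jt (\<lambda>r. adjoint self_corr X (m r))"
proof -
  interpret mul: hilbert_pair self_corr XG by unfold_locales
  show "m \<in> Cb_strict X \<Longrightarrow> psi t u m \<in> multipliers XG"
    unfolding multipliers_def by (rule mul.adjointableI) (rule ip_psi)
  show "m \<in> Cb_strict X \<Longrightarrow> adjoint self_corr XG (psi t u m) = pw_op Ju Jt (\<lambda>r. adjoint self_corr X (m r))"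
    by (rule mul.adjoint_eqI) (rule ip_psi)
qed

lemma inj_on_psi: "inj_on (psi t u) (Cb_strict X)"
proof (rule inj_onI)
  fix m n assume mn: "m \<in> Cb_strict X" "n \<in> Cb_strict X" "psi t u m = psi t u n"
  then have sb: "strongly_bounded m" "strongly_bounded n" by (simp_all add: Cb_strict_iff)
  have pw: "pw m f = pw n f" for f
    using psi_apply[OF sb(1), of f] psi_apply[OF sb(2), of f] mn(3) inj_Ju by (simp add: inj_eq)
  show "m = n"
  proof (rule ext, rule blinfun_eqI)
    fix r a
    obtain \<beta> :: "('g, complex) c0" where \<beta>: "c0_apply \<beta> r = 1" using ex_unit_bump[OF lc] by metis
    show "blinfun_apply (m r) a = blinfun_apply (n r) a"
      using arg_cong[OF pw[of "c0_elem a \<beta>"], of "\<lambda>f. c0_apply f r"]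
      by (simp add: pw_apply[OF sb(1)] pw_apply[OF sb(2)] \<beta>)
  qed
qed

text \<open>N and its adjoint are both made fibrewise. The resulting families m and n are fibrewise
  adjoint to each other, and their strong continuity is what \<open>Cb_strictI\<close> turns into
  strict continuity.\<close>

lemma ex_psi_eq:
  assumes N: "N \<in> multipliers XG"
  shows "\<exists>m\<in>Cb_strict X. psi t u m = N"
proof -
  interpret mul: hilbert_pair self_corr XG by unfold_locales
  interpret mul': hilbert_pair XG self_corr by unfold_locales
  define N' where "N' = adjoint self_corr XG N"
  have N: "N \<in> adjointable self_corr XG" using assms by (simp add: multipliers_def)
  have N': "N' \<in> adjointable XG self_corr"
    unfolding N'_def by (rule adjoint_adjointable(1)[OF hilbert_module_self_corr Z.hilbert_module N])
  define M where "M f = inv Ju (blinfun_apply N (Jt f))" for f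
  define M' where "M' \<xi> = inv Jt (blinfun_apply N' (Ju \<xi>))" for \<xi>
  have JM: "Ju (M f) = blinfun_apply N (Jt f)" and JM': "Jt (M' \<xi>) = blinfun_apply N' (Ju \<xi>)" for f \<xi>
    by (simp_all add: M_def M'_def surj_f_inv_f surj_Ju surj_Jt)
  have bl: "bounded_linear M" "bounded_linear M'"
    unfolding M_def M'_def
    by (rule bounded_linear_compose[OF bounded_linear_inv bounded_linear_compose[OF blinfun.bounded_linear_right]]
        c0_tensor_u c0_tensor_t bounded_linear_Ju bounded_linear_Jt)+
  have sc: "M (c *\<^sub>C f) = c *\<^sub>C M f" for c f
    by (rule injD[OF inj_Ju]) (simp add: JM Ju_scaleC Jt_scaleC mul.adjointable_scaleC[OF N])
  have sc': "M' (c *\<^sub>C f) = c *\<^sub>C M' f" for c f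
    by (rule injD[OF inj_Jt]) (simp add: JM' Ju_scaleC Jt_scaleC mul'.adjointable_scaleC[OF N'])
  \<comment> \<open>Injectivity of Jt turns the adjoint relation into an identity between functions,
    which can be evaluated at r.\<close>
  have fib: "ip X (c0_apply (M f) r) (c0_apply \<xi> r) = star (c0_apply f r) * c0_apply (M' \<xi>) r" for f \<xi> r
  proof -
    have "Jt (c0_map2 (ip X) (M f) \<xi>) = Jt (star f * M' \<xi>)"
      unfolding ip_Ju[symmetric] Jt_star_mult[symmetric] JM JM'
      using mul.ip_adjoint[OF N, of "Jt f" "Ju \<xi>"] by (simp add: N'_def)
    then have "c0_map2 (ip X) (M f) \<xi> = star f * M' \<xi>" by (rule injD[OF inj_Jt])
    from arg_cong[OF this, of "\<lambda>h. c0_apply h r"] show ?thesis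
      by (simp add: c0_map2_apply[OF bounded_bilinear_ip] c0_rep_eq)
  qed
  have fib_value: "\<exists>f :: ('g, 'v::cbanach) c0. c0_apply f r = v" for r v
  proof -
    obtain \<beta> :: "('g, complex) c0" where \<beta>: "c0_apply \<beta> r = 1" using ex_unit_bump[OF lc] by metis
    then show ?thesis by (intro exI[of _ "c0_elem v \<beta>"]) simp
  qed
  \<comment> \<open>Every vector x is the value at r of some \<xi>, so \<open>fib\<close> determines
    M f at r from the value of f at r.\<close>
  have loc: "c0_apply (M f) r = c0_apply (M f') r" if "c0_apply f r = c0_apply f' r" for f f' r
  proof (rule eq_if_ip_eq_left)
    fix x
    obtain \<xi> :: "('g, 'x) c0" where "c0_apply \<xi> r = x" using fib_value by metis
    then show "ip X (c0_apply (M f) r) x = ip X (c0_apply (M f') r) x"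
      using fib[of f r \<xi>] fib[of f' r \<xi>] that by simp
  qed
  have loc': "c0_apply (M' \<xi>) r = c0_apply (M' \<xi>') r" if "c0_apply \<xi> r = c0_apply \<xi>' r" for \<xi> \<xi>' r
  proof (rule self.eq_if_ip_eq_right)
    fix a
    obtain f :: "('g, 'a) c0" where "c0_apply f r = a" using fib_value by metis
    then show "ip self_corr a (c0_apply (M' \<xi>) r) = ip self_corr a (c0_apply (M' \<xi>') r)"
      using fib[of f r \<xi>] fib[of f r \<xi>'] that by simp
  qed
  obtain m where m: "strongly_bounded m" "\<And>f r. c0_apply (M f) r = blinfun_apply (m r) (c0_apply f r)"
    using fibrewise_operator[OF lc bl(1) sc loc] by metis
  obtain n where n: "strongly_bounded n" "\<And>f r. c0_apply (M' f) r = blinfun_apply (n r) (c0_apply f r)"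
    using fibrewise_operator[OF lc bl(2) sc' loc'] by metis
  have "ip X (blinfun_apply (m r) a) x = star a * blinfun_apply (n r) x" for r a x
  proof -
    obtain f :: "('g, 'a) c0" and \<xi> :: "('g, 'x) c0" where "c0_apply f r = a" "c0_apply \<xi> r = x"
      using fib_value by metis
    then show ?thesis using fib[of f r \<xi>] by (simp add: m(2) n(2))
  qed
  then have "m \<in> Cb_strict X" by (rule Cb_strictI[OF m(1) n(1)])
  moreover have "psi t u m = N"
  proof (rule psi_eqI[OF m(1)])
    fix f
    have "pw m f = M f" by (rule c0_eqI) (simp add: pw_apply[OF m(1)] m(2))
    then show "Ju (pw m f) = blinfun_apply N (Jt f)" by (simp add: JM)
  qed
  ultimately show ?thesis by blast
qed

lemma bij_betw_psi: "bij_betw (psi t u) (Cb_strict X) (multipliers XG)"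
  unfolding bij_betw_def using inj_on_psi psi_multiplier ex_psi_eq by (auto simp: image_def)

lemma psi_ip:
  assumes m: "m \<in> Cb_strict X" and n: "n \<in> Cb_strict X"
  shows "psi t t (\<lambda>r. adjoint self_corr X (m r) o\<^sub>L n r) = adjoint self_corr XG (psi t u m) o\<^sub>L psi t u n"
  unfolding adjoint_psi[OF m] unfolding psi_eq
  by (rule pw_op_compose[OF c0_tensor_t(1) c0_tensor_u c0_tensor_t(1) strongly_bounded_adjoint[OF m]])
    (use n in \<open>simp add: Cb_strict_iff\<close>)

text \<open>An operator on XG is determined on the vectors phi c z; with c = Jt g and z = Ju
  \<zeta>, both sides become the function phi (l r (g r)) (\<zeta> r).\<close>

lemma strict_ext_psi:
  assumes l: "l \<in> Cb_strict self_corr"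
  shows "strict_ext XG (psi t t l) = pw_op Ju Ju (\<lambda>r. strict_ext X (l r))"
proof (rule Z.blinfun_eq_on_phi)
  interpret T: c0_exterior self_corr t self_corr t by (rule c0_exterior_self)
  fix c z
  have lr: "l r \<in> multipliers self_corr" and sb: "strongly_bounded l" for r using l by (simp_all add: Cb_strict_iff)
  note k = strongly_bounded_strict_ext[OF l]
  obtain g where c: "c = Jt g" using surj_Jt by (metis surj_def)
  obtain \<zeta> where z: "z = Ju \<zeta>" using surj_Ju by (metis surj_def)
  have "c0_map2 (\<lambda>a. blinfun_apply (phi X a)) (pw l g) \<zeta> =
    pw (\<lambda>r. strict_ext X (l r)) (c0_map2 (\<lambda>a. blinfun_apply (phi X a)) g \<zeta>)"
    by (rule c0_eqI)
      (simp add: c0_map2_apply[OF bounded_bilinear_phi] pw_apply[OF sb] pw_apply[OF k] strict_ext_phi[OF lr])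
  then show "blinfun_apply (strict_ext XG (psi t t l)) (blinfun_apply (phi XG c) z) =
    blinfun_apply (pw_op Ju Ju (\<lambda>r. strict_ext X (l r))) (blinfun_apply (phi XG c) z)"
    unfolding Z.strict_ext_phi[OF T.psi_multiplier[OF l]]
    unfolding c z T.psi_apply[OF sb] phi_Ju
      pw_op_apply[OF c0_tensor_u c0_tensor_u k] by simp
qed

lemma psi_left_action:
  assumes l: "l \<in> Cb_strict self_corr" and m: "m \<in> Cb_strict X"
  shows "psi t u (\<lambda>r. strict_ext X (l r) o\<^sub>L m r) = strict_ext XG (psi t t l) o\<^sub>L psi t u m"
  unfolding strict_ext_psi[OF l] unfolding psi_eq
  by (rule pw_op_compose[OF c0_tensor_t(1) c0_tensor_u c0_tensor_u strongly_bounded_strict_ext[OF l]])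
    (use m in \<open>simp add: Cb_strict_iff\<close>)

text \<open>The instance X = A, u = t supplies bijectivity, linearity and adjoints; multiplicativity
  is composition of pointwise operators.\<close>

lemma star_iso_psi: "star_iso Cb_alg mult_alg (psi t t :: ('g \<Rightarrow> 'a \<Rightarrow>\<^sub>L 'a) \<Rightarrow> _)"
proof -
  interpret T: c0_exterior self_corr t self_corr t by (rule c0_exterior_self)
  have sb: "strongly_bounded l" if "l \<in> Cb_strict self_corr" for l :: "'g \<Rightarrow> 'a \<Rightarrow>\<^sub>L 'a"
    using that by (simp add: Cb_strict_iff)
  have "psi t t (\<lambda>r. l r o\<^sub>L k r) = psi t t l o\<^sub>L psi t t k"
    if "l \<in> Cb_strict self_corr" "k \<in> Cb_strict self_corr" for l k :: "'g \<Rightarrow> 'a \<Rightarrow>\<^sub>L 'a"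
    unfolding psi_eq by (rule pw_op_compose[OF c0_tensor_t(1) c0_tensor_t(1) c0_tensor_t(1) sb sb]) (rule that)+
  moreover have "psi t t (\<lambda>r. adjoint self_corr self_corr (l r)) = adjoint self_corr self_corr (psi t t l)"
    if "l \<in> Cb_strict self_corr" for l :: "'g \<Rightarrow> 'a \<Rightarrow>\<^sub>L 'a"
    using T.adjoint_psi[OF that] by (simp add: psi_eq)
  ultimately show ?thesis
    unfolding star_iso_def Cb_alg_def mult_alg_def
    using T.bij_betw_psi by (simp add: T.psi_add T.psi_scaleC sb)
qed

lemma corr_iso_psi: "corr_iso (Cb_corr X) (mult_corr XG) (psi t u) (psi t t)"
proof -
  have sb: "strongly_bounded m" if "m \<in> Cb_strict X" for m :: "'g \<Rightarrow> 'a \<Rightarrow>\<^sub>L 'x"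
    using that by (simp add: Cb_strict_iff)
  show ?thesis
    unfolding corr_iso_def
  proof (intro conjI)
    show "star_iso (coeffs (Cb_corr X)) (coeffs (mult_corr XG)) (psi t t :: ('g \<Rightarrow> _) \<Rightarrow> _)"
      using star_iso_psi by (simp add: Cb_corr_def mult_corr_def)
  qed (simp_all add: Cb_corr_def mult_corr_def bij_betw_psi psi_add psi_scaleC sb psi_ip Cb_alg_def psi_left_action)
qed

end

text \<open>\<open>pw\<close> and \<open>psi\<close> are built with \<open>Abs_c0\<close> and
  \<open>Blinfun\<close>, which have unspecified values on unsuitable arguments. The first two
  conjuncts therefore also assert that the pointwise products vanish at infinity and that
  \<open>psi\<close> really acts by them.\<close>

theorem theoremA4:
  fixes X :: "('x::cbanach, 'a::cstar_algebra) corr"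
    and t :: "'a \<Rightarrow> ('g::t2_space, complex) c0 \<Rightarrow> 'c::cstar_algebra"
    and XG :: "('z::cbanach, 'c) corr"
    and u :: "'x \<Rightarrow> ('g, complex) c0 \<Rightarrow> 'z"
  assumes "correspondence X" and "nondegenerate X"
    and "locally_compact_space (euclidean :: 'g topology)"
    and "min_tensor t"
    and "exterior_tensor X self_corr XG t u"
  shows "(\<forall>m\<in>Cb_strict X. \<forall>f :: ('g, 'a) c0.
            (\<forall>r. c0_apply (pw m f) r = m r (c0_apply f r)) \<and>
            psi t u m (c0_tensor t f) = c0_tensor u (pw m f)) \<and>
         (\<forall>l\<in>Cb_strict self_corr. \<forall>f :: ('g, 'a) c0.
            (\<forall>r. c0_apply (pw l f) r = l r (c0_apply f r)) \<and>
            psi t t l (c0_tensor t f) = c0_tensor t (pw l f)) \<and>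
         corr_iso (Cb_corr X) (mult_corr XG) (psi t u) (psi t t)"
proof -
  interpret c0_exterior X t XG u
    using assms by unfold_locales (simp_all add: correspondence_def)
  interpret T: c0_exterior self_corr t self_corr t by (rule c0_exterior_self)
  show ?thesis
    using corr_iso_psi by (simp add: Cb_strict_iff pw_apply psi_apply T.psi_apply)
qed

end
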